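(* Let $N\ge1$ be an integer. For any non-negative integer $r$, the average number of intersection points of two curves $f,g$ from the unit ball of $V_N$ in the $W_2^r$ metric (i.e. the average over the product of two copies of this unit ball with respect to the Euclidean volume) is equal to $$\frac{2^{8N+3}\,(\lambda_r(N))^2\,((2N)!)^4\,(2N+1)}{\mu(N)\,((4N+1)!)^2}.$$
   Context: For a natural number $N$, let $V_N$ be the $2(2N+1)$-dimensional real vector space of maps $f=(x,y):S^1=\mathbb{R}/2\pi\mathbb{Z}\to\mathbb{R}^2$ whose two components are trigonometric polynomials of degree $\le N$: $x(\varphi)=a_0+\sum_{j=1}^N(a_j\cos j\varphi+b_j\sin j\varphi)$, $y(\varphi)=\tilde a_0+\sum_{j=1}^N(\tilde a_j\cos j\varphi+\tilde b_j\sin j\varphi)$, with real coefficients. Equip $V_N$ with the $W_2^r$ Euclidean structure in which the dot product of $(x_1,y_1)$ and $(x_2,y_2)$ is $$\frac1\pi\int_0^{2\pi}\sum_{q=0}^r\left(x_1^{(q)}(\varphi)x_2^{(q)}(\varphi)+y_1^{(q)}(\varphi)y_2^{(q)}(\varphi)\right)d\varphi,$$ where $^{(q)}$ denotes the $q$-th derivative; equivalently, the squared norm of $f$ is $2(a_0^2+\tilde a_0^2)+\sum_{j=1}^N\tau_j(a_j^2+b_j^2+\tilde a_j^2+\tilde b_j^2)$, where $\tau_j=1+j^2+j^4+\cdots+j^{2r}$ (a sum of $r+1$ terms). Further notation (depending on $r$): $$\mu(N)=1+2\sum_{j=1}^N\frac1{\tau_j},\qquad \lambda_r(N)=\left(\sum_{j=1}^N\frac{j^2}{\tau_j}\right)^{1/2}.$$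 The number of intersection points of a pair of curves $(f,g)$ is the number of pairs $(\varphi,\psi)\in S^1\times S^1$ with $f(\varphi)=g(\psi)$; for almost all pairs this is finite and agrees with the number of common points of the two plane curves. *)

theory Defs
  imports "HOL-Analysis.Analysis"
begin

definition trig_poly :: "nat \<Rightarrow> (nat \<Rightarrow> real) \<Rightarrow> (nat \<Rightarrow> real) \<Rightarrow> real \<Rightarrow> real" where
  "trig_poly N a b \<phi> = a 0 + (\<Sum>j=1..N. a j * cos (real j * \<phi>) + b j * sin (real j * \<phi>))"

(* Maps on the circle R / 2 pi Z are rendered as 2 pi-periodic maps on the reals. *)
definition trig_curves :: "nat \<Rightarrow> (real \<Rightarrow> real \<times> real) set" where
  "trig_curves N = {f. \<exists>a b a' b'. f = (\<lambda>\<phi>. (trig_poly N a b \<phi>, trig_poly N a' b' \<phi>))}"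

definition W2_dot :: "nat \<Rightarrow> (real \<Rightarrow> real \<times> real) \<Rightarrow> (real \<Rightarrow> real \<times> real) \<Rightarrow> real" where
  "W2_dot r f g = 1 / pi * integral {0..2 * pi} (\<lambda>\<phi>. \<Sum>q=0..r.
      (deriv ^^ q) (fst \<circ> f) \<phi> * (deriv ^^ q) (fst \<circ> g) \<phi> +
      (deriv ^^ q) (snd \<circ> f) \<phi> * (deriv ^^ q) (snd \<circ> g) \<phi>)"

definition W2_unit_ball :: "nat \<Rightarrow> nat \<Rightarrow> (real \<Rightarrow> real \<times> real) set" where
  "W2_unit_ball r N = {f \<in> trig_curves N. sqrt (W2_dot r f f) \<le> 1}"

definition tau :: "nat \<Rightarrow> nat \<Rightarrow> real" where
  "tau r j = (\<Sum>q=0..r. real j ^ (2 * q))"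

definition mu :: "nat \<Rightarrow> nat \<Rightarrow> real" where
  "mu r N = 1 + 2 * (\<Sum>j=1..N. 1 / tau r j)"

definition lam :: "nat \<Rightarrow> nat \<Rightarrow> real" where
  "lam r N = sqrt (\<Sum>j=1..N. (real j)\<^sup>2 / tau r j)"

(* The orthonormal basis of scalar trigonometric polynomials for the Sobolev dot product,
   indexed by {-N..N}: cosines at positive, sines at negative indices. *)
definition frame :: "nat \<Rightarrow> int \<Rightarrow> real \<Rightarrow> real" where
  "frame r k \<phi> =
     (if k = 0 then 1 / sqrt 2
      else if k > 0 then cos (real (nat k) * \<phi>) / sqrt (tau r (nat k))
      else sin (real (nat (- k)) * \<phi>) / sqrt (tau r (nat (- k))))"

definition frame_curve ::
    "nat \<Rightarrow> nat \<Rightarrow> (int \<Rightarrow> real) \<times> (int \<Rightarrow> real) \<Rightarrow> real \<Rightarrow> real \<times> real" where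
  "frame_curve r N p = (\<lambda>\<phi>.
     (\<Sum>k\<in>{- int N..int N}. fst p k * frame r k \<phi>, \<Sum>k\<in>{- int N..int N}. snd p k * frame r k \<phi>))"

definition coord_space :: "nat \<Rightarrow> ((int \<Rightarrow> real) \<times> (int \<Rightarrow> real)) measure" where
  "coord_space N =
     (\<Pi>\<^sub>M k\<in>{- int N..int N}. lborel) \<Otimes>\<^sub>M (\<Pi>\<^sub>M k\<in>{- int N..int N}. lborel)"

(* Euclidean volume on trig_curves N: Lebesgue measure in orthonormal coordinates. The lemmas
   W2_dot_frame_curve, inj_on_frame_curve and space_W2_volume below show that frame_curve is a
   linear isometry of the coordinate space onto trig_curves N. *)
definition W2_volume :: "nat \<Rightarrow> nat \<Rightarrow> (real \<Rightarrow> real \<times> real) measure" where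
  "W2_volume r N = embed_measure (coord_space N) (frame_curve r N)"

(* Each point of the circle has exactly one representative in [0, 2 pi). The count is
   infinite when the set of parameter pairs is infinite. *)
definition intersection_number ::
    "(real \<Rightarrow> real \<times> real) \<Rightarrow> (real \<Rightarrow> real \<times> real) \<Rightarrow> ennreal" where
  "intersection_number f g = emeasure (count_space UNIV)
     {(\<phi>, \<psi>). \<phi> \<in> {0..<2 * pi} \<and> \<psi> \<in> {0..<2 * pi} \<and> f \<phi> = g \<psi>}"


lemma tau_pos: "tau r j > 0"
proof -
  have "tau r j = 1 + (\<Sum>q=1..r. real j ^ (2 * q))"
    unfolding tau_def by (subst sum.atLeast_Suc_atMost) auto
  moreover have "(\<Sum>q=1..r. real j ^ (2 * q)) \<ge> 0" by (intro sum_nonneg) auto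
  ultimately show ?thesis by simp
qed

definition frame_amp :: "nat \<Rightarrow> int \<Rightarrow> real" where
  "frame_amp r k = (if k = 0 then 1 / sqrt 2 else 1 / sqrt (tau r (nat \<bar>k\<bar>)))"

definition frame_phase :: "int \<Rightarrow> real" where
  "frame_phase k = (if k < 0 then - pi / 2 else 0)"

lemma frame_eq: "frame r k \<phi> = frame_amp r k * cos (real (nat \<bar>k\<bar>) * \<phi> + frame_phase k)"
  by (auto simp: frame_def frame_amp_def frame_phase_def cos_diff)

lemma higher_deriv_frame_sum:
  assumes "finite I"
  shows "(deriv ^^ q) (\<lambda>\<phi>. \<Sum>k\<in>I. c k * frame r k \<phi>) =
    (\<lambda>\<phi>. \<Sum>k\<in>I. c k * (frame_amp r k * real (nat \<bar>k\<bar>) ^ q *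
       cos (real (nat \<bar>k\<bar>) * \<phi> + frame_phase k + real q * (pi / 2))))"
proof (induction q)
  case 0
  show ?case by (simp add: frame_eq)
next
  case (Suc q)
  have *: "cos (x + real (Suc q) * (pi / 2)) = - sin (x + real q * (pi / 2))" for x
  proof -
    have "x + real (Suc q) * (pi / 2) = (x + real q * (pi / 2)) + pi / 2"
      by (simp add: field_simps)
    then show ?thesis by (simp only: cos_add cos_pi_half sin_pi_half)
  qed
  show ?case
    unfolding funpow.simps o_def Suc.IH
  proof (rule ext, rule DERIV_imp_deriv)
    fix \<phi>
    show "((\<lambda>\<phi>. \<Sum>k\<in>I. c k * (frame_amp r k * real (nat \<bar>k\<bar>) ^ q *
       cos (real (nat \<bar>k\<bar>) * \<phi> + frame_phase k + real q * (pi / 2)))) has_field_derivative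
      (\<Sum>k\<in>I. c k * (frame_amp r k * real (nat \<bar>k\<bar>) ^ Suc q *
       cos (real (nat \<bar>k\<bar>) * \<phi> + frame_phase k + real (Suc q) * (pi / 2))))) (at \<phi>)"
      unfolding *
      by (intro DERIV_sum) (auto intro!: derivative_eq_intros simp: algebra_simps)
  qed
qed

lemma has_integral_cos_phase:
  "((\<lambda>x. cos (real_of_int n * x + a)) has_integral (if n = 0 then 2 * pi * cos a else 0)) {0..2 * pi}"
proof (cases "n = 0")
  case True
  then show ?thesis using has_integral_const_real[of "cos a" 0 "2 * pi"] by simp
next
  case False
  have "((\<lambda>x. cos (real_of_int n * x + a)) has_integral
      (sin (real_of_int n * (2 * pi) + a) / real_of_int n - sin (real_of_int n * 0 + a) / real_of_int n))
      {0..2 * pi}"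
    using False
    by (intro fundamental_theorem_of_calculus)
       (auto intro!: derivative_eq_intros simp: has_real_derivative_iff_has_vector_derivative[symmetric])
  moreover have "sin (real_of_int n * (2 * pi) + a) = sin a"
    using sin_int_2pin[of n] cos_int_2pin[of n] by (simp add: sin_add mult.commute mult.left_commute)
  ultimately show ?thesis using False by simp
qed

lemma has_integral_cos_cos:
  "((\<lambda>x. cos (real m * x + a) * cos (real n * x + b)) has_integral
     (if m = n then (if m = 0 then 2 * pi * cos a * cos b else pi * cos (a - b)) else 0)) {0..2 * pi}"
proof -
  have eq: "cos (real m * x + a) * cos (real n * x + b) =
    (cos (real_of_int (int m - int n) * x + (a - b)) +
     cos (real_of_int (int m + int n) * x + (a + b))) / 2" for x
    by (subst cos_times_cos) (simp add: algebra_simps)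
  have "((\<lambda>x. (cos (real_of_int (int m - int n) * x + (a - b)) +
     cos (real_of_int (int m + int n) * x + (a + b))) / 2) has_integral
     ((if int m - int n = 0 then 2 * pi * cos (a - b) else 0) +
      (if int m + int n = 0 then 2 * pi * cos (a + b) else 0)) / 2) {0..2 * pi}"
    by (intro has_integral_divide has_integral_add has_integral_cos_phase)
  moreover have "((if int m - int n = 0 then 2 * pi * cos (a - b) else 0) +
      (if int m + int n = 0 then 2 * pi * cos (a + b) else 0)) / 2 =
     (if m = n then (if m = 0 then 2 * pi * cos a * cos b else pi * cos (a - b)) else 0)"
    by (auto simp: cos_add cos_diff algebra_simps)
  ultimately show ?thesis unfolding eq by simp
qed

lemma frame_term_integral:
  "((\<lambda>x. \<Sum>q=0..r.
      (frame_amp r k * real (nat \<bar>k\<bar>) ^ q * cos (real (nat \<bar>k\<bar>) * x + frame_phase k + real q * (pi / 2))) *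
      (frame_amp r l * real (nat \<bar>l\<bar>) ^ q * cos (real (nat \<bar>l\<bar>) * x + frame_phase l + real q * (pi / 2))))
    has_integral (if k = l then pi else 0)) {0..2 * pi}"
proof -
  define m n where "m = nat \<bar>k\<bar>" and "n = nat \<bar>l\<bar>"
  define J where "J q = (if m = n then (if m = 0 then 2 * pi * cos (frame_phase k + real q * (pi / 2)) *
      cos (frame_phase l + real q * (pi / 2)) else pi * cos (frame_phase k - frame_phase l)) else 0)" for q
  have "((\<lambda>x. \<Sum>q=0..r. (frame_amp r k * real m ^ q * frame_amp r l * real n ^ q) *
      (cos (real m * x + (frame_phase k + real q * (pi / 2))) *
       cos (real n * x + (frame_phase l + real q * (pi / 2)))))
     has_integral (\<Sum>q=0..r. (frame_amp r k * real m ^ q * frame_amp r l * real n ^ q) * J q)) {0..2 * pi}"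
  proof (intro has_integral_sum has_integral_mult_right)
    fix q
    show "((\<lambda>x. cos (real m * x + (frame_phase k + real q * (pi / 2))) *
       cos (real n * x + (frame_phase l + real q * (pi / 2)))) has_integral J q) {0..2 * pi}"
      using has_integral_cos_cos[of m "frame_phase k + real q * (pi / 2)" n "frame_phase l + real q * (pi / 2)"]
      unfolding J_def add_diff_cancel_right .
  qed auto
  moreover have "(\<Sum>q=0..r. (frame_amp r k * real m ^ q * frame_amp r l * real n ^ q) * J q) =
      (if k = l then pi else 0)"
  proof (cases "k = l")
    case True
    show ?thesis
    proof (cases "k = 0")
      case True
      have "(\<Sum>q=0..r. (frame_amp r k * real m ^ q * frame_amp r l * real n ^ q) * J q) =
          (\<Sum>q=0..r. if q = 0 then pi else 0)"
        by (intro sum.cong refl)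
          (auto simp: True \<open>k = l\<close>[symmetric] m_def n_def J_def frame_amp_def frame_phase_def
             zero_power field_simps)
      then show ?thesis using \<open>k = l\<close> by (simp add: sum.delta)
    next
      case False
      then have m: "m \<noteq> 0" "n = m" using \<open>k = l\<close> by (auto simp: m_def n_def)
      have amp: "frame_amp r k * frame_amp r l = 1 / tau r m"
        using False \<open>k = l\<close> tau_pos[of r m] by (simp add: frame_amp_def m_def)
      have "(frame_amp r k * real m ^ q * frame_amp r l * real n ^ q) * J q =
          frame_amp r k * frame_amp r l * (pi * real m ^ (2 * q))" for q
        using m \<open>k = l\<close> by (simp add: J_def mult_2 power_add)
      then have "(\<Sum>q=0..r. (frame_amp r k * real m ^ q * frame_amp r l * real n ^ q) * J q) =
          (\<Sum>q=0..r. pi / tau r m * real m ^ (2 * q))"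
        unfolding amp by simp
      also have "\<dots> = pi / tau r m * tau r m" by (simp add: tau_def sum_distrib_left)
      finally show ?thesis using tau_pos[of r m] \<open>k = l\<close> by simp
    qed
  next
    case False
    have "J q = 0" for q
    proof (cases "m = n")
      case True
      then have "k = - l" "k \<noteq> 0" using False by (auto simp: m_def n_def)
      then show ?thesis using True by (auto simp: J_def frame_phase_def m_def)
    qed (simp add: J_def)
    then show ?thesis using False by simp
  qed
  ultimately show ?thesis
    by (simp add: m_def n_def algebra_simps)
qed

lemma frame_sum_integral:
  assumes "finite I"
  shows "((\<lambda>x. \<Sum>q=0..r. (deriv ^^ q) (\<lambda>\<phi>. \<Sum>k\<in>I. c k * frame r k \<phi>) x *
        (deriv ^^ q) (\<lambda>\<phi>. \<Sum>k\<in>I. d k * frame r k \<phi>) x)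
     has_integral pi * (\<Sum>k\<in>I. c k * d k)) {0..2 * pi}"
proof -
  define T where "T k q x = frame_amp r k * real (nat \<bar>k\<bar>) ^ q *
      cos (real (nat \<bar>k\<bar>) * x + frame_phase k + real q * (pi / 2))" for k q x
  have "((\<lambda>x. \<Sum>k\<in>I. \<Sum>l\<in>I. (c k * d l) * (\<Sum>q=0..r. T k q x * T l q x)) has_integral
      (\<Sum>k\<in>I. \<Sum>l\<in>I. (c k * d l) * (if k = l then pi else 0))) {0..2 * pi}"
    unfolding T_def using assms
    by (intro has_integral_sum has_integral_mult_right frame_term_integral) auto
  moreover have "(\<Sum>k\<in>I. \<Sum>l\<in>I. (c k * d l) * (if k = l then pi else 0)) = pi * (\<Sum>k\<in>I. c k * d k)"
    using assms by (simp add: if_distrib sum_distrib_left mult.commute cong: if_cong)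
  moreover have "(\<Sum>q=0..r. (deriv ^^ q) (\<lambda>\<phi>. \<Sum>k\<in>I. c k * frame r k \<phi>) x *
        (deriv ^^ q) (\<lambda>\<phi>. \<Sum>k\<in>I. d k * frame r k \<phi>) x) =
      (\<Sum>k\<in>I. \<Sum>l\<in>I. (c k * d l) * (\<Sum>q=0..r. T k q x * T l q x))" for x
  proof -
    have "(\<Sum>q=0..r. (deriv ^^ q) (\<lambda>\<phi>. \<Sum>k\<in>I. c k * frame r k \<phi>) x *
        (deriv ^^ q) (\<lambda>\<phi>. \<Sum>k\<in>I. d k * frame r k \<phi>) x) =
      (\<Sum>q=0..r. \<Sum>k\<in>I. \<Sum>l\<in>I. (c k * d l) * (T k q x * T l q x))"
      unfolding higher_deriv_frame_sum[OF assms] T_def[symmetric] sum_product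
      by (simp add: mult_ac)
    also have "\<dots> = (\<Sum>k\<in>I. \<Sum>q=0..r. \<Sum>l\<in>I. (c k * d l) * (T k q x * T l q x))"
      by (rule sum.swap)
    also have "\<dots> = (\<Sum>k\<in>I. \<Sum>l\<in>I. \<Sum>q=0..r. (c k * d l) * (T k q x * T l q x))"
      by (intro sum.cong refl sum.swap)
    finally show ?thesis by (simp add: sum_distrib_left)
  qed
  ultimately show ?thesis by simp
qed

lemma W2_dot_frame_curve:
  "W2_dot r (frame_curve r N p) (frame_curve r N p') =
     (\<Sum>k\<in>{- int N..int N}. fst p k * fst p' k) + (\<Sum>k\<in>{- int N..int N}. snd p k * snd p' k)"
proof -
  let ?I = "{- int N..int N}"
  note i = frame_sum_integral[where I = ?I and r = r]
  have "integral {0..2 * pi} (\<lambda>\<phi>. \<Sum>q=0..r.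
      (deriv ^^ q) (fst \<circ> frame_curve r N p) \<phi> * (deriv ^^ q) (fst \<circ> frame_curve r N p') \<phi> +
      (deriv ^^ q) (snd \<circ> frame_curve r N p) \<phi> * (deriv ^^ q) (snd \<circ> frame_curve r N p') \<phi>) =
      pi * (\<Sum>k\<in>?I. fst p k * fst p' k) + pi * (\<Sum>k\<in>?I. snd p k * snd p' k)"
    unfolding frame_curve_def o_def fst_conv snd_conv sum.distrib
    by (intro integral_unique has_integral_add i) auto
  then show ?thesis by (simp add: W2_dot_def distrib_left[symmetric])
qed

lemma space_coord_space:
  "space (coord_space N) =
     ({- int N..int N} \<rightarrow>\<^sub>E UNIV) \<times> ({- int N..int N} \<rightarrow>\<^sub>E UNIV)"
  by (simp add: coord_space_def space_pair_measure space_PiM)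

lemma inj_on_frame_curve: "inj_on (frame_curve r N) (space (coord_space N))"
proof (rule inj_onI)
  fix p p' assume p: "p \<in> space (coord_space N)" and p': "p' \<in> space (coord_space N)"
    and eq: "frame_curve r N p = frame_curve r N p'"
  let ?I = "{- int N..int N}"
  have "(\<Sum>k\<in>?I. fst p k * fst s k) + (\<Sum>k\<in>?I. snd p k * snd s k) =
      (\<Sum>k\<in>?I. fst p' k * fst s k) + (\<Sum>k\<in>?I. snd p' k * snd s k)" for s
    unfolding W2_dot_frame_curve[of r, symmetric] eq ..
  note * = this[of "(\<lambda>k. if k = j then 1 else 0, \<lambda>_. 0)" for j]
    this[of "(\<lambda>_. 0, \<lambda>k. if k = j then 1 else 0)" for j]
  have "fst p k = fst p' k" "snd p k = snd p' k" if "k \<in> ?I" for k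
    using *[of k] that by (simp_all add: if_distrib cong: if_cong)
  then show "p = p'"
    using p p' unfolding space_coord_space
    by (intro prod_eqI; intro PiE_ext[where k = ?I and s = "\<lambda>_. UNIV"]) auto
qed

lemma sum_symmetric_interval:
  "(\<Sum>k\<in>{- int N..int N}. g k) = g 0 + (\<Sum>j=1..N. g (int j) + g (- int j) :: real)"
proof (induction N)
  case (Suc N)
  have "{- int (Suc N)..int (Suc N)} = insert (- int (Suc N)) (insert (int (Suc N)) {- int N..int N})"
    by auto
  then show ?case using Suc by simp
qed simp

lemma frame_sum_eq_trig_poly:
  "(\<Sum>k\<in>{- int N..int N}. c k * frame r k \<phi>) =
     trig_poly N (\<lambda>j. if j = 0 then c 0 / sqrt 2 else c (int j) / sqrt (tau r j))
       (\<lambda>j. c (- int j) / sqrt (tau r j)) \<phi>"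
  unfolding sum_symmetric_interval trig_poly_def by (simp add: frame_def)

lemma trig_poly_eq_frame_sum:
  obtains c where "c \<in> {- int N..int N} \<rightarrow>\<^sub>E UNIV"
    "trig_poly N a b = (\<lambda>\<phi>. \<Sum>k\<in>{- int N..int N}. c k * frame r k \<phi>)"
proof -
  define c where "c = (\<lambda>k\<in>{- int N..int N}. if k = 0 then sqrt 2 * a 0
     else if k > 0 then sqrt (tau r (nat k)) * a (nat k) else sqrt (tau r (nat (- k))) * b (nat (- k)))"
  have t: "tau r j \<noteq> 0" for j using tau_pos[of r j] by simp
  have "trig_poly N a b \<phi> = (\<Sum>k\<in>{- int N..int N}. c k * frame r k \<phi>)" for \<phi>
    unfolding frame_sum_eq_trig_poly trig_poly_def
    by (intro arg_cong2[where f = "(+)"] sum.cong) (auto simp: c_def t)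
  then show ?thesis by (intro that[of c]) (auto simp: c_def)
qed

lemma space_W2_volume: "space (W2_volume r N) = trig_curves N"
proof (intro equalityI subsetI)
  fix f assume "f \<in> space (W2_volume r N)"
  then show "f \<in> trig_curves N"
    by (auto simp: W2_volume_def space_embed_measure frame_curve_def trig_curves_def
        frame_sum_eq_trig_poly)
next
  fix f assume "f \<in> trig_curves N"
  then obtain a b a' b' where f: "f = (\<lambda>\<phi>. (trig_poly N a b \<phi>, trig_poly N a' b' \<phi>))"
    by (auto simp: trig_curves_def)
  obtain c where c: "c \<in> {- int N..int N} \<rightarrow>\<^sub>E UNIV"
    "trig_poly N a b = (\<lambda>\<phi>. \<Sum>k\<in>{- int N..int N}. c k * frame r k \<phi>)"
    by (rule trig_poly_eq_frame_sum)
  obtain d where d: "d \<in> {- int N..int N} \<rightarrow>\<^sub>E UNIV"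
    "trig_poly N a' b' = (\<lambda>\<phi>. \<Sum>k\<in>{- int N..int N}. d k * frame r k \<phi>)"
    by (rule trig_poly_eq_frame_sum)
  have "f = frame_curve r N (c, d)" by (simp add: f c(2) d(2) frame_curve_def)
  moreover have "(c, d) \<in> space (coord_space N)" using c(1) d(1) by (simp add: space_coord_space)
  ultimately show "f \<in> space (W2_volume r N)"
    by (auto simp: W2_volume_def space_embed_measure)
qed

end

(* Translating f by its constant Fourier coefficient c = (c1, c2) turns the intersections of f and g
   into the preimages of c under (phi, psi) |-> sqrt 2 (g psi - f phi). The area formula in the plane
   therefore writes the integral over c of the intersection number as an integral over (phi, psi) of
   2 |det (f' phi, g' psi)|, and by Tonelli it remains to integrate this quantity over all curves
   for fixed (phi, psi).

   Evaluation at phi and differentiation at phi are orthogonal functionals of the coordinates of a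
   trigonometric polynomial, with squared norms mu / 2 and lam^2. So the triple (value, derivative,
   squared norm) has the same distribution under Lebesgue measure as (sqrt (mu / 2) s, lam t,
   s^2 + t^2 + q), where q is a sum of squares of the remaining coordinates. What is left are radial
   integrals, which reduce to volumes of balls. *)
theory Submission
  imports Defs
begin

section \<open>Distribution of sums of squares\<close>

text \<open>Membership in the unit ball couples all coordinates of both components of a curve, so
  the components are not independent after normalisation. Everything is therefore done with
  unnormalised Lebesgue measure, and \<open>sq_measure\<close>, its image under the squared norm,
  replaces polar coordinates. Only the first curve is translated. If z = g psi is prescribed, the
  constant coefficient of f is determined and contributes 2 (z - u)^2 per component to the squared
  norm, u being the nonconstant part of f at phi. Completing the square costs a factor 1 / sqrt mu
  per component and leaves the offset 2 z^2 / mu, which is exactly the term s^2 carried by the value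
  z in the law of the second curve. Hence the remaining radii for the two curves agree, both
  integrations produce the volume of the same (4N+1)-dimensional ball, and its square over the
  squared volume of the (4N+2)-dimensional unit ball yields the factorials of the result. Infinite
  intersection numbers need no separate treatment, since the area formula holds for infinite counts;
  measurability of the count is proved directly.\<close>

definition sq_measure :: "nat \<Rightarrow> real measure" where
  "sq_measure m = distr (\<Pi>\<^sub>M i\<in>{..<m}. lborel) borel (\<lambda>x. \<Sum>i<m. (x i)\<^sup>2)"

lemma space_sq_measure [simp]: "space (sq_measure m) = UNIV"
  and sets_sq_measure [simp, measurable_cong]: "sets (sq_measure m) = sets borel"
  by (simp_all add: sq_measure_def)

lemma nn_integral_sq_measure:
  assumes [measurable]: "h \<in> borel_measurable borel"
  shows "(\<integral>\<^sup>+q. h q \<partial>sq_measure m) = (\<integral>\<^sup>+x. h (\<Sum>i<m. (x i)\<^sup>2) \<partial>(\<Pi>\<^sub>M i\<in>{..<m}. lborel))"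
  unfolding sq_measure_def by (subst nn_integral_distr) simp_all

lemma nn_integral_sq_measure_0:
  assumes [measurable]: "h \<in> borel_measurable borel"
  shows "(\<integral>\<^sup>+q. h q \<partial>sq_measure 0) = h 0"
proof -
  show ?thesis by (simp add: nn_integral_sq_measure PiM_empty nn_integral_count_space_finite)
qed

text \<open>Tonelli for the last coordinate. Read from right to left it absorbs a free coordinate
  into the radial part and raises the dimension by one.\<close>

lemma nn_integral_sq_measure_Suc:
  assumes [measurable]: "h \<in> borel_measurable borel"
  shows "(\<integral>\<^sup>+q. h q \<partial>sq_measure (Suc m)) = (\<integral>\<^sup>+t. \<integral>\<^sup>+q. h (t\<^sup>2 + q) \<partial>sq_measure m \<partial>lborel)"
proof -
  interpret product_sigma_finite "\<lambda>_::nat. lborel :: real measure" by standard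
  have "(\<integral>\<^sup>+q. h q \<partial>sq_measure (Suc m)) =
      (\<integral>\<^sup>+x. h (\<Sum>i<Suc m. (x i)\<^sup>2) \<partial>(\<Pi>\<^sub>M i\<in>insert m {..<m}. lborel))"
    by (simp add: nn_integral_sq_measure lessThan_Suc)
  also have "\<dots> = (\<integral>\<^sup>+t. \<integral>\<^sup>+x. h (\<Sum>i<Suc m. ((x(m := t)) i)\<^sup>2)
      \<partial>(\<Pi>\<^sub>M i\<in>{..<m}. lborel) \<partial>lborel)"
    by (subst product_nn_integral_insert_rev) (simp_all add: lessThan_Suc)
  also have "\<dots> = (\<integral>\<^sup>+t. \<integral>\<^sup>+x. h (t\<^sup>2 + (\<Sum>i<m. (x i)\<^sup>2))
      \<partial>(\<Pi>\<^sub>M i\<in>{..<m}. lborel) \<partial>lborel)"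
    by (intro nn_integral_cong arg_cong[where f = h]) simp
  also have "\<dots> = (\<integral>\<^sup>+t. \<integral>\<^sup>+q. h (t\<^sup>2 + q) \<partial>sq_measure m \<partial>lborel)"
    by (intro nn_integral_cong nn_integral_sq_measure[symmetric]) simp
  finally show ?thesis .
qed

text \<open>For s > 0 this is the volume of a closed ball of radius sqrt s. In dimension 0 the mass
  at s = 0 is 1, whereas \<open>0 powr 0\<close> is 0; hence the restriction to positive m.\<close>

lemma emeasure_sq_measure_atMost:
  assumes "m > 0"
  shows "emeasure (sq_measure m) {..s} =
    (if s < 0 then 0 else ennreal (unit_ball_vol (real m) * s powr (real m / 2)))"
proof -
  let ?P = "\<Pi>\<^sub>M i\<in>{..<m}. lborel :: real measure"
  have e: "emeasure (sq_measure m) {..s} = emeasure ?P ({x. (\<Sum>i<m. (x i)\<^sup>2) \<le> s} \<inter> space ?P)" for s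
    unfolding sq_measure_def by (subst emeasure_distr) (auto simp: vimage_def)
  have pos: "emeasure (sq_measure m) {..s} = ennreal (unit_ball_vol (real m) * s powr (real m / 2))"
    if "s > 0" for s
  proof -
    have "{x. (\<Sum>i<m. (x i)\<^sup>2) \<le> s} = {x. sqrt (\<Sum>i<m. (x i)\<^sup>2) \<le> sqrt s}" by simp
    moreover have "sqrt s ^ m = s powr (real m / 2)"
      using that by (simp add: powr_half_sqrt[symmetric] powr_realpow[symmetric] powr_powr)
    ultimately show ?thesis
      using emeasure_cball_aux[of "{..<m}" "sqrt s"] that by (simp add: e)
  qed
  consider "s < 0" | "s = 0" | "s > 0" by linarith
  then show ?thesis
  proof cases
    case 1
    have "(\<Sum>i<m. (x i)\<^sup>2) \<ge> 0" for x :: "nat \<Rightarrow> real" by (intro sum_nonneg) auto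
    then have "{x. (\<Sum>i<m. (x i)\<^sup>2) \<le> s} \<inter> space ?P = {}"
      using 1 by (smt (verit) Collect_empty_eq disjoint_iff mem_Collect_eq)
    then show ?thesis using 1 by (simp add: e)
  next
    case 2
    \<comment> \<open>The ball volume is available for positive radii only, so the mass at s = 0 is
      bounded by the masses of the balls of squared radius 1 / (n + 1), which tend to 0.\<close>
    have "(\<lambda>n. ennreal (unit_ball_vol (real m) * (1 / real (Suc n)) powr (real m / 2))) \<longlonglongrightarrow>
        ennreal (unit_ball_vol (real m) * 0)"
      using assms by (intro tendsto_ennrealI tendsto_mult tendsto_const tendsto_zero_powrI
          LIMSEQ_Suc[OF lim_1_over_n]) (auto intro!: always_eventually)
    moreover have "emeasure (sq_measure m) {..s} \<le>
        ennreal (unit_ball_vol (real m) * (1 / real (Suc n)) powr (real m / 2))" for n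
      using 2 by (subst pos[symmetric]) (auto intro!: emeasure_mono)
    ultimately have "emeasure (sq_measure m) {..s} \<le> ennreal (unit_ball_vol (real m) * 0)"
      by (intro LIMSEQ_le_const) auto
    then show ?thesis using 2 assms by simp
  next
    case 3
    then show ?thesis by (simp add: pos)
  qed
qed

lemma emeasure_sq_measure_atMost_finite: "emeasure (sq_measure m) {..s} < \<infinity>"
proof (cases "m = 0")
  case True
  have "emeasure (sq_measure m) {..s} = (\<integral>\<^sup>+q. indicator {..s} q \<partial>sq_measure m)" by simp
  also have "\<dots> \<le> 1" unfolding True by (subst nn_integral_sq_measure_0) (auto simp: indicator_def)
  finally show ?thesis by (simp add: order_le_less_trans)
qed (simp add: emeasure_sq_measure_atMost)

lemma sigma_finite_sq_measure: "sigma_finite_measure (sq_measure m)"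
proof
  show "\<exists>A. countable A \<and> A \<subseteq> sets (sq_measure m) \<and> \<Union> A = space (sq_measure m) \<and>
      (\<forall>a\<in>A. emeasure (sq_measure m) a \<noteq> \<infinity>)"
    using emeasure_sq_measure_atMost_finite[of m]
    by (intro exI[of _ "range (\<lambda>n::nat. {..real n})"]) (auto simp: real_arch_simple less_top)
qed

interpretation sq: sigma_finite_measure "sq_measure m" for m
  by (rule sigma_finite_sq_measure)

text \<open>Closed half-lines form an intersection-stable generator of the Borel sets and have
  finite mass, so the distribution function determines the measure even where its total mass is
  infinite.\<close>

lemma sq_measure_eqI:
  assumes "sets M = sets borel" "\<And>s. emeasure M {..s} = emeasure (sq_measure m) {..s}"
  shows "M = sq_measure m"
proof (rule measure_eqI_generator_eq[where \<Omega> = UNIV and E = "range (\<lambda>a::real. {..a})"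
      and A = "\<lambda>n. {..real n}"])
  show "Int_stable (range (\<lambda>a::real. {..a}))"
    by (auto simp: Int_stable_def)
  show "sets M = sigma_sets UNIV (range (\<lambda>a::real. {..a}))"
    "sets (sq_measure m) = sigma_sets UNIV (range (\<lambda>a::real. {..a}))"
    using assms(1) by (simp_all add: borel_eq_atMost[where 'a = real])
  show "emeasure M {..real i} \<noteq> \<infinity>" for i
    using emeasure_sq_measure_atMost_finite[of m "real i"] by (simp add: assms(2))
qed (auto simp: assms(2) real_arch_simple)

text \<open>The density is the derivative in s of the ball volume
  \<open>unit_ball_vol m * s powr (m / 2)\<close>, so both measures have the same distribution
  function.\<close>

lemma sq_measure_eq_density:
  assumes "m > 0"
  shows "sq_measure m = density lborel (\<lambda>q. ennreal (indicator {0<..} q *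
    (unit_ball_vol (real m) * (real m / 2) * q powr (real m / 2 - 1))))" (is "_ = density lborel ?d")
proof (rule sym, rule sq_measure_eqI)
  fix s :: real
  have "emeasure (density lborel ?d) {..s} = (\<integral>\<^sup>+q. ?d q * indicator {..s} q \<partial>lborel)"
    by (simp add: emeasure_density)
  also have "\<dots> = emeasure (sq_measure m) {..s}"
  proof (cases "s > 0")
    case True
    have "((\<lambda>q. unit_ball_vol (real m) * (real m / 2) * q powr (real m / 2 - 1)) has_integral
        unit_ball_vol (real m) * (real m / 2) * (s powr (real m / 2 - 1 + 1) / (real m / 2 - 1 + 1))) {0..s}"
      using True assms by (intro has_integral_mult_right has_integral_powr_from_0) auto
    then have "((\<lambda>q. unit_ball_vol (real m) * (real m / 2) * q powr (real m / 2 - 1)) has_integral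
        unit_ball_vol (real m) * s powr (real m / 2)) {0..s}"
      using assms by simp
    from nn_integral_has_integral_lebesgue[OF _ this]
    have "ennreal (unit_ball_vol (real m) * s powr (real m / 2)) =
       (\<integral>\<^sup>+q. ennreal (indicator {0..s} q * (unit_ball_vol (real m) * (real m / 2) * q powr (real m / 2 - 1))) \<partial>lborel)"
      by (simp add: mult_ac)
    also have "\<dots> = (\<integral>\<^sup>+q. ?d q * indicator {..s} q \<partial>lborel)"
      by (intro nn_integral_cong_AE AE_I[where N = "{0}"]) (auto simp: indicator_def)
    finally show ?thesis using True assms by (simp add: emeasure_sq_measure_atMost)
  next
    case False
    then have *: "?d q * indicator {..s} q = 0" for q by (auto simp: indicator_def)
    have "(\<integral>\<^sup>+q. ?d q * indicator {..s} q \<partial>lborel) = 0" unfolding * by simp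
    then show ?thesis using False assms by (simp add: emeasure_sq_measure_atMost)
  qed
  finally show "emeasure (density lborel ?d) {..s} = emeasure (sq_measure m) {..s}" .
qed simp

text \<open>Semigroup law under convolution, reflecting that R^m times R^k is R^(m+k). The induction
  peels off one coordinate of the first factor at a time.\<close>

lemma nn_integral_sq_measure_add:
  assumes [measurable]: "h \<in> borel_measurable borel"
  shows "(\<integral>\<^sup>+p. \<integral>\<^sup>+q. h (p + q) \<partial>sq_measure k \<partial>sq_measure m) = (\<integral>\<^sup>+q. h q \<partial>sq_measure (m + k))"
  using assms
proof (induction m arbitrary: h)
  case 0
  note [measurable] = 0
  show ?case by (subst nn_integral_sq_measure_0) simp_all
next
  case (Suc m)
  note [measurable] = Suc.prems
  have "(\<integral>\<^sup>+p. \<integral>\<^sup>+q. h (p + q) \<partial>sq_measure k \<partial>sq_measure (Suc m)) =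
      (\<integral>\<^sup>+t. \<integral>\<^sup>+p. \<integral>\<^sup>+q. h (t\<^sup>2 + (p + q)) \<partial>sq_measure k \<partial>sq_measure m \<partial>lborel)"
    by (subst nn_integral_sq_measure_Suc) (simp_all add: add.assoc)
  also have "\<dots> = (\<integral>\<^sup>+t. \<integral>\<^sup>+q. h (t\<^sup>2 + q) \<partial>sq_measure (m + k) \<partial>lborel)"
    by (intro nn_integral_cong Suc.IH) simp
  also have "\<dots> = (\<integral>\<^sup>+q. h q \<partial>sq_measure (Suc (m + k)))"
    by (subst nn_integral_sq_measure_Suc) simp_all
  finally show ?case by simp
qed

text \<open>Frees the radial law from the index set {..<m}; the coordinates of a trigonometric
  polynomial are indexed by integers.\<close>

lemma nn_integral_PiM_sum_squares:
  fixes I :: "'i set"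
  assumes "finite I" and [measurable]: "h \<in> borel_measurable borel"
  shows "(\<integral>\<^sup>+x. h (\<Sum>i\<in>I. (x i)\<^sup>2) \<partial>(\<Pi>\<^sub>M i\<in>I. lborel)) = (\<integral>\<^sup>+q. h q \<partial>sq_measure (card I))"
  using assms
proof (induction I arbitrary: h rule: finite_induct)
  case empty
  show ?case using empty by (simp add: nn_integral_sq_measure_0 PiM_empty nn_integral_count_space_finite)
next
  case (insert i I)
  note [measurable] = insert.prems
  interpret product_sigma_finite "\<lambda>_::'i. lborel :: real measure" by standard
  have "(\<integral>\<^sup>+x. h (\<Sum>i\<in>insert i I. (x i)\<^sup>2) \<partial>(\<Pi>\<^sub>M i\<in>insert i I. lborel)) =
     (\<integral>\<^sup>+t. \<integral>\<^sup>+x. h (\<Sum>j\<in>insert i I. ((x(i := t)) j)\<^sup>2) \<partial>(\<Pi>\<^sub>M i\<in>I. lborel) \<partial>lborel)"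
    using insert.hyps by (subst product_nn_integral_insert_rev) simp_all
  also have "\<dots> = (\<integral>\<^sup>+t. \<integral>\<^sup>+x. h (t\<^sup>2 + (\<Sum>j\<in>I. (x j)\<^sup>2)) \<partial>(\<Pi>\<^sub>M i\<in>I. lborel) \<partial>lborel)"
    using insert.hyps by (intro nn_integral_cong arg_cong[where f = h]) (auto intro!: sum.cong)
  also have "\<dots> = (\<integral>\<^sup>+t. \<integral>\<^sup>+q. h (t\<^sup>2 + q) \<partial>sq_measure (card I) \<partial>lborel)"
    by (intro nn_integral_cong insert.IH) simp
  also have "\<dots> = (\<integral>\<^sup>+q. h q \<partial>sq_measure (card (insert i I)))"
    using insert.hyps by (simp add: nn_integral_sq_measure_Suc)
  finally show ?case .
qed

section \<open>Affine substitutions on the line and rotations of the plane\<close>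

lemma nn_integral_lborel_scale:
  fixes h :: "real \<Rightarrow> ennreal"
  assumes [measurable]: "h \<in> borel_measurable borel" and "c \<noteq> 0"
  shows "ennreal \<bar>c\<bar> * (\<integral>\<^sup>+x. h (c * x + t) \<partial>lborel) = (\<integral>\<^sup>+x. h x \<partial>lborel)"
  using assms by (subst nn_integral_real_affine[of h c t]) (simp_all add: add.commute)

text \<open>For c different from 0 the rotation is a composition of two one-dimensional affine
  substitutions: x is replaced by c x + s y for fixed y, then y for fixed x. The scale factors are c
  and 1 / c, so the Jacobians cancel. For c = 0 the rotation only swaps the coordinates up to
  signs.\<close>

lemma nn_integral_lborel_rotate:
  fixes h :: "real \<times> real \<Rightarrow> ennreal"
  assumes [measurable]: "h \<in> borel_measurable (borel \<Otimes>\<^sub>M borel)" and cs: "c\<^sup>2 + s\<^sup>2 = 1"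
  shows "(\<integral>\<^sup>+x. \<integral>\<^sup>+y. h (c * x + s * y, - s * x + c * y) \<partial>lborel \<partial>lborel) =
    (\<integral>\<^sup>+x. \<integral>\<^sup>+y. h (x, y) \<partial>lborel \<partial>lborel)"
proof (cases "c = 0")
  case True
  then have s: "s \<noteq> 0" "\<bar>s\<bar> = 1" using cs by (auto simp: power2_eq_square abs_if square_eq_1_iff)
  have "(\<integral>\<^sup>+x. \<integral>\<^sup>+y. h (c * x + s * y, - s * x + c * y) \<partial>lborel \<partial>lborel) =
      (\<integral>\<^sup>+x. \<integral>\<^sup>+y. h (y, - s * x) \<partial>lborel \<partial>lborel)"
  proof (rule nn_integral_cong)
    fix x
    have "ennreal \<bar>s\<bar> * (\<integral>\<^sup>+y. h (s * y + 0, - s * x) \<partial>lborel) = (\<integral>\<^sup>+y. h (y, - s * x) \<partial>lborel)"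
      by (rule nn_integral_lborel_scale) (measurable, rule s(1))
    then show "(\<integral>\<^sup>+y. h (c * x + s * y, - s * x + c * y) \<partial>lborel) = (\<integral>\<^sup>+y. h (y, - s * x) \<partial>lborel)"
      by (simp add: True s(2))
  qed
  also have "\<dots> = (\<integral>\<^sup>+x. \<integral>\<^sup>+y. h (y, x) \<partial>lborel \<partial>lborel)"
  proof -
    have "ennreal \<bar>- s\<bar> * (\<integral>\<^sup>+x. \<integral>\<^sup>+y. h (y, - s * x + 0) \<partial>lborel \<partial>lborel) =
        (\<integral>\<^sup>+x. \<integral>\<^sup>+y. h (y, x) \<partial>lborel \<partial>lborel)"
      by (rule nn_integral_lborel_scale) (measurable, simp add: s(1))
    then show ?thesis by (simp add: s(2))
  qed
  also have "\<dots> = (\<integral>\<^sup>+x. \<integral>\<^sup>+y. h (x, y) \<partial>lborel \<partial>lborel)"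
    by (rule lborel_pair.Fubini') measurable
  finally show ?thesis .
next
  case False
  have "(\<integral>\<^sup>+x. \<integral>\<^sup>+y. h (c * x + s * y, - s * x + c * y) \<partial>lborel \<partial>lborel) =
      (\<integral>\<^sup>+y. \<integral>\<^sup>+x. h (c * x + s * y, - s * x + c * y) \<partial>lborel \<partial>lborel)"
    by (rule lborel_pair.Fubini') measurable
  also have "\<dots> = (\<integral>\<^sup>+y. ennreal (1 / \<bar>c\<bar>) * (\<integral>\<^sup>+x. h (x, (y - s * x) / c) \<partial>lborel) \<partial>lborel)"
  proof (rule nn_integral_cong)
    fix y
    \<comment> \<open>Expresses the second rotated coordinate by the first one and y, so that the
      inner substitution in x acts on the first slot in the required form.\<close>
    have *: "- s * x + c * y = (y - s * (c * x + s * y)) / c" for x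
    proof -
      have "c * (- s * x + c * y) = (c\<^sup>2 + s\<^sup>2) * y - s * (c * x + s * y)"
        by (simp add: algebra_simps power2_eq_square)
      then show ?thesis using False cs by (simp add: field_simps)
    qed
    have "ennreal \<bar>c\<bar> * (\<integral>\<^sup>+x. h (c * x + s * y, (y - s * (c * x + s * y)) / c) \<partial>lborel) =
        (\<integral>\<^sup>+x. h (x, (y - s * x) / c) \<partial>lborel)"
      by (rule nn_integral_lborel_scale) (measurable, rule False)
    then have "ennreal (1 / \<bar>c\<bar>) * (\<integral>\<^sup>+x. h (x, (y - s * x) / c) \<partial>lborel) =
        ennreal (1 / \<bar>c\<bar>) * (ennreal \<bar>c\<bar> *
          (\<integral>\<^sup>+x. h (c * x + s * y, (y - s * (c * x + s * y)) / c) \<partial>lborel))"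
      by (rule arg_cong[OF sym])
    also have "\<dots> = ennreal (1 / \<bar>c\<bar> * \<bar>c\<bar>) *
       (\<integral>\<^sup>+x. h (c * x + s * y, (y - s * (c * x + s * y)) / c) \<partial>lborel)"
      by (simp only: mult.assoc[symmetric] ennreal_mult'' abs_ge_zero)
    finally show "(\<integral>\<^sup>+x. h (c * x + s * y, - s * x + c * y) \<partial>lborel) =
        ennreal (1 / \<bar>c\<bar>) * (\<integral>\<^sup>+x. h (x, (y - s * x) / c) \<partial>lborel)"
      unfolding * using False by simp
  qed
  also have "\<dots> = ennreal (1 / \<bar>c\<bar>) * (\<integral>\<^sup>+y. \<integral>\<^sup>+x. h (x, (y - s * x) / c) \<partial>lborel \<partial>lborel)"
    by (rule nn_integral_cmult) measurable
  also have "(\<integral>\<^sup>+y. \<integral>\<^sup>+x. h (x, (y - s * x) / c) \<partial>lborel \<partial>lborel) =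
      (\<integral>\<^sup>+x. \<integral>\<^sup>+y. h (x, (y - s * x) / c) \<partial>lborel \<partial>lborel)"
    by (rule lborel_pair.Fubini') measurable
  also have "ennreal (1 / \<bar>c\<bar>) * \<dots> = (\<integral>\<^sup>+x. ennreal (1 / \<bar>c\<bar>) * (\<integral>\<^sup>+y. h (x, (y - s * x) / c) \<partial>lborel) \<partial>lborel)"
    by (rule nn_integral_cmult[symmetric]) measurable
  also have "\<dots> = (\<integral>\<^sup>+x. \<integral>\<^sup>+y. h (x, y) \<partial>lborel \<partial>lborel)"
  proof (rule nn_integral_cong)
    fix x
    have "ennreal \<bar>1 / c\<bar> * (\<integral>\<^sup>+y. h (x, (1 / c) * y + - s * x / c) \<partial>lborel) = (\<integral>\<^sup>+y. h (x, y) \<partial>lborel)"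
      by (rule nn_integral_lborel_scale[where h = "\<lambda>y. h (x, y)"]) (measurable, simp add: False)
    then show "ennreal (1 / \<bar>c\<bar>) * (\<integral>\<^sup>+y. h (x, (y - s * x) / c) \<partial>lborel) = (\<integral>\<^sup>+y. h (x, y) \<partial>lborel)"
      by (simp add: diff_divide_distrib abs_divide)
  qed
  finally show ?thesis .
qed

section \<open>The area formula in the plane\<close>

text \<open>The measure of an injective differentiable image requires an integrable Jacobian. This
  follows from its continuity and the boundedness of A; the gauge integral is then rewritten as a
  nonnegative Lebesgue integral.\<close>

lemma emeasure_differentiable_image_inj:
  fixes F :: "real^'n::{finite,wellorder} \<Rightarrow> real^'n::_"
  assumes der: "\<And>x. (F has_derivative F' x) (at x)"
    and cont: "continuous_on UNIV (\<lambda>x. matrix (F' x))"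
    and A: "A \<in> sets borel" "bounded A" "inj_on F A"
  shows "F ` A \<in> sets lebesgue"
    and "emeasure lebesgue (F ` A) = (\<integral>\<^sup>+x. ennreal \<bar>det (matrix (F' x))\<bar> * indicator A x \<partial>lebesgue)"
proof -
  let ?d = "\<lambda>x. \<bar>det (matrix (F' x))\<bar>"
  have d: "continuous_on UNIV ?d"
    unfolding det_def by (intro continuous_intros continuous_on_component cont)
  have AL: "A \<in> sets lebesgue" using A(1) by auto
  obtain l u where lu: "A \<subseteq> cbox l u"
    using A(2) bounded_subset_cbox_symmetric by metis
  have "?d absolutely_integrable_on cbox l u"
    by (intro absolutely_integrable_continuous continuous_on_subset[OF d]) simp
  then have int: "?d absolutely_integrable_on A"
    using set_integrable_subset[OF _ AL lu] by blast
  have der': "(F has_derivative F' x) (at x within A)" for x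
    using der has_derivative_at_withinI by blast
  have "?d integrable_on A" using int set_lebesgue_integral_eq_integral(1) by blast
  then have "(?d has_integral integral A ?d) A" by blast
  then have *: "F ` A \<in> lmeasurable" "measure lebesgue (F ` A) = integral A ?d"
    using has_measure_differentiable_image[OF AL der' A(3)] by blast+
  then show "F ` A \<in> sets lebesgue" by auto
  have "emeasure lebesgue (F ` A) = ennreal (measure lebesgue (F ` A))"
    using * by (intro emeasure_eq_measure2) auto
  also have "\<dots> = ennreal (\<integral>x. indicator A x *\<^sub>R ?d x \<partial>lebesgue)"
    using * set_lebesgue_integral_eq_integral(2)[OF int] by (simp add: set_lebesgue_integral_def)
  also have "\<dots> = (\<integral>\<^sup>+x. ennreal (indicator A x *\<^sub>R ?d x) \<partial>lebesgue)"
    using int by (intro nn_integral_eq_integral[symmetric]) (auto simp: set_integrable_def)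
  also have "\<dots> = (\<integral>\<^sup>+x. ennreal (?d x) * indicator A x \<partial>lebesgue)"
    by (intro nn_integral_cong) (simp add: indicator_def)
  finally show "emeasure lebesgue (F ` A) = (\<integral>\<^sup>+x. ennreal (?d x) * indicator A x \<partial>lebesgue)" .
qed

text \<open>Near a point with invertible derivative the map is injective on a ball, by continuity of
  the derivative; Lindelof reduces the cover by such sets to a countable one. Countability is what
  makes the later summation over pieces possible.\<close>

lemma locally_injective_cover:
  fixes F :: "real^'n \<Rightarrow> real^'n"
  assumes der: "\<And>x. (F has_derivative F' x) (at x)"
    and cont: "continuous_on UNIV (\<lambda>x. matrix (F' x))"
  shows "\<exists>G :: nat \<Rightarrow> (real^'n) set. (\<forall>n. open (G n) \<and> inj_on F (G n)) \<and>
    (\<Union>n. G n) = {x. det (matrix (F' x)) \<noteq> 0}"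
proof -
  let ?U = "{x. det (matrix (F' x)) \<noteq> 0}"
  have lin: "linear (F' x)" for x using der has_derivative_linear by blast
  have d: "continuous_on UNIV (\<lambda>x. det (matrix (F' x)))"
    unfolding det_def by (intro continuous_intros continuous_on_component cont)
  have oU: "open ?U"
    using open_Collect_neq[OF d continuous_on_const[of _ 0]] by simp
  have ex: "\<exists>B. open B \<and> x \<in> B \<and> B \<subseteq> ?U \<and> inj_on F B" if x: "x \<in> ?U" for x
  proof -
    let ?A = "matrix (F' x)"
    obtain A' where A': "A' ** ?A = mat 1"
      using x invertible_det_nz[of ?A] by (auto simp: invertible_def)
    obtain r where "r > 0" "ball x r \<subseteq> ?U" "inj_on F (ball x r)"
    proof (rule has_derivative_locally_injective[of x ?U "(*v) A'" F' F])
      show "x \<in> ?U" "open ?U" by fact+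
      show "bounded_linear ((*v) A')" by (simp add: matrix_vector_mul_bounded_linear)
      have "A' *v F' x v = v" for v
        using A' matrix_vector_mul(2)[OF lin, of x]
        by (metis matrix_vector_mul_assoc matrix_vector_mul_lid)
      then show "(*v) A' \<circ> F' x = id" by (auto simp: fun_eq_iff)
      show "(F has_derivative F' y) (at y)" for y by (rule der)
      fix e :: real assume "e > 0"
      \<comment> \<open>Local injectivity asks for continuity of the derivative in operator norm,
        which is dominated by the sum of the absolute values of the matrix entries.\<close>
      have "continuous (at x) (\<lambda>y. matrix (F' y))"
        using cont by (simp add: continuous_on_eq_continuous_at)
      then have "((\<lambda>y. matrix (F' y) - ?A) \<longlongrightarrow> 0) (at x)"
        by (simp add: continuous_at LIM_zero)
      then have "((\<lambda>y. \<Sum>i\<in>UNIV. \<Sum>j\<in>UNIV. \<bar>(matrix (F' y) - ?A) $ i $ j\<bar>) \<longlongrightarrow>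
          (\<Sum>i\<in>UNIV. \<Sum>j\<in>UNIV. \<bar>(0 :: real^'n^'n) $ i $ j\<bar>)) (at x)"
        by (intro tendsto_intros)
      then have "((\<lambda>y. \<Sum>i\<in>UNIV. \<Sum>j\<in>UNIV. \<bar>(matrix (F' y) - ?A) $ i $ j\<bar>) \<longlongrightarrow> 0) (at x)" by simp
      from tendstoD[OF this \<open>e > 0\<close>] obtain d where "d > 0" and
        d: "\<And>y. y \<noteq> x \<Longrightarrow> dist y x < d \<Longrightarrow> dist (\<Sum>i\<in>UNIV. \<Sum>j\<in>UNIV. \<bar>(matrix (F' y) - ?A) $ i $ j\<bar>) 0 < e"
        by (auto simp: eventually_at)
      have "onorm (\<lambda>v. F' y v - F' x v) < e" if "dist x y < d" for y
      proof -
        have lin': "linear (\<lambda>v. F' y v - F' x v)" using lin by (simp add: linear_compose_sub)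
        have m: "matrix (\<lambda>v. F' y v - F' x v) = matrix (F' y) - ?A"
          by (simp add: matrix_def vec_eq_iff)
        have "onorm (\<lambda>v. F' y v - F' x v) = onorm ((*v) (matrix (F' y) - ?A))"
          using matrix_vector_mul(2)[OF lin'] unfolding m by simp
        also have "\<dots> \<le> (\<Sum>i\<in>UNIV. \<Sum>j\<in>UNIV. \<bar>(matrix (F' y) - ?A) $ i $ j\<bar>)"
          by (rule onorm_le_matrix_component_sum)
        also have "\<dots> < e"
          using d[of y] that \<open>e > 0\<close> by (cases "y = x") (auto simp: dist_commute)
        finally show ?thesis .
      qed
      then show "\<exists>d>0. \<forall>y. dist x y < d \<longrightarrow> onorm (\<lambda>v. F' y v - F' x v) < e"
        using \<open>d > 0\<close> by blast
    qed
    then show ?thesis by (intro exI[of _ "ball x r"]) auto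
  qed
  define \<F> where "\<F> = {B. open B \<and> B \<subseteq> ?U \<and> inj_on F B}"
  obtain \<F>' where \<F>': "\<F>' \<subseteq> \<F>" "countable \<F>'" "\<Union>\<F>' = \<Union>\<F>"
    using Lindelof[of \<F>] unfolding \<F>_def by blast
  have U: "\<Union>\<F>' = ?U" unfolding \<F>'(3) using ex by (auto simp: \<F>_def)
  \<comment> \<open>Adding the empty set guarantees a nonempty countable family, so that the
    enumeration has exactly this range.\<close>
  let ?G = "from_nat_into (insert {} \<F>')"
  have r: "range ?G = insert {} \<F>'" using \<F>'(2) by (intro range_from_nat_into) auto
  have mem: "?G n \<in> \<F>" for n
  proof -
    have "?G n \<in> insert {} \<F>'" using r by auto
    then show ?thesis using \<F>'(1) by (auto simp: \<F>_def)
  qed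
  have "(\<Union>n. ?G n) = ?U" using U by (simp add: r)
  moreover have "\<forall>n. open (?G n) \<and> inj_on F (?G n)" using mem by (auto simp: \<F>_def)
  ultimately show ?thesis by blast
qed

lemma emeasure_count_space_fiber_inj_on:
  assumes "inj_on F A"
  shows "emeasure (count_space UNIV) {x \<in> A. F x = y} = indicator (F ` A) y"
proof (cases "y \<in> F ` A")
  case True
  then obtain x where "x \<in> A" "y = F x" by auto
  then have *: "{x \<in> A. F x = y} = {x}" using assms by (auto dest: inj_onD)
  show ?thesis unfolding * using True by simp
next
  case False
  then have *: "{x \<in> A. F x = y} = {}" by auto
  show ?thesis unfolding * using False by simp
qed

text \<open>The critical points of D have a null image. The regular points of D are cut into
  countably many disjoint Borel pieces on which F is injective. On a piece the fibre count is the
  indicator of the image, whose measure is the integral of the Jacobian, and countable additivity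
  sums over the pieces.\<close>

theorem area_formula:
  fixes F :: "real^'n::{finite,wellorder} \<Rightarrow> real^'n::_"
  assumes der: "\<And>x. (F has_derivative F' x) (at x)"
    and cont: "continuous_on UNIV (\<lambda>x. matrix (F' x))"
    and D: "D \<in> sets borel" "bounded D"
  shows "(\<integral>\<^sup>+y. emeasure (count_space UNIV) {x \<in> D. F x = y} \<partial>lebesgue) =
    (\<integral>\<^sup>+x. ennreal \<bar>det (matrix (F' x))\<bar> * indicator D x \<partial>lebesgue)"
proof -
  let ?d = "\<lambda>x. \<bar>det (matrix (F' x))\<bar>"
  have dc: "continuous_on UNIV ?d"
    unfolding det_def by (intro continuous_intros continuous_on_component cont)
  then have [measurable]: "?d \<in> borel_measurable borel" by (intro borel_measurable_continuous_onI)
  from locally_injective_cover[OF der cont] obtain G :: "nat \<Rightarrow> _"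
    where G: "(\<forall>n. open (G n) \<and> inj_on F (G n)) \<and> (\<Union>n. G n) = {x. det (matrix (F' x)) \<noteq> 0}" ..
  have G: "open (G n)" "inj_on F (G n)" "(\<Union>n. G n) = {x. det (matrix (F' x)) \<noteq> 0}" for n
    using G by simp_all
  define A where "A n = D \<inter> disjointed G n" for n
  have sub: "A n \<subseteq> G n" "A n \<subseteq> D" for n using disjointed_subset[of G n] by (auto simp: A_def)
  have "range (disjointed G) \<subseteq> sets borel"
    using G(1) by (intro sets.range_disjointed_sets) auto
  then have Ab [measurable]: "A n \<in> sets borel" for n
    using D(1) unfolding A_def by (intro sets.Int) auto
  have An: "bounded (A n)" "inj_on F (A n)" for n
    by (rule bounded_subset[OF D(2) sub(2)], rule inj_on_subset[OF G(2) sub(1)])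
  note im = emeasure_differentiable_image_inj[OF der cont Ab An]
  have disj: "disjoint_family A"
    using disjoint_family_disjointed[of G] unfolding A_def disjoint_family_on_def by blast
  have UA: "(\<Union>n. A n) = {x \<in> D. ?d x \<noteq> 0}"
    using UN_disjointed_eq[of G] G(3) by (auto simp: A_def)
  \<comment> \<open>Sard: for almost every y the fibre contains no critical point of D, hence it is
    the disjoint union of its parts in the sets A n.\<close>
  have "negligible (F ` {x \<in> D. ?d x = 0})"
    using der by (intro baby_Sard[where f' = F']) (auto simp: det_eq_0_rank intro: has_derivative_at_withinI)
  then have AE: "AE y in lebesgue. y \<notin> F ` {x \<in> D. ?d x = 0}"
    by (simp add: negligible_iff_null_sets AE_not_in)
  have "(\<integral>\<^sup>+y. emeasure (count_space UNIV) {x \<in> D. F x = y} \<partial>lebesgue) =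
      (\<integral>\<^sup>+y. (\<Sum>n. indicator (F ` A n) y) \<partial>lebesgue)"
  proof (rule nn_integral_cong_AE)
    show "AE y in lebesgue. emeasure (count_space UNIV) {x \<in> D. F x = y} = (\<Sum>n. indicator (F ` A n) y)"
      using AE
    proof eventually_elim
      case (elim y)
      have "{x \<in> D. F x = y} = (\<Union>n. {x \<in> A n. F x = y})" using elim UA by auto
      moreover have "(\<Sum>n. emeasure (count_space UNIV) {x \<in> A n. F x = y}) =
          emeasure (count_space UNIV) (\<Union>n. {x \<in> A n. F x = y})"
        using disj by (intro suminf_emeasure) (auto simp: disjoint_family_on_def)
      ultimately show ?case
        using emeasure_count_space_fiber_inj_on[OF An(2)] by simp
    qed
  qed
  also have "\<dots> = (\<Sum>n. \<integral>\<^sup>+y. indicator (F ` A n) y \<partial>lebesgue)"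
    using im(1) by (intro nn_integral_suminf) auto
  also have "\<dots> = (\<Sum>n. \<integral>\<^sup>+x. ennreal (?d x) * indicator (A n) x \<partial>lebesgue)"
    using im by simp
  also have "\<dots> = (\<integral>\<^sup>+x. (\<Sum>n. ennreal (?d x) * indicator (A n) x) \<partial>lebesgue)"
    by (intro nn_integral_suminf[symmetric] measurable_completion) measurable
  also have "\<dots> = (\<integral>\<^sup>+x. ennreal (?d x) * indicator D x \<partial>lebesgue)"
    using suminf_indicator[OF disj] by (intro nn_integral_cong) (auto simp: UA indicator_def)
  finally show ?thesis .
qed

text \<open>The two versions of planar Lebesgue measure agree on boxes. The identification is needed
  because matrices and determinants act on \<open>real^2\<close>, while parameter pairs and constant
  coefficients live in a product type.\<close>

lemma distr_lborel_vec2: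
  "distr (lborel :: (real^2) measure) borel (\<lambda>x. (x $ 1, x $ 2)) = (lborel :: (real \<times> real) measure)"
proof (rule lborel_eqI[symmetric])
  let ?e = "\<lambda>x :: real^2. (x $ 1, x $ 2)"
  have [measurable]: "?e \<in> borel_measurable borel"
    by (intro borel_measurable_continuous_onI continuous_intros)
  fix l u :: "real \<times> real" assume lu: "\<And>b. b \<in> Basis \<Longrightarrow> l \<bullet> b \<le> u \<bullet> b"
  let ?l = "vector [fst l, snd l] :: real^2" and ?u = "vector [fst u, snd u] :: real^2"
  have le: "fst l \<le> fst u" "snd l \<le> snd u" using lu[of "(1, 0)"] lu[of "(0, 1)"] by (auto simp: Basis_prod_def inner_prod_def)
  have "?e -` box l u = box ?l ?u"
    by (auto simp: mem_box_cart box_prod forall_2 mem_box Basis_prod_def inner_prod_def)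
  then have "emeasure (distr lborel borel ?e) (box l u) = emeasure lborel (box ?l ?u)"
    by (simp add: emeasure_distr)
  also have "\<dots> = ennreal ((fst u - fst l) * (snd u - snd l))"
    using le by (subst emeasure_lborel_box) (auto simp: Basis_vec_def inner_axis UNIV_2 axis_eq_axis vector_2)
  also have "\<dots> = ennreal (\<Prod>b\<in>Basis. (u - l) \<bullet> b)"
    by (simp add: Basis_prod_def inner_prod_def mult.commute)
  finally show "emeasure (distr lborel borel ?e) (box l u) = ennreal (\<Prod>b\<in>Basis. (u - l) \<bullet> b)" .
qed simp

text \<open>Conjugation of the general formula by the coordinate isomorphism between
  \<open>real^2\<close> and pairs, with the determinant written out. The assumption
  \<open>meas\<close> allows the integral of the fibre count to be transported along this
  isomorphism.\<close>

theorem area_formula_plane: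
  fixes u v u1 u2 v1 v2 :: "real \<times> real \<Rightarrow> real"
  assumes u: "\<And>p. (u has_derivative (\<lambda>h. u1 p * fst h + u2 p * snd h)) (at p)"
    and v: "\<And>p. (v has_derivative (\<lambda>h. v1 p * fst h + v2 p * snd h)) (at p)"
    and c: "continuous_on UNIV u1" "continuous_on UNIV u2" "continuous_on UNIV v1" "continuous_on UNIV v2"
    and D: "D \<in> sets borel" "bounded D"
    and meas: "(\<lambda>z. emeasure (count_space UNIV) {p \<in> D. (u p, v p) = z}) \<in> borel_measurable borel"
  shows "(\<integral>\<^sup>+z. emeasure (count_space UNIV) {p \<in> D. (u p, v p) = z} \<partial>lborel) =
    (\<integral>\<^sup>+p. ennreal \<bar>u1 p * v2 p - u2 p * v1 p\<bar> * indicator D p \<partial>lborel)"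
proof -
  define e :: "real^2 \<Rightarrow> real \<times> real" where "e x = (x $ 1, x $ 2)" for x
  define i :: "real \<times> real \<Rightarrow> real^2" where "i p = vector [fst p, snd p]" for p
  have ei: "e (i p) = p" "i (e x) = x" for p x
    by (auto simp: e_def i_def vec_eq_iff forall_2 vector_2)
  have ie: "i p = x \<longleftrightarrow> p = e x" for p x using ei by metis
  have ec [continuous_intros]: "continuous_on S (\<lambda>x. e x)" for S
    unfolding e_def by (intro continuous_intros)
  have [measurable]: "e \<in> borel_measurable borel"
    by (intro borel_measurable_continuous_onI ec)
  have le: "bounded_linear e"
    unfolding e_def by (intro bounded_linear_Pair bounded_linear_vec_nth)
  have li: "bounded_linear i"
    unfolding linear_conv_bounded_linear[symmetric]
    by (rule linearI) (auto simp: i_def vec_eq_iff forall_2 vector_2)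
  have lborel: "(lborel :: (real \<times> real) measure) = distr lborel borel e"
    unfolding e_def[abs_def] by (rule distr_lborel_vec2[symmetric])
  define F where "F x = i (u (e x), v (e x))" for x
  define F' where "F' x h = i (u1 (e x) * fst (e h) + u2 (e x) * snd (e h), v1 (e x) * fst (e h) + v2 (e x) * snd (e h))" for x h
  have de: "(e has_derivative e) (at x)" for x by (rule bounded_linear_imp_has_derivative[OF le])
  have der: "(F has_derivative F' x) (at x)" for x
    unfolding F_def F'_def
    by (intro bounded_linear.has_derivative[OF li] has_derivative_Pair
        has_derivative_compose[OF de u] has_derivative_compose[OF de v])
  have mat: "matrix (F' x) = (\<chi> k l. if k = 1 then (if l = 1 then u1 (e x) else u2 (e x))
      else (if l = 1 then v1 (e x) else v2 (e x)))" for x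
    by (auto simp: matrix_def vec_eq_iff forall_2 F'_def i_def e_def vector_2 axis_def)
  have comp: "continuous_on UNIV (\<lambda>x. g (e x))" if "continuous_on UNIV g" for g :: "real \<times> real \<Rightarrow> real"
    using continuous_on_compose2[OF that ec] by blast
  have cont: "continuous_on UNIV (\<lambda>x. matrix (F' x))"
    unfolding mat
  proof (intro continuous_on_vec_lambda)
    fix k l :: 2
    show "continuous_on UNIV (\<lambda>x. if k = 1 then (if l = 1 then u1 (e x) else u2 (e x))
      else (if l = 1 then v1 (e x) else v2 (e x)))"
      using c by (cases "k = 1"; cases "l = 1") (simp_all add: comp)
  qed
  have bij: "{x \<in> e -` D. F x = y} = i ` {p \<in> D. (u p, v p) = e y}" for y
  proof (intro set_eqI iffI)
    fix x assume "x \<in> {x \<in> e -` D. F x = y}"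
    then show "x \<in> i ` {p \<in> D. (u p, v p) = e y}"
      by (intro image_eqI[of _ i "e x"]) (simp_all add: F_def ie ei)
  qed (auto simp: F_def ie ei)
  have inj: "inj_on i S" for S by (rule inj_on_inverseI[of _ e]) (simp add: ei)
  have count: "emeasure (count_space UNIV) {x \<in> e -` D. F x = y} =
      emeasure (count_space UNIV) {p \<in> D. (u p, v p) = e y}" for y
    unfolding bij using inj by (simp add: emeasure_count_space card_image finite_image_iff)
  have DD: "e -` D \<in> sets borel" using D(1) measurable_sets[of e borel borel D] by simp
  have "e -` D \<subseteq> i ` D" using ei by (metis image_eqI subsetI vimageE)
  then have BD: "bounded (e -` D)"
    using bounded_linear_image[OF D(2) li] bounded_subset by blast
  have [measurable]: "u1 \<in> borel_measurable borel" "u2 \<in> borel_measurable borel"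
      "v1 \<in> borel_measurable borel" "v2 \<in> borel_measurable borel"
    using c by (auto intro: borel_measurable_continuous_onI)
  have [measurable]: "D \<in> sets borel" by (rule D(1))
  note [measurable] = meas
  have "(\<integral>\<^sup>+z. emeasure (count_space UNIV) {p \<in> D. (u p, v p) = z} \<partial>lborel) =
      (\<integral>\<^sup>+y. emeasure (count_space UNIV) {p \<in> D. (u p, v p) = e y} \<partial>lborel)"
    unfolding lborel by (subst nn_integral_distr) simp_all
  also have "\<dots> = (\<integral>\<^sup>+y. emeasure (count_space UNIV) {p \<in> D. (u p, v p) = e y} \<partial>lebesgue)"
    by (rule nn_integral_completion[symmetric])
  also have "\<dots> = (\<integral>\<^sup>+x. ennreal \<bar>det (matrix (F' x))\<bar> * indicator (e -` D) x \<partial>lebesgue)"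
    unfolding count[symmetric] by (rule area_formula[OF der cont DD BD])
  also have "\<dots> = (\<integral>\<^sup>+x. ennreal \<bar>u1 (e x) * v2 (e x) - u2 (e x) * v1 (e x)\<bar> * indicator D (e x) \<partial>lebesgue)"
    by (simp add: det_2 mat indicator_def)
  also have "\<dots> = (\<integral>\<^sup>+x. ennreal \<bar>u1 (e x) * v2 (e x) - u2 (e x) * v1 (e x)\<bar> * indicator D (e x) \<partial>lborel)"
    by (rule nn_integral_completion)
  also have "\<dots> = (\<integral>\<^sup>+p. ennreal \<bar>u1 p * v2 p - u2 p * v1 p\<bar> * indicator D p \<partial>lborel)"
    unfolding lborel by (subst nn_integral_distr) simp_all
  finally show ?thesis .
qed

section \<open>Measurability of the number of zeros\<close>

text \<open>On a compact set a continuous function has a zero if and only if its absolute value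
  takes arbitrarily small values on a countable dense subset. This replaces an uncountable
  existential quantifier by countable ones; compactness is used to get back from small values to an
  actual zero.\<close>

lemma measurable_ex_zero_compact:
  fixes \<Phi> :: "'w \<Rightarrow> 'a::euclidean_space \<Rightarrow> real"
  assumes [measurable]: "\<And>p. (\<lambda>w. \<Phi> w p) \<in> borel_measurable M"
    and cont: "\<And>w. continuous_on UNIV (\<Phi> w)" and K: "compact K"
  shows "{w \<in> space M. \<exists>p\<in>K. \<Phi> w p = 0} \<in> sets M"
proof -
  obtain T where T: "countable T" "T \<subseteq> K" "K \<subseteq> closure T" using separable by blast
  have "{w \<in> space M. \<exists>p\<in>K. \<Phi> w p = 0} =
      {w \<in> space M. \<forall>n::nat. \<exists>p\<in>T. \<bar>\<Phi> w p\<bar> < 1 / real (Suc n)}"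
  proof (intro set_eqI iffI)
    fix w assume "w \<in> {w \<in> space M. \<exists>p\<in>K. \<Phi> w p = 0}"
    then obtain p where p: "w \<in> space M" "p \<in> K" "\<Phi> w p = 0" by auto
    have "\<exists>t\<in>T. \<bar>\<Phi> w t\<bar> < 1 / real (Suc n)" for n
    proof -
      have "isCont (\<Phi> w) p" using cont by (simp add: continuous_on_eq_continuous_at)
      then obtain d where d: "d > 0" "\<And>q. dist q p < d \<Longrightarrow> dist (\<Phi> w q) (\<Phi> w p) < 1 / real (Suc n)"
        unfolding continuous_at_eps_delta by (metis of_nat_0_less_iff zero_less_Suc zero_less_divide_1_iff)
      obtain t where "t \<in> T" "dist t p < d"
        using p(2) T(3) d(1) closure_approachable[of p T] by blast
      then show ?thesis using d(2)[of t] p(3) by auto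
    qed
    then show "w \<in> {w \<in> space M. \<forall>n::nat. \<exists>p\<in>T. \<bar>\<Phi> w p\<bar> < 1 / real (Suc n)}"
      using p by simp
  next
    fix w assume "w \<in> {w \<in> space M. \<forall>n::nat. \<exists>p\<in>T. \<bar>\<Phi> w p\<bar> < 1 / real (Suc n)}"
    then have w: "w \<in> space M" "\<And>n. \<exists>p\<in>T. \<bar>\<Phi> w p\<bar> < 1 / real (Suc n)" by auto
    then have "K \<noteq> {}" using T(2) by blast
    moreover have "continuous_on K (\<lambda>p. \<bar>\<Phi> w p\<bar>)"
      by (intro continuous_intros continuous_on_subset[OF cont]) simp
    ultimately obtain p where p: "p \<in> K" "\<And>q. q \<in> K \<Longrightarrow> \<bar>\<Phi> w p\<bar> \<le> \<bar>\<Phi> w q\<bar>"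
      using continuous_attains_inf[OF K] by blast
    have "\<Phi> w p = 0"
    proof (rule ccontr)
      assume "\<Phi> w p \<noteq> 0"
      then obtain n where "1 / real (Suc n) < \<bar>\<Phi> w p\<bar>"
        using nat_approx_posE[of "\<bar>\<Phi> w p\<bar>"] by auto
      moreover obtain t where "t \<in> T" "\<bar>\<Phi> w t\<bar> < 1 / real (Suc n)" using w(2) by blast
      ultimately show False using p(2)[of t] T(2) by auto
    qed
    then show "w \<in> {w \<in> space M. \<exists>p\<in>K. \<Phi> w p = 0}" using p(1) w(1) by auto
  qed
  also have "\<dots> \<in> sets M"
    by (intro sets.sets_Collect_countable_All sets.sets_Collect_countable_Ex' T(1)) measurable
  finally show ?thesis .
qed

lemma ennreal_eq_top_if_ge_nats:
  assumes "\<And>n. of_nat n \<le> (x :: ennreal)"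
  shows "x = top"
proof (rule ccontr)
  assume "x \<noteq> top"
  then obtain n where "x < of_nat n" using ennreal_Ex_less_of_nat[of x] by (auto simp: less_top)
  then show False using assms[of n] by simp
qed

lemma finite_set_separation:
  fixes S :: "'a::metric_space set"
  assumes "finite S"
  obtains d where "d > 0" "\<And>x y. x \<in> S \<Longrightarrow> y \<in> S \<Longrightarrow> x \<noteq> y \<Longrightarrow> d \<le> dist x y"
proof -
  \<comment> \<open>The extra element 1 keeps the set nonempty when S has at most one point, so that
    the minimum is meaningful.\<close>
  let ?E = "insert 1 ((\<lambda>(x, y). dist x y) ` {(x, y) \<in> S \<times> S. x \<noteq> y})"
  have fin: "finite {(x, y) \<in> S \<times> S. x \<noteq> y}"
    by (rule finite_subset[of _ "S \<times> S"]) (use assms in auto)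
  show ?thesis
  proof (rule that[of "Min ?E"])
    show "Min ?E > 0" using fin by (subst Min_gr_iff) auto
    show "Min ?E \<le> dist x y" if "x \<in> S" "y \<in> S" "x \<noteq> y" for x y
      using fin that by (intro Min_le) (auto intro!: rev_image_eqI[of "(x, y)"])
  qed
qed

(* Counting by the number of pairwise disjoint small compact cells that contain a zero exhibits
   the count as a countable supremum of measurable functions. *)
lemma measurable_count_zeros_compact:
  fixes \<Phi> :: "'w \<Rightarrow> 'a::euclidean_space \<Rightarrow> real"
  assumes meas: "\<And>p. (\<lambda>w. \<Phi> w p) \<in> borel_measurable M"
    and cont: "\<And>w. continuous_on UNIV (\<Phi> w)" and D: "compact D"
  shows "(\<lambda>w. emeasure (count_space UNIV) {p \<in> D. \<Phi> w p = 0}) \<in> borel_measurable M"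
proof -
  obtain Q :: "'a set" where "countable Q" "Q \<subseteq> UNIV" "UNIV \<subseteq> closure Q"
    using separable by blast
  then have Q: "countable Q" "closure Q = UNIV" by blast+
  define cell where "cell = (\<lambda>(q, n). D \<inter> cball q (1 / real (Suc n)))"
  define \<C> where "\<C> = {F. finite F \<and> F \<subseteq> Q \<times> UNIV \<and> disjoint_family_on cell F}"
  define S where "S F w = (\<Sum>i\<in>F. indicator {w. \<exists>p\<in>cell i. \<Phi> w p = 0} w :: ennreal)" for F w
  have cc: "compact (cell i)" for i
    using D by (cases i) (auto simp: cell_def intro: compact_Int_closed)
  have "\<C> \<subseteq> {F. finite F \<and> F \<subseteq> Q \<times> UNIV}" by (auto simp: \<C>_def)
  then have c\<C>: "countable \<C>"
    using countable_subset countable_Collect_finite_subset[of "Q \<times> (UNIV :: nat set)"] Q(1) by auto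
  have mS: "S F \<in> borel_measurable M" for F
    unfolding S_def
  proof (intro borel_measurable_sum)
    fix i
    have "{w \<in> space M. \<exists>p\<in>cell i. \<Phi> w p = 0} \<in> sets M"
      by (rule measurable_ex_zero_compact[OF meas cont cc])
    then show "(\<lambda>w. indicator {w. \<exists>p\<in>cell i. \<Phi> w p = 0} w :: ennreal) \<in> borel_measurable M"
      by (subst measurable_cong[where g = "indicator {w \<in> space M. \<exists>p\<in>cell i. \<Phi> w p = 0}"])
        (auto simp: indicator_def)
  qed
  have "emeasure (count_space UNIV) {p \<in> D. \<Phi> w p = 0} = (SUP F\<in>\<C>. S F w)" for w
  proof (rule antisym)
    let ?A = "{p \<in> D. \<Phi> w p = 0}"
    \<comment> \<open>Bounding the cardinality of every finite set of zeros covers both cases of the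
      lower bound: the whole zero set if it is finite, arbitrarily large subsets if it is
      not.\<close>
    have fin: "of_nat (card B) \<le> (SUP F\<in>\<C>. S F w)" if B: "finite B" "B \<subseteq> ?A" for B
    proof -
      obtain d where d: "d > 0" "\<And>x y. x \<in> B \<Longrightarrow> y \<in> B \<Longrightarrow> x \<noteq> y \<Longrightarrow> d \<le> dist x y"
        using finite_set_separation[OF B(1)] by blast
      \<comment> \<open>Each zero s lies within the radius of its cell centre, so every point of
        that cell is closer to s than twice the radius, hence than d / 2. A point common to two
        cells would put two zeros of B at a distance below their separation d.\<close>
      obtain n where n: "1 / real (Suc n) < d / 4" using nat_approx_posE[of "d / 4"] d(1) by auto
      have "\<exists>q\<in>Q. dist q s < 1 / real (Suc n)" for s
        using closure_approachable[of s Q] Q(2) by auto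
      then obtain c where c: "\<And>s. c s \<in> Q" "\<And>s. dist (c s) s < 1 / real (Suc n)" by metis
      let ?F = "(\<lambda>s. (c s, n)) ` B"
      have near: "dist p s < d / 2" if "p \<in> cell (c s, n)" for p s
      proof -
        have "dist (c s) p \<le> 1 / real (Suc n)" using that by (simp add: cell_def)
        then show ?thesis using c(2)[of s] n dist_triangle[of p s "c s"] by (simp add: dist_commute)
      qed
      have sep: "cell (c s, n) \<inter> cell (c t, n) = {}" if "s \<in> B" "t \<in> B" "s \<noteq> t" for s t
      proof (rule ccontr)
        assume "cell (c s, n) \<inter> cell (c t, n) \<noteq> {}"
        then obtain p where "p \<in> cell (c s, n)" "p \<in> cell (c t, n)" by blast
        then have "dist s t < d"
          using near[of p s] near[of p t] dist_triangle[of s t p] by (simp add: dist_commute)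
        then show False using d(2)[OF that] by simp
      qed
      have mem: "s \<in> cell (c s, n)" if "s \<in> B" for s
        using that B(2) c(2)[of s] by (auto simp: cell_def intro: less_imp_le)
      have inj: "inj_on (\<lambda>s. (c s, n)) B"
      proof (rule inj_onI)
        fix s t assume st: "s \<in> B" "t \<in> B" "(c s, n) = (c t, n)"
        show "s = t"
        proof (rule ccontr)
          assume "s \<noteq> t"
          then show False using sep[OF st(1,2)] mem[OF st(1)] mem[OF st(2)] st(3) by auto
        qed
      qed
      have "?F \<in> \<C>"
        using B(1) c(1) sep by (auto simp: \<C>_def disjoint_family_on_def)
      moreover have "S ?F w = of_nat (card B)"
      proof -
        have "S ?F w = (\<Sum>s\<in>B. indicator {w. \<exists>p\<in>cell (c s, n). \<Phi> w p = 0} w)"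
          unfolding S_def by (subst sum.reindex[OF inj]) simp
        also have "\<dots> = (\<Sum>s\<in>B. 1)"
        proof (intro sum.cong refl)
          fix s assume "s \<in> B"
          then have "\<exists>p\<in>cell (c s, n). \<Phi> w p = 0" using mem B(2) by blast
          then show "indicator {w. \<exists>p\<in>cell (c s, n). \<Phi> w p = 0} w = (1 :: ennreal)" by simp
        qed
        finally show ?thesis by simp
      qed
      ultimately show ?thesis by (metis SUP_upper)
    qed
    show "emeasure (count_space UNIV) ?A \<le> (SUP F\<in>\<C>. S F w)"
    proof (cases "finite ?A")
      case True
      then show ?thesis using fin[of ?A] by simp
    next
      case False
      have "of_nat n \<le> (SUP F\<in>\<C>. S F w)" for n
        using infinite_arbitrarily_large[OF False, of n] fin by metis
      then have top: "(SUP F\<in>\<C>. S F w) = top" by (rule ennreal_eq_top_if_ge_nats)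
      show ?thesis unfolding top by simp
    qed
    show "(SUP F\<in>\<C>. S F w) \<le> emeasure (count_space UNIV) ?A"
    proof (rule SUP_least)
      fix F assume F: "F \<in> \<C>"
      have "S F w \<le> (\<Sum>i\<in>F. emeasure (count_space UNIV) (?A \<inter> cell i))"
        unfolding S_def
      proof (intro sum_mono)
        fix i
        show "indicator {w. \<exists>p\<in>cell i. \<Phi> w p = 0} w \<le> emeasure (count_space UNIV) (?A \<inter> cell i)"
        proof (cases "\<exists>p\<in>cell i. \<Phi> w p = 0")
          case True
          then obtain p where p: "p \<in> cell i" "\<Phi> w p = 0" by blast
          then have "{p} \<subseteq> ?A \<inter> cell i" by (auto simp: cell_def split: prod.splits)
          then have "emeasure (count_space UNIV) {p} \<le> emeasure (count_space UNIV) (?A \<inter> cell i)"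
            by (intro emeasure_mono) auto
          then show ?thesis using True by simp
        qed simp
      qed
      also have "\<dots> = emeasure (count_space UNIV) (\<Union>i\<in>F. ?A \<inter> cell i)"
      proof (rule sum_emeasure)
        show "disjoint_family_on (\<lambda>i. ?A \<inter> cell i) F"
          using F unfolding \<C>_def disjoint_family_on_def by blast
      qed (use F in \<open>auto simp: \<C>_def\<close>)
      also have "\<dots> \<le> emeasure (count_space UNIV) ?A" by (intro emeasure_mono) auto
      finally show "S F w \<le> emeasure (count_space UNIV) ?A" .
    qed
  qed
  then show ?thesis using borel_measurable_SUP[OF c\<C> mS] by simp
qed

text \<open>Continuity from below of counting measure along an exhaustion by compact sets.\<close>

lemma measurable_count_zeros:
  fixes \<Phi> :: "'w \<Rightarrow> 'a::euclidean_space \<Rightarrow> real"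
  assumes meas: "\<And>p. (\<lambda>w. \<Phi> w p) \<in> borel_measurable M"
    and cont: "\<And>w. continuous_on UNIV (\<Phi> w)"
    and D: "\<And>n. compact (D n)" "incseq D"
  shows "(\<lambda>w. emeasure (count_space UNIV) {p \<in> (\<Union>n::nat. D n). \<Phi> w p = 0}) \<in> borel_measurable M"
proof -
  have "emeasure (count_space UNIV) {p \<in> (\<Union>n. D n). \<Phi> w p = 0} =
      (SUP n. emeasure (count_space UNIV) {p \<in> D n. \<Phi> w p = 0})" for w
  proof -
    have "{p \<in> (\<Union>n. D n). \<Phi> w p = 0} = (\<Union>n. {p \<in> D n. \<Phi> w p = 0})" by auto
    moreover have "incseq (\<lambda>n. {p \<in> D n. \<Phi> w p = 0})" using D(2) by (fastforce simp: incseq_def)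
    ultimately show ?thesis by (simp add: SUP_emeasure_incseq)
  qed
  moreover have "(\<lambda>w. SUP n. emeasure (count_space UNIV) {p \<in> D n. \<Phi> w p = 0}) \<in> borel_measurable M"
    by (intro borel_measurable_SUP measurable_count_zeros_compact meas cont D) auto
  ultimately show ?thesis by simp
qed

text \<open>Counting each point of the circle once forces half-open parameter intervals, which are
  not compact. The rectangles shortened by 1 / (n + 1) at the upper ends exhaust them.\<close>

lemma measurable_count_zeros_square:
  fixes \<Phi> :: "'w \<Rightarrow> real \<times> real \<Rightarrow> real"
  assumes meas: "\<And>p. (\<lambda>w. \<Phi> w p) \<in> borel_measurable M"
    and cont: "\<And>w. continuous_on UNIV (\<Phi> w)"
  shows "(\<lambda>w. emeasure (count_space UNIV) {p \<in> {a..<b} \<times> {c..<d}. \<Phi> w p = 0}) \<in> borel_measurable M"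
proof -
  let ?D = "\<lambda>n. {a..b - 1 / real (Suc n)} \<times> {c..d - 1 / real (Suc n)}"
  have ex: "\<exists>n. x \<le> e - 1 / real (Suc n)" if "x < e" for x e :: real
    using nat_approx_posE[of "e - x"] that by (metis diff_gt_0_iff_gt less_eq_real_def less_diff_eq add.commute)
  have "{a..<b} \<times> {c..<d} = (\<Union>n. ?D n)"
  proof (intro set_eqI iffI)
    fix p assume "p \<in> {a..<b} \<times> {c..<d}"
    then obtain x y where p: "p = (x, y)" "a \<le> x" "x < b" "c \<le> y" "y < d" by auto
    obtain m n where mn: "x \<le> b - 1 / real (Suc m)" "y \<le> d - 1 / real (Suc n)"
      using ex p by blast
    have "1 / real (Suc (max m n)) \<le> 1 / real (Suc m)" "1 / real (Suc (max m n)) \<le> 1 / real (Suc n)"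
      by (auto intro!: divide_left_mono)
    then have "p \<in> ?D (max m n)" using p mn by auto
    then show "p \<in> (\<Union>n. ?D n)" by blast
  next
    fix p assume "p \<in> (\<Union>n. ?D n)"
    then obtain n where "p \<in> ?D n" by blast
    moreover define e where "e = 1 / real (Suc n)"
    moreover have "e > 0" by (simp add: e_def)
    ultimately show "p \<in> {a..<b} \<times> {c..<d}" unfolding e_def[symmetric] by auto
  qed
  moreover have "incseq ?D"
  proof (rule incseq_SucI)
    fix n
    have "1 / real (Suc (Suc n)) \<le> 1 / real (Suc n)" by (auto intro!: divide_left_mono)
    then show "?D n \<subseteq> ?D (Suc n)" by auto
  qed
  moreover have "compact (?D n)" for n by (intro compact_Times compact_Icc)
  ultimately show ?thesis using measurable_count_zeros[OF meas cont, of ?D] by simp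
qed

section \<open>Distribution of value, derivative and norm of a trigonometric polynomial\<close>

text \<open>Rotating (s, t) so that the first axis points along (a, b) turns a s + b t into a
  multiple of a single coordinate and preserves s^2 + t^2. This merges the contributions of two
  coordinates to one linear functional.\<close>

lemma nn_integral_combine_squares:
  fixes g :: "real \<times> real \<Rightarrow> ennreal"
  assumes [measurable]: "g \<in> borel_measurable (borel \<Otimes>\<^sub>M borel)"
    and abc: "a\<^sup>2 + b\<^sup>2 = c\<^sup>2" "c \<noteq> 0"
  shows "(\<integral>\<^sup>+s. \<integral>\<^sup>+t. g (a * s + b * t, s\<^sup>2 + t\<^sup>2) \<partial>lborel \<partial>lborel) =
    (\<integral>\<^sup>+s. \<integral>\<^sup>+t. g (c * s, s\<^sup>2 + t\<^sup>2) \<partial>lborel \<partial>lborel)"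
proof -
  define C S where "C = a / c" and "S = b / c"
  have cs: "C\<^sup>2 + S\<^sup>2 = 1"
    using abc by (simp add: C_def S_def power_divide add_divide_distrib[symmetric])
  have "(\<integral>\<^sup>+s. \<integral>\<^sup>+t. (\<lambda>(s, t). g (c * s, s\<^sup>2 + t\<^sup>2)) (C * s + S * t, - S * s + C * t) \<partial>lborel \<partial>lborel) =
      (\<integral>\<^sup>+s. \<integral>\<^sup>+t. (\<lambda>(s, t). g (c * s, s\<^sup>2 + t\<^sup>2)) (s, t) \<partial>lborel \<partial>lborel)"
    by (rule nn_integral_lborel_rotate[OF _ cs]) measurable
  moreover have "c * (C * s + S * t) = a * s + b * t" for s t
    using abc(2) by (simp add: C_def S_def field_simps)
  moreover have "(C * s + S * t)\<^sup>2 + (- S * s + C * t)\<^sup>2 = s\<^sup>2 + t\<^sup>2" for s t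
  proof -
    have "(C * s + S * t)\<^sup>2 + (- S * s + C * t)\<^sup>2 = (C\<^sup>2 + S\<^sup>2) * (s\<^sup>2 + t\<^sup>2)"
      by (simp add: power2_eq_square algebra_simps)
    then show ?thesis by (simp add: cs)
  qed
  ultimately show ?thesis by simp
qed

definition frame_deriv :: "nat \<Rightarrow> int \<Rightarrow> real \<Rightarrow> real" where
  "frame_deriv r k \<phi> =
     (if k = 0 then 0
      else if k > 0 then - real (nat k) * sin (real (nat k) * \<phi>) / sqrt (tau r (nat k))
      else real (nat (- k)) * cos (real (nat (- k)) * \<phi>) / sqrt (tau r (nat (- k))))"

text \<open>The norm of evaluation at a point as a functional on trigonometric polynomials without
  constant term: the cosine and sine of frequency j together contribute 1 / tau_j to its square, at
  every point. In the same way \<open>lam\<close> is the norm of the derivative functional.\<close>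

definition amp :: "nat \<Rightarrow> nat \<Rightarrow> real" where
  "amp r N = sqrt (\<Sum>j=1..N. 1 / tau r j)"

lemma amp_sq: "(amp r N)\<^sup>2 = (\<Sum>j=1..N. 1 / tau r j)"
  unfolding amp_def using tau_pos[of r] by (intro real_sqrt_pow2 sum_nonneg) (simp add: less_imp_le)

lemma lam_sq: "(lam r N)\<^sup>2 = (\<Sum>j=1..N. (real j)\<^sup>2 / tau r j)"
  unfolding lam_def using tau_pos[of r] by (intro real_sqrt_pow2 sum_nonneg) (simp add: less_imp_le)

lemma mu_eq_amp: "mu r N = 1 + 2 * (amp r N)\<^sup>2"
  by (simp add: mu_def amp_sq)

lemma amp_pos: "N \<ge> 1 \<Longrightarrow> amp r N > 0"
  unfolding amp_def using tau_pos[of r] by (intro real_sqrt_gt_zero sum_pos) auto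

lemma lam_pos: "N \<ge> 1 \<Longrightarrow> lam r N > 0"
  unfolding lam_def using tau_pos[of r] by (intro real_sqrt_gt_zero sum_pos) auto

lemma mu_pos: "mu r N > 0"
  by (simp add: mu_eq_amp add_pos_nonneg)

definition nonzero_indices :: "nat \<Rightarrow> int set" where
  "nonzero_indices N = {- int N..int N} - {0}"

lemma finite_nonzero_indices [simp]: "finite (nonzero_indices N)"
  by (simp add: nonzero_indices_def)

lemma zero_notin_nonzero_indices [simp]: "0 \<notin> nonzero_indices N"
  by (simp add: nonzero_indices_def)

lemma nonzero_indices_0 [simp]: "nonzero_indices 0 = {}"
  by (auto simp: nonzero_indices_def)

lemma nonzero_indices_Suc:
  "nonzero_indices (Suc N) = insert (int (Suc N)) (insert (- int (Suc N)) (nonzero_indices N))"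
  by (auto simp: nonzero_indices_def)

lemma insert_zero_nonzero_indices: "insert 0 (nonzero_indices N) = {- int N..int N}"
  by (auto simp: nonzero_indices_def)

definition trig_data :: "nat \<Rightarrow> int set \<Rightarrow> real \<Rightarrow> (int \<Rightarrow> real) \<Rightarrow> real \<times> real \<times> real" where
  "trig_data r I \<phi> x =
    (\<Sum>k\<in>I. x k * frame r k \<phi>, \<Sum>k\<in>I. x k * frame_deriv r k \<phi>, \<Sum>k\<in>I. (x k)\<^sup>2)"

text \<open>Rotating the coordinate plane of the modes cos j and sin j by the angle j \<phi> makes
  the new coordinate \<xi> enter the value only and \<eta> the derivative only. This is the
  orthogonality of value and derivative, frequency by frequency, and it removes the dependence on
  \<phi> from the new mode.\<close>

lemma nn_integral_trig_data_pair:
  fixes h :: "real \<times> real \<times> real \<Rightarrow> ennreal"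
  assumes h [measurable]: "h \<in> borel_measurable (borel \<Otimes>\<^sub>M borel \<Otimes>\<^sub>M borel)"
    and j: "j \<ge> 1" and I: "finite I" "int j \<notin> I" "- int j \<notin> I"
  shows "(\<integral>\<^sup>+x. h (trig_data r (insert (int j) (insert (- int j) I)) \<phi> x)
      \<partial>(\<Pi>\<^sub>M k\<in>insert (int j) (insert (- int j) I). lborel)) =
    (\<integral>\<^sup>+\<xi>. \<integral>\<^sup>+\<eta>. \<integral>\<^sup>+x. (case trig_data r I \<phi> x of (u, v, w) \<Rightarrow>
      h (u + \<xi> / sqrt (tau r j), v + real j * \<eta> / sqrt (tau r j), \<xi>\<^sup>2 + \<eta>\<^sup>2 + w))
      \<partial>(\<Pi>\<^sub>M k\<in>I. lborel) \<partial>lborel \<partial>lborel)"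
proof -
  interpret product_sigma_finite "\<lambda>_::int. lborel :: real measure" by standard
  interpret P: sigma_finite_measure "\<Pi>\<^sub>M k\<in>I. lborel :: real measure"
    using sigma_finite[OF I(1)] .
  let ?I1 = "insert (- int j) I" and ?I2 = "insert (int j) (insert (- int j) I)"
  define c s where "c = cos (real j * \<phi>)" and "s = sin (real j * \<phi>)"
  define H where "H = (\<lambda>(\<xi>, \<eta>). \<integral>\<^sup>+x. (case trig_data r I \<phi> x of (u, v, w) \<Rightarrow>
      h (u + \<xi> / sqrt (tau r j), v + real j * \<eta> / sqrt (tau r j), \<xi>\<^sup>2 + \<eta>\<^sup>2 + w))
      \<partial>(\<Pi>\<^sub>M k\<in>I. lborel))"
  have [measurable]: "H \<in> borel_measurable (borel \<Otimes>\<^sub>M borel)"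
    unfolding H_def trig_data_def by measurable
  have [measurable]: "(\<lambda>x. h (trig_data r K \<phi> x)) \<in> borel_measurable (\<Pi>\<^sub>M k\<in>K. lborel)" for K
    unfolding trig_data_def by measurable
  have upd: "trig_data r ?I2 \<phi> (x(- int j := z, int j := y)) =
      (case trig_data r I \<phi> x of (u, v, w) \<Rightarrow>
        (u + (c * y + s * z) / sqrt (tau r j), v + real j * (- s * y + c * z) / sqrt (tau r j),
         (c * y + s * z)\<^sup>2 + (- s * y + c * z)\<^sup>2 + w))" for x y z
  proof -
    have ne: "int j \<notin> ?I1" "- int j \<noteq> int j" using j I by auto
    have cong: "(\<Sum>k\<in>I. f k ((x(- int j := z, int j := y)) k)) = (\<Sum>k\<in>I. f k (x k))"
      for f :: "int \<Rightarrow> real \<Rightarrow> real"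
      using I by (intro sum.cong) auto
    have cs: "c\<^sup>2 + s\<^sup>2 = 1" by (simp add: c_def s_def)
    have "(c * y + s * z)\<^sup>2 + (- s * y + c * z)\<^sup>2 = (c\<^sup>2 + s\<^sup>2) * (y\<^sup>2 + z\<^sup>2)"
      by (simp add: power2_eq_square algebra_simps)
    then have sq: "(c * y + s * z)\<^sup>2 + (- s * y + c * z)\<^sup>2 = y\<^sup>2 + z\<^sup>2" by (simp add: cs)
    show ?thesis
      unfolding trig_data_def prod.case sq
      using j I ne cong[of "\<lambda>k t. t * frame r k \<phi>"] cong[of "\<lambda>k t. t * frame_deriv r k \<phi>"]
        cong[of "\<lambda>k t. t\<^sup>2"]
      by (simp add: frame_def frame_deriv_def c_def s_def add_divide_distrib diff_divide_distrib algebra_simps)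
  qed
  have "(\<integral>\<^sup>+x. h (trig_data r ?I2 \<phi> x) \<partial>(\<Pi>\<^sub>M k\<in>?I2. lborel)) =
      (\<integral>\<^sup>+y. \<integral>\<^sup>+x. h (trig_data r ?I2 \<phi> (x(int j := y))) \<partial>(\<Pi>\<^sub>M k\<in>?I1. lborel) \<partial>lborel)"
    using I j by (intro product_nn_integral_insert_rev) simp_all
  also have "\<dots> = (\<integral>\<^sup>+y. \<integral>\<^sup>+z. \<integral>\<^sup>+x. h (trig_data r ?I2 \<phi> (x(- int j := z, int j := y)))
      \<partial>(\<Pi>\<^sub>M k\<in>I. lborel) \<partial>lborel \<partial>lborel)"
  proof (intro nn_integral_cong product_nn_integral_insert_rev)
    fix y
    show "(\<lambda>x. h (trig_data r ?I2 \<phi> (x(int j := y)))) \<in> borel_measurable (\<Pi>\<^sub>M k\<in>?I1. lborel)"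
      by measurable
  qed (use I in auto)
  also have "\<dots> = (\<integral>\<^sup>+y. \<integral>\<^sup>+z. H (c * y + s * z, - s * y + c * z) \<partial>lborel \<partial>lborel)"
    unfolding H_def upd by (simp add: case_prod_unfold)
  also have "\<dots> = (\<integral>\<^sup>+\<xi>. \<integral>\<^sup>+\<eta>. H (\<xi>, \<eta>) \<partial>lborel \<partial>lborel)"
    by (rule nn_integral_lborel_rotate) (measurable, simp add: c_def s_def)
  finally show ?thesis by (simp add: H_def)
qed

text \<open>Induction on the number of frequencies. A new mode adds \<xi> to the value and \<eta> to
  the derivative; each is merged with the corresponding old coordinate, and the squared coefficients
  add up to the new \<open>amp\<close> and \<open>lam\<close>. Two coordinates per step are left
  over for the radial part.\<close>

lemma nn_integral_trig_data_nonzero: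
  fixes h :: "real \<times> real \<times> real \<Rightarrow> ennreal"
  assumes "N \<ge> 1" and h [measurable]: "h \<in> borel_measurable (borel \<Otimes>\<^sub>M borel \<Otimes>\<^sub>M borel)"
  shows "(\<integral>\<^sup>+x. h (trig_data r (nonzero_indices N) \<phi> x) \<partial>(\<Pi>\<^sub>M k\<in>nonzero_indices N. lborel)) =
    (\<integral>\<^sup>+s. \<integral>\<^sup>+t. \<integral>\<^sup>+q. h (amp r N * s, lam r N * t, s\<^sup>2 + t\<^sup>2 + q)
      \<partial>sq_measure (2 * N - 2) \<partial>lborel \<partial>lborel)"
  using assms
proof (induction N arbitrary: h rule: nat_induct_at_least)
  \<comment> \<open>A single frequency has two coordinates, used up by value and derivative; the
    rest is \<open>sq_measure 0\<close>, the unit mass at 0.\<close>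
  case base
  note [measurable] = base
  have "nonzero_indices 1 = insert (int 1) (insert (- int 1) {})"
    using nonzero_indices_Suc[of 0] by simp
  then have "(\<integral>\<^sup>+x. h (trig_data r (nonzero_indices 1) \<phi> x) \<partial>(\<Pi>\<^sub>M k\<in>nonzero_indices 1. lborel)) =
      (\<integral>\<^sup>+\<xi>. \<integral>\<^sup>+\<eta>. h (\<xi> / sqrt (tau r 1), \<eta> / sqrt (tau r 1), \<xi>\<^sup>2 + \<eta>\<^sup>2) \<partial>lborel \<partial>lborel)"
    using nn_integral_trig_data_pair[OF base, of 1 "{}" r \<phi>]
    by (simp add: PiM_empty nn_integral_count_space_finite trig_data_def)
  also have "\<dots> = (\<integral>\<^sup>+s. \<integral>\<^sup>+t. \<integral>\<^sup>+q. h (amp r 1 * s, lam r 1 * t, s\<^sup>2 + t\<^sup>2 + q)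
      \<partial>sq_measure (2 * 1 - 2) \<partial>lborel \<partial>lborel)"
    by (simp add: nn_integral_sq_measure_0 amp_def lam_def real_sqrt_divide)
  finally show ?case .
next
  case (Suc N)
  note [measurable] = Suc.prems
  let ?j = "Suc N"
  define b d where "b = 1 / sqrt (tau r ?j)" and "d = real ?j / sqrt (tau r ?j)"
  define a l where "a = amp r N" and "l = lam r N"
  define a' l' where "a' = amp r ?j" and "l' = lam r ?j"
  have sq: "a\<^sup>2 + b\<^sup>2 = a'\<^sup>2" "l\<^sup>2 + d\<^sup>2 = l'\<^sup>2"
    using tau_pos[of r ?j]
    by (simp_all add: a_def a'_def b_def d_def l_def l'_def amp_sq lam_sq power_divide)
  have nz: "a' \<noteq> 0" "l' \<noteq> 0" using amp_pos[of ?j r] lam_pos[of ?j r] by (simp_all add: a'_def l'_def)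
  let ?Q = "sq_measure (2 * N - 2)"
  have "(\<integral>\<^sup>+x. h (trig_data r (nonzero_indices ?j) \<phi> x) \<partial>(\<Pi>\<^sub>M k\<in>nonzero_indices ?j. lborel)) =
    (\<integral>\<^sup>+\<xi>. \<integral>\<^sup>+\<eta>. \<integral>\<^sup>+x. (case trig_data r (nonzero_indices N) \<phi> x of (u, v, w) \<Rightarrow>
      h (u + \<xi> / sqrt (tau r ?j), v + real ?j * \<eta> / sqrt (tau r ?j), \<xi>\<^sup>2 + \<eta>\<^sup>2 + w))
      \<partial>(\<Pi>\<^sub>M k\<in>nonzero_indices N. lborel) \<partial>lborel \<partial>lborel)"
    unfolding nonzero_indices_Suc
    by (rule nn_integral_trig_data_pair[OF Suc.prems]) (auto simp: nonzero_indices_def)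
  also have "\<dots> = (\<integral>\<^sup>+\<xi>. \<integral>\<^sup>+\<eta>. \<integral>\<^sup>+s. \<integral>\<^sup>+t. \<integral>\<^sup>+q.
      h (a * s + b * \<xi>, l * t + d * \<eta>, \<xi>\<^sup>2 + \<eta>\<^sup>2 + (s\<^sup>2 + t\<^sup>2 + q)) \<partial>?Q \<partial>lborel \<partial>lborel \<partial>lborel \<partial>lborel)"
  proof (intro nn_integral_cong)
    fix \<xi> \<eta> :: real
    have "(\<integral>\<^sup>+x. (\<lambda>(u, v, w). h (u + \<xi> / sqrt (tau r ?j), v + real ?j * \<eta> / sqrt (tau r ?j), \<xi>\<^sup>2 + \<eta>\<^sup>2 + w))
        (trig_data r (nonzero_indices N) \<phi> x) \<partial>(\<Pi>\<^sub>M k\<in>nonzero_indices N. lborel)) =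
      (\<integral>\<^sup>+s. \<integral>\<^sup>+t. \<integral>\<^sup>+q. (\<lambda>(u, v, w). h (u + \<xi> / sqrt (tau r ?j), v + real ?j * \<eta> / sqrt (tau r ?j), \<xi>\<^sup>2 + \<eta>\<^sup>2 + w))
        (amp r N * s, lam r N * t, s\<^sup>2 + t\<^sup>2 + q) \<partial>?Q \<partial>lborel \<partial>lborel)"
      by (rule Suc.IH) measurable
    then show "(\<integral>\<^sup>+x. (case trig_data r (nonzero_indices N) \<phi> x of (u, v, w) \<Rightarrow>
      h (u + \<xi> / sqrt (tau r ?j), v + real ?j * \<eta> / sqrt (tau r ?j), \<xi>\<^sup>2 + \<eta>\<^sup>2 + w))
      \<partial>(\<Pi>\<^sub>M k\<in>nonzero_indices N. lborel)) = (\<integral>\<^sup>+s. \<integral>\<^sup>+t. \<integral>\<^sup>+q.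
      h (a * s + b * \<xi>, l * t + d * \<eta>, \<xi>\<^sup>2 + \<eta>\<^sup>2 + (s\<^sup>2 + t\<^sup>2 + q)) \<partial>?Q \<partial>lborel \<partial>lborel)"
      by (simp add: a_def b_def l_def d_def)
  qed
  \<comment> \<open>The integrations are reordered so that each new variable stands next to its
    partner: \<eta> next to t for the derivative, then \<xi> next to s for the value.\<close>
  also have "\<dots> = (\<integral>\<^sup>+\<xi>. \<integral>\<^sup>+s. \<integral>\<^sup>+\<eta>. \<integral>\<^sup>+t. \<integral>\<^sup>+q.
      h (a * s + b * \<xi>, l * t + d * \<eta>, \<xi>\<^sup>2 + \<eta>\<^sup>2 + (s\<^sup>2 + t\<^sup>2 + q)) \<partial>?Q \<partial>lborel \<partial>lborel \<partial>lborel \<partial>lborel)"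
    by (rule nn_integral_cong, rule lborel_pair.Fubini') measurable
  also have "\<dots> = (\<integral>\<^sup>+\<xi>. \<integral>\<^sup>+s. \<integral>\<^sup>+t. \<integral>\<^sup>+\<eta>. \<integral>\<^sup>+q.
      h (a * s + b * \<xi>, l * t + d * \<eta>, \<xi>\<^sup>2 + \<eta>\<^sup>2 + (s\<^sup>2 + t\<^sup>2 + q)) \<partial>?Q \<partial>lborel \<partial>lborel \<partial>lborel \<partial>lborel)"
    by (rule nn_integral_cong, rule nn_integral_cong, rule lborel_pair.Fubini') measurable
  also have "\<dots> = (\<integral>\<^sup>+\<xi>. \<integral>\<^sup>+s. \<integral>\<^sup>+t. \<integral>\<^sup>+\<eta>. \<integral>\<^sup>+q.
      h (a * s + b * \<xi>, l' * t, s\<^sup>2 + \<xi>\<^sup>2 + (t\<^sup>2 + \<eta>\<^sup>2 + q)) \<partial>?Q \<partial>lborel \<partial>lborel \<partial>lborel \<partial>lborel)"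
  proof (rule nn_integral_cong, rule nn_integral_cong)
    fix \<xi> s :: real
    have "(\<integral>\<^sup>+t. \<integral>\<^sup>+\<eta>. (\<lambda>(u, v). \<integral>\<^sup>+q. h (a * s + b * \<xi>, u, s\<^sup>2 + \<xi>\<^sup>2 + (v + q)) \<partial>?Q)
          (l * t + d * \<eta>, t\<^sup>2 + \<eta>\<^sup>2) \<partial>lborel \<partial>lborel) =
      (\<integral>\<^sup>+t. \<integral>\<^sup>+\<eta>. (\<lambda>(u, v). \<integral>\<^sup>+q. h (a * s + b * \<xi>, u, s\<^sup>2 + \<xi>\<^sup>2 + (v + q)) \<partial>?Q)
          (l' * t, t\<^sup>2 + \<eta>\<^sup>2) \<partial>lborel \<partial>lborel)"
      by (rule nn_integral_combine_squares[OF _ sq(2) nz(2)]) measurable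
    then show "(\<integral>\<^sup>+t. \<integral>\<^sup>+\<eta>. \<integral>\<^sup>+q.
      h (a * s + b * \<xi>, l * t + d * \<eta>, \<xi>\<^sup>2 + \<eta>\<^sup>2 + (s\<^sup>2 + t\<^sup>2 + q)) \<partial>?Q \<partial>lborel \<partial>lborel) =
     (\<integral>\<^sup>+t. \<integral>\<^sup>+\<eta>. \<integral>\<^sup>+q.
      h (a * s + b * \<xi>, l' * t, s\<^sup>2 + \<xi>\<^sup>2 + (t\<^sup>2 + \<eta>\<^sup>2 + q)) \<partial>?Q \<partial>lborel \<partial>lborel)"
      by (simp add: add_ac)
  qed
  also have "\<dots> = (\<integral>\<^sup>+s. \<integral>\<^sup>+\<xi>. \<integral>\<^sup>+t. \<integral>\<^sup>+\<eta>. \<integral>\<^sup>+q.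
      h (a * s + b * \<xi>, l' * t, s\<^sup>2 + \<xi>\<^sup>2 + (t\<^sup>2 + \<eta>\<^sup>2 + q)) \<partial>?Q \<partial>lborel \<partial>lborel \<partial>lborel \<partial>lborel)"
    by (rule lborel_pair.Fubini') measurable
  also have "\<dots> = (\<integral>\<^sup>+s. \<integral>\<^sup>+\<xi>. \<integral>\<^sup>+t. \<integral>\<^sup>+\<eta>. \<integral>\<^sup>+q.
      h (a' * s, l' * t, s\<^sup>2 + \<xi>\<^sup>2 + (t\<^sup>2 + \<eta>\<^sup>2 + q)) \<partial>?Q \<partial>lborel \<partial>lborel \<partial>lborel \<partial>lborel)"
  proof -
    have "(\<integral>\<^sup>+s. \<integral>\<^sup>+\<xi>. (\<lambda>(u, v). \<integral>\<^sup>+t. \<integral>\<^sup>+\<eta>. \<integral>\<^sup>+q. h (u, l' * t, v + (t\<^sup>2 + \<eta>\<^sup>2 + q)) \<partial>?Q \<partial>lborel \<partial>lborel)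
          (a * s + b * \<xi>, s\<^sup>2 + \<xi>\<^sup>2) \<partial>lborel \<partial>lborel) =
      (\<integral>\<^sup>+s. \<integral>\<^sup>+\<xi>. (\<lambda>(u, v). \<integral>\<^sup>+t. \<integral>\<^sup>+\<eta>. \<integral>\<^sup>+q. h (u, l' * t, v + (t\<^sup>2 + \<eta>\<^sup>2 + q)) \<partial>?Q \<partial>lborel \<partial>lborel)
          (a' * s, s\<^sup>2 + \<xi>\<^sup>2) \<partial>lborel \<partial>lborel)"
      by (rule nn_integral_combine_squares[OF _ sq(1) nz(1)]) measurable
    then show ?thesis by simp
  qed
  also have "\<dots> = (\<integral>\<^sup>+s. \<integral>\<^sup>+t. \<integral>\<^sup>+\<xi>. \<integral>\<^sup>+\<eta>. \<integral>\<^sup>+q.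
      h (a' * s, l' * t, s\<^sup>2 + \<xi>\<^sup>2 + (t\<^sup>2 + \<eta>\<^sup>2 + q)) \<partial>?Q \<partial>lborel \<partial>lborel \<partial>lborel \<partial>lborel)"
    by (rule nn_integral_cong, rule lborel_pair.Fubini') measurable
  \<comment> \<open>After both merges \<xi> and \<eta> enter only through their squares. They join
    q, which raises the dimension of the radial part by two.\<close>
  also have "\<dots> = (\<integral>\<^sup>+s. \<integral>\<^sup>+t. \<integral>\<^sup>+q. h (a' * s, l' * t, s\<^sup>2 + t\<^sup>2 + q) \<partial>sq_measure (Suc (Suc (2 * N - 2))) \<partial>lborel \<partial>lborel)"
  proof (rule nn_integral_cong, rule nn_integral_cong)
    fix s t :: real
    have "(\<integral>\<^sup>+q. h (a' * s, l' * t, s\<^sup>2 + t\<^sup>2 + q) \<partial>sq_measure (Suc (Suc (2 * N - 2)))) =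
        (\<integral>\<^sup>+\<xi>. \<integral>\<^sup>+q. h (a' * s, l' * t, s\<^sup>2 + t\<^sup>2 + (\<xi>\<^sup>2 + q)) \<partial>sq_measure (Suc (2 * N - 2)) \<partial>lborel)"
      by (rule nn_integral_sq_measure_Suc) measurable
    also have "\<dots> = (\<integral>\<^sup>+\<xi>. \<integral>\<^sup>+\<eta>. \<integral>\<^sup>+q. h (a' * s, l' * t, s\<^sup>2 + t\<^sup>2 + (\<xi>\<^sup>2 + (\<eta>\<^sup>2 + q))) \<partial>?Q \<partial>lborel \<partial>lborel)"
      by (rule nn_integral_cong, rule nn_integral_sq_measure_Suc) measurable
    finally show "(\<integral>\<^sup>+\<xi>. \<integral>\<^sup>+\<eta>. \<integral>\<^sup>+q.
      h (a' * s, l' * t, s\<^sup>2 + \<xi>\<^sup>2 + (t\<^sup>2 + \<eta>\<^sup>2 + q)) \<partial>?Q \<partial>lborel \<partial>lborel) =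
      (\<integral>\<^sup>+q. h (a' * s, l' * t, s\<^sup>2 + t\<^sup>2 + q) \<partial>sq_measure (Suc (Suc (2 * N - 2))))"
      by (simp add: add_ac)
  qed
  also have "Suc (Suc (2 * N - 2)) = 2 * ?j - 2" using Suc.hyps by simp
  finally show ?case by (simp add: a'_def l'_def)
qed

text \<open>The constant frame function 1 / sqrt 2 adds 1 / 2 to the squared norm of evaluation,
  giving 1 / 2 + amp^2 = mu / 2, and nothing to that of the derivative. Of the 2N + 1 coordinates 2N
  - 1 remain in the radial part.\<close>

lemma nn_integral_trig_data:
  fixes h :: "real \<times> real \<times> real \<Rightarrow> ennreal"
  assumes N: "N \<ge> 1" and h [measurable]: "h \<in> borel_measurable (borel \<Otimes>\<^sub>M borel \<Otimes>\<^sub>M borel)"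
  shows "(\<integral>\<^sup>+x. h (trig_data r {- int N..int N} \<phi> x) \<partial>(\<Pi>\<^sub>M k\<in>{- int N..int N}. lborel)) =
    (\<integral>\<^sup>+s. \<integral>\<^sup>+t. \<integral>\<^sup>+q. h (sqrt (mu r N / 2) * s, lam r N * t, s\<^sup>2 + t\<^sup>2 + q)
      \<partial>sq_measure (2 * N - 1) \<partial>lborel \<partial>lborel)"
proof -
  interpret product_sigma_finite "\<lambda>_::int. lborel :: real measure" by standard
  define J where "J = nonzero_indices N"
  have J: "finite J" "0 \<notin> J" "insert 0 J = {- int N..int N}"
    by (simp_all add: J_def insert_zero_nonzero_indices)
  define m where "m = sqrt (mu r N / 2)"
  define a l where "a = amp r N" and "l = lam r N"
  have m: "m\<^sup>2 = mu r N / 2" "m \<noteq> 0" using mu_pos[of r N] by (auto simp: m_def)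
  have sq: "(1 / sqrt 2)\<^sup>2 + a\<^sup>2 = m\<^sup>2"
    unfolding m by (simp add: a_def mu_eq_amp power_divide add_divide_distrib)
  let ?Q = "sq_measure (2 * N - 2)"
  have [measurable]: "(\<lambda>x. h (trig_data r K \<phi> x)) \<in> borel_measurable (\<Pi>\<^sub>M k\<in>K. lborel)" for K
    unfolding trig_data_def by measurable
  have upd: "trig_data r (insert 0 J) \<phi> (x(0 := y)) =
      (case trig_data r J \<phi> x of (u, v, w) \<Rightarrow> ((1 / sqrt 2) * y + u, v, y\<^sup>2 + w))" for x y
  proof -
    have "(\<Sum>k\<in>J. f k ((x(0 := y)) k)) = (\<Sum>k\<in>J. f k (x k))" for f :: "int \<Rightarrow> real \<Rightarrow> real"
      using J by (intro sum.cong) auto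
    note cong = this[of "\<lambda>k t. t * frame r k \<phi>"] this[of "\<lambda>k t. t * frame_deriv r k \<phi>"] this[of "\<lambda>k t. t\<^sup>2"]
    show ?thesis
      using J(1,2) cong by (simp add: trig_data_def frame_def frame_deriv_def)
  qed
  have "(\<integral>\<^sup>+x. h (trig_data r (insert 0 J) \<phi> x) \<partial>(\<Pi>\<^sub>M k\<in>insert 0 J. lborel)) =
      (\<integral>\<^sup>+y. \<integral>\<^sup>+x. h (trig_data r (insert 0 J) \<phi> (x(0 := y))) \<partial>(\<Pi>\<^sub>M k\<in>J. lborel) \<partial>lborel)"
    using J by (intro product_nn_integral_insert_rev) simp_all
  also have "\<dots> = (\<integral>\<^sup>+y. \<integral>\<^sup>+s. \<integral>\<^sup>+t. \<integral>\<^sup>+q. h ((1 / sqrt 2) * y + a * s, l * t, y\<^sup>2 + s\<^sup>2 + (t\<^sup>2 + q))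
      \<partial>?Q \<partial>lborel \<partial>lborel \<partial>lborel)"
  proof (rule nn_integral_cong)
    fix y :: real
    have "(\<integral>\<^sup>+x. (\<lambda>(u, v, w). h ((1 / sqrt 2) * y + u, v, y\<^sup>2 + w)) (trig_data r J \<phi> x) \<partial>(\<Pi>\<^sub>M k\<in>J. lborel)) =
        (\<integral>\<^sup>+s. \<integral>\<^sup>+t. \<integral>\<^sup>+q. (\<lambda>(u, v, w). h ((1 / sqrt 2) * y + u, v, y\<^sup>2 + w))
          (amp r N * s, lam r N * t, s\<^sup>2 + t\<^sup>2 + q) \<partial>?Q \<partial>lborel \<partial>lborel)"
      unfolding J_def by (rule nn_integral_trig_data_nonzero[OF N]) measurable
    then show "(\<integral>\<^sup>+x. h (trig_data r (insert 0 J) \<phi> (x(0 := y))) \<partial>(\<Pi>\<^sub>M k\<in>J. lborel)) =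
        (\<integral>\<^sup>+s. \<integral>\<^sup>+t. \<integral>\<^sup>+q. h ((1 / sqrt 2) * y + a * s, l * t, y\<^sup>2 + s\<^sup>2 + (t\<^sup>2 + q)) \<partial>?Q \<partial>lborel \<partial>lborel)"
      unfolding upd by (simp add: case_prod_unfold a_def l_def add_ac)
  qed
  also have "\<dots> = (\<integral>\<^sup>+s. \<integral>\<^sup>+y. \<integral>\<^sup>+t. \<integral>\<^sup>+q. h (m * s, l * t, s\<^sup>2 + y\<^sup>2 + (t\<^sup>2 + q))
      \<partial>?Q \<partial>lborel \<partial>lborel \<partial>lborel)"
  proof -
    have "(\<integral>\<^sup>+y. \<integral>\<^sup>+s. (\<lambda>(u, v). \<integral>\<^sup>+t. \<integral>\<^sup>+q. h (u, l * t, v + (t\<^sup>2 + q)) \<partial>?Q \<partial>lborel)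
          ((1 / sqrt 2) * y + a * s, y\<^sup>2 + s\<^sup>2) \<partial>lborel \<partial>lborel) =
      (\<integral>\<^sup>+y. \<integral>\<^sup>+s. (\<lambda>(u, v). \<integral>\<^sup>+t. \<integral>\<^sup>+q. h (u, l * t, v + (t\<^sup>2 + q)) \<partial>?Q \<partial>lborel)
          (m * y, y\<^sup>2 + s\<^sup>2) \<partial>lborel \<partial>lborel)"
      by (rule nn_integral_combine_squares[OF _ sq m(2)]) measurable
    then show ?thesis by simp
  qed
  also have "\<dots> = (\<integral>\<^sup>+s. \<integral>\<^sup>+t. \<integral>\<^sup>+y. \<integral>\<^sup>+q. h (m * s, l * t, s\<^sup>2 + y\<^sup>2 + (t\<^sup>2 + q))
      \<partial>?Q \<partial>lborel \<partial>lborel \<partial>lborel)"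
    by (rule nn_integral_cong, rule lborel_pair.Fubini') measurable
  also have "\<dots> = (\<integral>\<^sup>+s. \<integral>\<^sup>+t. \<integral>\<^sup>+q. h (m * s, l * t, s\<^sup>2 + t\<^sup>2 + q)
      \<partial>sq_measure (Suc (2 * N - 2)) \<partial>lborel \<partial>lborel)"
  proof (rule nn_integral_cong, rule nn_integral_cong)
    fix s t :: real
    have "(\<integral>\<^sup>+q. h (m * s, l * t, s\<^sup>2 + t\<^sup>2 + q) \<partial>sq_measure (Suc (2 * N - 2))) =
        (\<integral>\<^sup>+y. \<integral>\<^sup>+q. h (m * s, l * t, s\<^sup>2 + t\<^sup>2 + (y\<^sup>2 + q)) \<partial>?Q \<partial>lborel)"
      by (rule nn_integral_sq_measure_Suc) measurable
    then show "(\<integral>\<^sup>+y. \<integral>\<^sup>+q. h (m * s, l * t, s\<^sup>2 + y\<^sup>2 + (t\<^sup>2 + q)) \<partial>?Q \<partial>lborel) =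
        (\<integral>\<^sup>+q. h (m * s, l * t, s\<^sup>2 + t\<^sup>2 + q) \<partial>sq_measure (Suc (2 * N - 2)))"
      by (simp add: add_ac)
  qed
  also have "Suc (2 * N - 2) = 2 * N - 1" using N by simp
  finally show ?thesis by (simp add: J m_def l_def)
qed

section \<open>Radial integrals\<close>

interpretation sq_lborel: pair_sigma_finite "sq_measure m" "lborel :: real measure" for m
  by standard

text \<open>The volume of a k-dimensional ball as a function of its squared radius. It vanishes for
  negative R, so the condition that a point lies in the ball needs no case distinction.\<close>

definition ball_mass :: "nat \<Rightarrow> real \<Rightarrow> ennreal" where
  "ball_mass k R = emeasure (sq_measure k) {..R}"

text \<open>With R moved from the set into the integrand, measurability in R becomes that of an
  integral with a parameter.\<close>

lemma ball_mass_eq_nn_integral: "ball_mass k R = (\<integral>\<^sup>+q. indicator {..0} (q - R) \<partial>sq_measure k)"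
proof -
  have "(indicator {..0} (q - R) :: ennreal) = indicator {..R} q" for q by (simp add: indicator_def)
  then show ?thesis by (simp add: ball_mass_def)
qed

lemma measurable_ball_mass [measurable]: "ball_mass k \<in> borel_measurable borel"
  unfolding ball_mass_eq_nn_integral[abs_def] by measurable

lemma nn_integral_indicator_sq_measure:
  "(\<integral>\<^sup>+q. indicator {..1} (c + q) \<partial>sq_measure k) = ball_mass k (1 - c)"
  unfolding ball_mass_eq_nn_integral by (intro nn_integral_cong) (simp add: indicator_def)

text \<open>Slicing a ball in R^(m+k): over a point of squared norm p in R^m the slice is a
  k-dimensional ball of squared radius R - p.\<close>

lemma nn_integral_ball_mass: "(\<integral>\<^sup>+p. ball_mass k (R - p) \<partial>sq_measure m) = ball_mass (m + k) R"
proof -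
  have "(\<integral>\<^sup>+p. ball_mass k (R - p) \<partial>sq_measure m) =
      (\<integral>\<^sup>+p. \<integral>\<^sup>+q. indicator {..0} (p + q - R) \<partial>sq_measure k \<partial>sq_measure m)"
    unfolding ball_mass_eq_nn_integral by (simp add: algebra_simps)
  also have "\<dots> = ball_mass (m + k) R"
    unfolding ball_mass_eq_nn_integral by (rule nn_integral_sq_measure_add) measurable
  finally show ?thesis .
qed

lemma nn_integral_sq_measure_1:
  assumes [measurable]: "h \<in> borel_measurable borel"
  shows "(\<integral>\<^sup>+q. h q \<partial>sq_measure 1) = (\<integral>\<^sup>+t. h (t\<^sup>2) \<partial>lborel)"
  using nn_integral_sq_measure_Suc[of h 0] by (simp add: nn_integral_sq_measure_0)

lemma nn_integral_sq_measure_2: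
  assumes [measurable]: "h \<in> borel_measurable borel"
  shows "(\<integral>\<^sup>+q. h q \<partial>sq_measure 2) = (\<integral>\<^sup>+s. \<integral>\<^sup>+t. h (s\<^sup>2 + t\<^sup>2) \<partial>lborel \<partial>lborel)"
proof -
  have "(\<integral>\<^sup>+q. h q \<partial>sq_measure (Suc 1)) = (\<integral>\<^sup>+s. \<integral>\<^sup>+q. h (s\<^sup>2 + q) \<partial>sq_measure 1 \<partial>lborel)"
    by (rule nn_integral_sq_measure_Suc) measurable
  also have "\<dots> = (\<integral>\<^sup>+s. \<integral>\<^sup>+t. h (s\<^sup>2 + t\<^sup>2) \<partial>lborel \<partial>lborel)"
    by (rule nn_integral_cong, rule nn_integral_sq_measure_1) measurable
  finally show ?thesis by (simp add: numeral_2_eq_2)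
qed

lemma nn_integral_sq_measure_density:
  assumes "m > 0" and [measurable]: "h \<in> borel_measurable borel"
  shows "(\<integral>\<^sup>+q. h q \<partial>sq_measure m) = (\<integral>\<^sup>+q. ennreal (indicator {0<..} q *
    (unit_ball_vol (real m) * (real m / 2) * q powr (real m / 2 - 1))) * h q \<partial>lborel)"
  unfolding sq_measure_eq_density[OF assms(1)] by (subst nn_integral_density) measurable

text \<open>Under q = t^2 the measure |t| dt becomes dq on the positive half-line, both signs of t
  contributing one half. The radial law of the plane is pi dq. A weight |t| on the line thus acts
  like one more dimension, up to the factor pi.\<close>

lemma nn_integral_abs_mult_square:
  assumes [measurable]: "g \<in> borel_measurable borel"
  shows "ennreal pi * (\<integral>\<^sup>+t. ennreal \<bar>t\<bar> * g (t\<^sup>2) \<partial>lborel) = (\<integral>\<^sup>+q. g q \<partial>sq_measure 2)"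
proof -
  have "(\<integral>\<^sup>+t. ennreal \<bar>t\<bar> * g (t\<^sup>2) \<partial>lborel) = (\<integral>\<^sup>+q. ennreal (sqrt q) * g q \<partial>sq_measure 1)"
    by (subst nn_integral_sq_measure_1) simp_all
  also have "\<dots> = (\<integral>\<^sup>+q. indicator {0<..} q * g q \<partial>lborel)"
  proof (subst nn_integral_sq_measure_density)
    show "(\<integral>\<^sup>+q. ennreal (indicator {0<..} q *
        (unit_ball_vol (real 1) * (real 1 / 2) * q powr (real 1 / 2 - 1))) * (ennreal (sqrt q) * g q) \<partial>lborel) =
      (\<integral>\<^sup>+q. indicator {0<..} q * g q \<partial>lborel)"
    proof (rule nn_integral_cong)
      fix q :: real
      show "ennreal (indicator {0<..} q * (unit_ball_vol (real 1) * (real 1 / 2) * q powr (real 1 / 2 - 1))) *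
          (ennreal (sqrt q) * g q) = indicator {0<..} q * g q"
      proof (cases "q > 0")
        case True
        have "q powr (1 / 2 - 1) * sqrt q = 1"
          using True by (simp add: powr_half_sqrt[symmetric] powr_add[symmetric])
        then have "ennreal (q powr (1 / 2 - 1)) * ennreal (sqrt q) = 1"
          by (simp add: ennreal_mult'[symmetric])
        then show ?thesis using True by (simp add: mult.assoc[symmetric])
      qed simp
    qed
  qed simp_all
  also have "ennreal pi * \<dots> = (\<integral>\<^sup>+q. ennreal pi * (indicator {0<..} q * g q) \<partial>lborel)"
    by (rule nn_integral_cmult[symmetric]) measurable
  also have "\<dots> = (\<integral>\<^sup>+q. g q \<partial>sq_measure 2)"
    by (subst nn_integral_sq_measure_density)
      (auto intro!: nn_integral_cong simp: indicator_def eval_unit_ball_vol)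
  finally show ?thesis .
qed

text \<open>Comparison of densities: pi in dimension two and 2 pi sqrt q in dimension three. A
  weight given by the norm in the plane acts like one more dimension, up to the factor 2.\<close>

lemma nn_integral_sqrt_sq_measure_2:
  assumes [measurable]: "g \<in> borel_measurable borel"
  shows "2 * (\<integral>\<^sup>+q. ennreal (sqrt q) * g q \<partial>sq_measure 2) = (\<integral>\<^sup>+q. g q \<partial>sq_measure 3)"
proof -
  have "2 * (\<integral>\<^sup>+q. ennreal (sqrt q) * g q \<partial>sq_measure 2) = (\<integral>\<^sup>+q. 2 * (ennreal (sqrt q) * g q) \<partial>sq_measure 2)"
    by (rule nn_integral_cmult[symmetric]) measurable
  also have "\<dots> = (\<integral>\<^sup>+q. ennreal (indicator {0<..} q *
        (unit_ball_vol (real 2) * (real 2 / 2) * q powr (real 2 / 2 - 1))) * (2 * (ennreal (sqrt q) * g q)) \<partial>lborel)"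
    by (rule nn_integral_sq_measure_density) simp_all
  also have "\<dots> = (\<integral>\<^sup>+q. ennreal (indicator {0<..} q *
        (unit_ball_vol (real 3) * (real 3 / 2) * q powr (real 3 / 2 - 1))) * g q \<partial>lborel)"
  proof (rule nn_integral_cong)
    fix q :: real
    show "ennreal (indicator {0<..} q *
        (unit_ball_vol (real 2) * (real 2 / 2) * q powr (real 2 / 2 - 1))) * (2 * (ennreal (sqrt q) * g q)) =
      ennreal (indicator {0<..} q *
        (unit_ball_vol (real 3) * (real 3 / 2) * q powr (real 3 / 2 - 1))) * g q"
    proof (cases "q > 0")
      case True
      have "ennreal pi * (2 * ennreal (sqrt q)) = ennreal (pi * (2 * sqrt q))"
        by (simp add: ennreal_mult' ennreal_mult'')
      also have "pi * (2 * sqrt q) = 4 / 3 * pi * (3 / 2) * q powr (3 / 2 - 1)"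
        using True by (simp add: powr_half_sqrt)
      finally show ?thesis
        using True by (simp add: eval_unit_ball_vol mult.assoc[symmetric])
    qed simp
  qed
  also have "\<dots> = (\<integral>\<^sup>+q. g q \<partial>sq_measure 3)"
    by (rule nn_integral_sq_measure_density[symmetric]) simp_all
  finally show ?thesis .
qed

text \<open>The coordinate s with its weight counts as two dimensions and t as one, so a planar
  integral against k-balls yields a (k+3)-ball. This is the form in which the velocity of the first
  curve is integrated.\<close>

lemma nn_integral_abs_ball_mass:
  "ennreal pi * (\<integral>\<^sup>+s. \<integral>\<^sup>+t. ennreal \<bar>s\<bar> * ball_mass k (R - (s\<^sup>2 + t\<^sup>2)) \<partial>lborel \<partial>lborel) = ball_mass (k + 3) R"
proof -
  have "(\<integral>\<^sup>+s. \<integral>\<^sup>+t. ennreal \<bar>s\<bar> * ball_mass k (R - (s\<^sup>2 + t\<^sup>2)) \<partial>lborel \<partial>lborel) =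
      (\<integral>\<^sup>+t. \<integral>\<^sup>+s. ennreal \<bar>s\<bar> * ball_mass k (R - t\<^sup>2 - s\<^sup>2) \<partial>lborel \<partial>lborel)"
    by (subst lborel_pair.Fubini') (simp_all add: algebra_simps)
  also have "ennreal pi * \<dots> =
      (\<integral>\<^sup>+t. ennreal pi * (\<integral>\<^sup>+s. ennreal \<bar>s\<bar> * ball_mass k (R - t\<^sup>2 - s\<^sup>2) \<partial>lborel) \<partial>lborel)"
    by (rule nn_integral_cmult[symmetric]) measurable
  also have "\<dots> = (\<integral>\<^sup>+t. \<integral>\<^sup>+q. ball_mass k (R - t\<^sup>2 - q) \<partial>sq_measure 2 \<partial>lborel)"
    by (rule nn_integral_cong, rule nn_integral_abs_mult_square) measurable
  also have "\<dots> = (\<integral>\<^sup>+t. ball_mass (2 + k) (R - t\<^sup>2) \<partial>lborel)"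
    by (simp only: nn_integral_ball_mass)
  also have "\<dots> = (\<integral>\<^sup>+q. ball_mass (2 + k) (R - q) \<partial>sq_measure 1)"
    by (rule nn_integral_sq_measure_1[symmetric]) measurable
  also have "\<dots> = ball_mass (k + 3) R"
    by (simp only: nn_integral_ball_mass) (simp add: add.commute eval_nat_numeral)
  finally show ?thesis .
qed

text \<open>The companion with the planar norm as weight, used for the speed of the second curve. It
  produces the same dimension k + 3.\<close>

lemma nn_integral_norm_ball_mass:
  "2 * (\<integral>\<^sup>+s. \<integral>\<^sup>+t. ennreal (sqrt (s\<^sup>2 + t\<^sup>2)) * ball_mass k (R - (s\<^sup>2 + t\<^sup>2)) \<partial>lborel \<partial>lborel) = ball_mass (k + 3) R"
proof -
  have "(\<integral>\<^sup>+s. \<integral>\<^sup>+t. ennreal (sqrt (s\<^sup>2 + t\<^sup>2)) * ball_mass k (R - (s\<^sup>2 + t\<^sup>2)) \<partial>lborel \<partial>lborel) =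
      (\<integral>\<^sup>+q. ennreal (sqrt q) * ball_mass k (R - q) \<partial>sq_measure 2)"
    by (rule nn_integral_sq_measure_2[symmetric]) measurable
  then show ?thesis
    by (simp add: nn_integral_sqrt_sq_measure_2 nn_integral_ball_mass add.commute)
qed

text \<open>Squaring doubles the exponent of the squared radius, so the square of an n-ball volume
  is a constant multiple of a 2n-ball volume. Slicing then gives the unit ball of dimension 2n + 2,
  and pi / (n + 1) is the quotient of the unit ball volumes in dimensions 2n + 2 and 2n.\<close>

lemma nn_integral_ball_mass_square:
  assumes "n > 0"
  shows "(\<integral>\<^sup>+s. \<integral>\<^sup>+t. (ball_mass n (1 - (s\<^sup>2 + t\<^sup>2)))\<^sup>2 \<partial>lborel \<partial>lborel) =
    ennreal ((unit_ball_vol (real n))\<^sup>2 * (pi / (real n + 1)))"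
proof -
  let ?c = "(unit_ball_vol (real n))\<^sup>2 / unit_ball_vol (real (2 * n))"
  have w: "unit_ball_vol (real k) > 0" for k by (rule unit_ball_vol_pos) simp
  have sq: "(ball_mass n R)\<^sup>2 = ennreal ?c * ball_mass (2 * n) R" for R
  proof (cases "R < 0")
    case False
    have "(R powr (real n / 2))\<^sup>2 = R powr (real (2 * n) / 2)"
      by (simp add: power2_eq_square powr_add[symmetric])
    then have "(unit_ball_vol (real n) * R powr (real n / 2))\<^sup>2 =
        ?c * (unit_ball_vol (real (2 * n)) * R powr (real (2 * n) / 2))"
      using less_imp_neq[OF w[of "2 * n"]] by (simp add: power_mult_distrib del: of_nat_mult)
    then show ?thesis
      using False assms less_imp_neq[OF w[of "2 * n"]]
      by (simp add: ball_mass_def emeasure_sq_measure_atMost ennreal_power ennreal_mult'[symmetric]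
          del: of_nat_mult)
  qed (use assms in \<open>simp add: ball_mass_def emeasure_sq_measure_atMost\<close>)
  have "(\<integral>\<^sup>+s. \<integral>\<^sup>+t. (ball_mass n (1 - (s\<^sup>2 + t\<^sup>2)))\<^sup>2 \<partial>lborel \<partial>lborel) =
      (\<integral>\<^sup>+q. (ball_mass n (1 - q))\<^sup>2 \<partial>sq_measure 2)"
    by (rule nn_integral_sq_measure_2[symmetric]) measurable
  also have "\<dots> = ennreal ?c * (\<integral>\<^sup>+q. ball_mass (2 * n) (1 - q) \<partial>sq_measure 2)"
    unfolding sq by (rule nn_integral_cmult) measurable
  also have "\<dots> = ennreal ?c * ennreal (unit_ball_vol (real (2 * Suc n)))"
    by (subst nn_integral_ball_mass) (simp add: ball_mass_def emeasure_sq_measure_atMost)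
  also have "\<dots> = ennreal (?c * unit_ball_vol (real (2 * Suc n)))"
    using w[of "2 * n"] by (simp add: ennreal_mult'[symmetric] del: of_nat_mult of_nat_Suc)
  also have "unit_ball_vol (real (2 * Suc n)) = unit_ball_vol (real (2 * n)) * (pi / (real n + 1))"
    unfolding unit_ball_vol_even by (simp add: field_simps)
  finally show ?thesis using w[of "2 * n"] by (simp del: of_nat_mult)
qed

text \<open>For fixed w the determinant is a linear functional of (s, t) whose norm is that of w. A
  rotation turns it into |w| times a single coordinate.\<close>

lemma nn_integral_det_radial:
  assumes [measurable]: "g \<in> borel_measurable borel"
  shows "(\<integral>\<^sup>+s. \<integral>\<^sup>+t. ennreal \<bar>s * w2 - t * w1\<bar> * g (s\<^sup>2 + t\<^sup>2) \<partial>lborel \<partial>lborel) =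
    ennreal (sqrt (w1\<^sup>2 + w2\<^sup>2)) * (\<integral>\<^sup>+s. \<integral>\<^sup>+t. ennreal \<bar>s\<bar> * g (s\<^sup>2 + t\<^sup>2) \<partial>lborel \<partial>lborel)"
proof (cases "w1 = 0 \<and> w2 = 0")
  case False
  define w where "w = sqrt (w1\<^sup>2 + w2\<^sup>2)"
  have w: "w2\<^sup>2 + (- w1)\<^sup>2 = w\<^sup>2" "w \<noteq> 0" "w \<ge> 0"
    using False by (auto simp: w_def sum_power2_eq_zero_iff)
  have "(\<integral>\<^sup>+s. \<integral>\<^sup>+t. (\<lambda>(u, v). ennreal \<bar>u\<bar> * g v) (w2 * s + - w1 * t, s\<^sup>2 + t\<^sup>2) \<partial>lborel \<partial>lborel) =
      (\<integral>\<^sup>+s. \<integral>\<^sup>+t. (\<lambda>(u, v). ennreal \<bar>u\<bar> * g v) (w * s, s\<^sup>2 + t\<^sup>2) \<partial>lborel \<partial>lborel)"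
    by (rule nn_integral_combine_squares[OF _ w(1,2)]) measurable
  then have "(\<integral>\<^sup>+s. \<integral>\<^sup>+t. ennreal \<bar>s * w2 - t * w1\<bar> * g (s\<^sup>2 + t\<^sup>2) \<partial>lborel \<partial>lborel) =
      (\<integral>\<^sup>+s. \<integral>\<^sup>+t. ennreal w * (ennreal \<bar>s\<bar> * g (s\<^sup>2 + t\<^sup>2)) \<partial>lborel \<partial>lborel)"
    using w(3) by (simp add: abs_mult ennreal_mult' mult.commute mult.left_commute)
  also have "\<dots> = ennreal w * (\<integral>\<^sup>+s. \<integral>\<^sup>+t. ennreal \<bar>s\<bar> * g (s\<^sup>2 + t\<^sup>2) \<partial>lborel \<partial>lborel)"
    by (simp add: nn_integral_cmult)
  finally show ?thesis by (simp add: w_def)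
qed simp

text \<open>The quadratic s^2 + 2 (z - a s)^2 has leading coefficient \<mu> and minimum 2 z^2 /
  \<mu>. The factor 1 / sqrt \<mu> is the Jacobian of the affine substitution that centres and
  normalises it.\<close>

lemma nn_integral_complete_square:
  assumes [measurable]: "h \<in> borel_measurable borel" and \<mu>: "\<mu> = 1 + 2 * a\<^sup>2"
  shows "(\<integral>\<^sup>+s. h (s\<^sup>2 + 2 * (z - a * s)\<^sup>2) \<partial>lborel) =
    ennreal (1 / sqrt \<mu>) * (\<integral>\<^sup>+s. h (s\<^sup>2 + 2 * z\<^sup>2 / \<mu>) \<partial>lborel)"
proof -
  have pos: "\<mu> > 0" by (simp add: \<mu> add_pos_nonneg)
  have eq: "(sqrt \<mu> * s + - 2 * a * z / sqrt \<mu>)\<^sup>2 + 2 * z\<^sup>2 / \<mu> = s\<^sup>2 + 2 * (z - a * s)\<^sup>2" for s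
  proof -
    have "(sqrt \<mu> * s + - 2 * a * z / sqrt \<mu>)\<^sup>2 = (sqrt \<mu> * s)\<^sup>2 - 4 * a * z * s + (2 * a * z / sqrt \<mu>)\<^sup>2"
      unfolding power2_sum using pos by simp
    also have "\<dots> = \<mu> * s\<^sup>2 - 4 * a * z * s + 4 * a\<^sup>2 * z\<^sup>2 / \<mu>"
      using pos by (simp add: power_mult_distrib power_divide)
    finally have "(sqrt \<mu> * s + - 2 * a * z / sqrt \<mu>)\<^sup>2 + 2 * z\<^sup>2 / \<mu> =
        \<mu> * s\<^sup>2 - 4 * a * z * s + (2 * z\<^sup>2) * (1 + 2 * a\<^sup>2) / \<mu>"
      by (simp add: add_divide_distrib algebra_simps)
    also have "\<dots> = \<mu> * s\<^sup>2 - 4 * a * z * s + 2 * z\<^sup>2"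
      using pos \<mu> by (metis less_irrefl nonzero_mult_div_cancel_right)
    also have "\<dots> = s\<^sup>2 + 2 * (z - a * s)\<^sup>2" by (simp add: \<mu> power2_eq_square algebra_simps)
    finally show ?thesis .
  qed
  have "ennreal \<bar>sqrt \<mu>\<bar> * (\<integral>\<^sup>+s. h ((sqrt \<mu> * s + - 2 * a * z / sqrt \<mu>)\<^sup>2 + 2 * z\<^sup>2 / \<mu>) \<partial>lborel) =
      (\<integral>\<^sup>+s. h (s\<^sup>2 + 2 * z\<^sup>2 / \<mu>) \<partial>lborel)"
    by (rule nn_integral_lborel_scale) (measurable, use pos in simp)
  then have "ennreal (1 / sqrt \<mu>) * (\<integral>\<^sup>+s. h (s\<^sup>2 + 2 * z\<^sup>2 / \<mu>) \<partial>lborel) =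
      ennreal (1 / sqrt \<mu>) * (ennreal (sqrt \<mu>) * (\<integral>\<^sup>+s. h (s\<^sup>2 + 2 * (z - a * s)\<^sup>2) \<partial>lborel))"
    unfolding eq using pos by simp
  also have "\<dots> = ennreal (1 / sqrt \<mu> * sqrt \<mu>) * (\<integral>\<^sup>+s. h (s\<^sup>2 + 2 * (z - a * s)\<^sup>2) \<partial>lborel)"
    using pos by (simp only: mult.assoc[symmetric] ennreal_mult'' real_sqrt_ge_zero less_imp_le)
  finally show ?thesis using pos by simp
qed

text \<open>One component of the first curve, whose constant coefficient sqrt 2 (z - u) is forced by
  the condition that the value be z; this accounts for the summand 2 (z - u)^2. After completing the
  square, s enters only through s^2 and joins the radial part, whose dimension becomes 2N -
  1.\<close>

lemma nn_integral_nonzero_trig_data_reduced: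
  fixes k :: "real \<times> real \<Rightarrow> ennreal"
  assumes N: "N \<ge> 1" and [measurable]: "k \<in> borel_measurable (borel \<Otimes>\<^sub>M borel)"
  shows "(\<integral>\<^sup>+x. (case trig_data r (nonzero_indices N) \<phi> x of (u, v, w) \<Rightarrow> k (v, w + 2 * (z - u)\<^sup>2))
      \<partial>(\<Pi>\<^sub>M k\<in>nonzero_indices N. lborel)) =
    ennreal (1 / sqrt (mu r N)) * (\<integral>\<^sup>+t. \<integral>\<^sup>+q. k (lam r N * t, 2 * z\<^sup>2 / mu r N + t\<^sup>2 + q)
      \<partial>sq_measure (2 * N - 1) \<partial>lborel)"
proof -
  let ?Q = "sq_measure (2 * N - 2)"
  define a l m where "a = amp r N" and "l = lam r N" and "m = mu r N"
  have m: "m = 1 + 2 * a\<^sup>2" by (simp add: m_def a_def mu_eq_amp)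
  have "(\<integral>\<^sup>+x. (\<lambda>(u, v, w). k (v, w + 2 * (z - u)\<^sup>2)) (trig_data r (nonzero_indices N) \<phi> x)
      \<partial>(\<Pi>\<^sub>M k\<in>nonzero_indices N. lborel)) =
    (\<integral>\<^sup>+s. \<integral>\<^sup>+t. \<integral>\<^sup>+q. (\<lambda>(u, v, w). k (v, w + 2 * (z - u)\<^sup>2)) (amp r N * s, lam r N * t, s\<^sup>2 + t\<^sup>2 + q)
      \<partial>?Q \<partial>lborel \<partial>lborel)"
    by (rule nn_integral_trig_data_nonzero[OF N]) measurable
  then have "(\<integral>\<^sup>+x. (case trig_data r (nonzero_indices N) \<phi> x of (u, v, w) \<Rightarrow> k (v, w + 2 * (z - u)\<^sup>2))
      \<partial>(\<Pi>\<^sub>M k\<in>nonzero_indices N. lborel)) =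
    (\<integral>\<^sup>+s. \<integral>\<^sup>+t. \<integral>\<^sup>+q. k (l * t, s\<^sup>2 + 2 * (z - a * s)\<^sup>2 + (t\<^sup>2 + q)) \<partial>?Q \<partial>lborel \<partial>lborel)"
    by (simp add: a_def l_def add_ac)
  also have "\<dots> = (\<integral>\<^sup>+t. \<integral>\<^sup>+s. \<integral>\<^sup>+q. k (l * t, s\<^sup>2 + 2 * (z - a * s)\<^sup>2 + (t\<^sup>2 + q)) \<partial>?Q \<partial>lborel \<partial>lborel)"
    by (rule lborel_pair.Fubini') measurable
  also have "\<dots> = (\<integral>\<^sup>+t. ennreal (1 / sqrt m) *
      (\<integral>\<^sup>+q. k (l * t, 2 * z\<^sup>2 / m + t\<^sup>2 + q) \<partial>sq_measure (Suc (2 * N - 2))) \<partial>lborel)"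
  proof (rule nn_integral_cong)
    fix t
    have "(\<integral>\<^sup>+s. \<integral>\<^sup>+q. k (l * t, s\<^sup>2 + 2 * (z - a * s)\<^sup>2 + (t\<^sup>2 + q)) \<partial>?Q \<partial>lborel) =
        ennreal (1 / sqrt m) * (\<integral>\<^sup>+s. \<integral>\<^sup>+q. k (l * t, s\<^sup>2 + 2 * z\<^sup>2 / m + (t\<^sup>2 + q)) \<partial>?Q \<partial>lborel)"
      by (rule nn_integral_complete_square[OF _ m]) measurable
    also have "(\<integral>\<^sup>+s. \<integral>\<^sup>+q. k (l * t, s\<^sup>2 + 2 * z\<^sup>2 / m + (t\<^sup>2 + q)) \<partial>?Q \<partial>lborel) =
        (\<integral>\<^sup>+s. \<integral>\<^sup>+q. k (l * t, 2 * z\<^sup>2 / m + t\<^sup>2 + (s\<^sup>2 + q)) \<partial>?Q \<partial>lborel)"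
      by (simp add: add_ac)
    also have "\<dots> = (\<integral>\<^sup>+q. k (l * t, 2 * z\<^sup>2 / m + t\<^sup>2 + q) \<partial>sq_measure (Suc (2 * N - 2)))"
      by (rule nn_integral_sq_measure_Suc[symmetric]) measurable
    finally show "(\<integral>\<^sup>+s. \<integral>\<^sup>+q. k (l * t, s\<^sup>2 + 2 * (z - a * s)\<^sup>2 + (t\<^sup>2 + q)) \<partial>?Q \<partial>lborel) =
      ennreal (1 / sqrt m) * (\<integral>\<^sup>+q. k (l * t, 2 * z\<^sup>2 / m + t\<^sup>2 + q) \<partial>sq_measure (Suc (2 * N - 2)))" .
  qed
  also have "\<dots> = ennreal (1 / sqrt m) *
      (\<integral>\<^sup>+t. \<integral>\<^sup>+q. k (l * t, 2 * z\<^sup>2 / m + t\<^sup>2 + q) \<partial>sq_measure (Suc (2 * N - 2)) \<partial>lborel)"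
    by (rule nn_integral_cmult) measurable
  also have "Suc (2 * N - 2) = 2 * N - 1" using N by simp
  finally show ?thesis by (simp add: l_def m_def)
qed

text \<open>Integration over the nonconstant coordinates of the first curve, with the position (z1,
  z2) and the velocity (w1, w2) of the second curve fixed. The square is completed in each
  component, giving 1 / mu; the velocity of the first curve is \<open>lam\<close> times (s, t), and
  the weight |s| gives 1 / pi. The dimension is 2 (2N - 1) + 3 = 4N + 1.\<close>

lemma nn_integral_det_nonzero_frames:
  assumes N: "N \<ge> 1"
  shows "(\<integral>\<^sup>+x. \<integral>\<^sup>+y. (case (trig_data r (nonzero_indices N) \<phi> x, trig_data r (nonzero_indices N) \<phi> y) of
        ((u1, v1, n1), (u2, v2, n2)) \<Rightarrow>
      ennreal \<bar>v1 * w2 - v2 * w1\<bar> * indicator {..1} (n1 + 2 * (z1 - u1)\<^sup>2 + (n2 + 2 * (z2 - u2)\<^sup>2)))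
      \<partial>(\<Pi>\<^sub>M k\<in>nonzero_indices N. lborel) \<partial>(\<Pi>\<^sub>M k\<in>nonzero_indices N. lborel)) =
    ennreal (lam r N / (mu r N * pi)) * ennreal (sqrt (w1\<^sup>2 + w2\<^sup>2)) *
      ball_mass (4 * N + 1) (1 - 2 * (z1\<^sup>2 + z2\<^sup>2) / mu r N)"
proof -
  define J P where "J = nonzero_indices N" and "P = (\<Pi>\<^sub>M k\<in>J. lborel :: real measure)"
  define l m where "l = lam r N" and "m = mu r N"
  define R where "R = 1 - 2 * (z1\<^sup>2 + z2\<^sup>2) / m"
  let ?Q = "sq_measure (2 * N - 1)"
  have m: "m > 0" by (simp add: m_def mu_pos)
  have l: "l > 0" using lam_pos[OF N] by (simp add: l_def)
  note red = nn_integral_nonzero_trig_data_reduced[where r = r and \<phi> = \<phi>, OF N, folded J_def, folded P_def,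
      folded l_def, folded m_def]
  define K where "K = (\<lambda>(v1, e1). ennreal (1 / sqrt m) * (\<integral>\<^sup>+t. \<integral>\<^sup>+q.
      ennreal \<bar>v1 * w2 - (l * t) * w1\<bar> * indicator {..1} (e1 + (2 * z2\<^sup>2 / m + t\<^sup>2 + q)) \<partial>?Q \<partial>lborel))"
  have [measurable]: "K \<in> borel_measurable (borel \<Otimes>\<^sub>M borel)"
    unfolding K_def by measurable
  have "(\<integral>\<^sup>+x. \<integral>\<^sup>+y. (case (trig_data r J \<phi> x, trig_data r J \<phi> y) of ((u1, v1, n1), (u2, v2, n2)) \<Rightarrow>
      ennreal \<bar>v1 * w2 - v2 * w1\<bar> * indicator {..1} (n1 + 2 * (z1 - u1)\<^sup>2 + (n2 + 2 * (z2 - u2)\<^sup>2))) \<partial>P \<partial>P) =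
    (\<integral>\<^sup>+x. (case trig_data r J \<phi> x of (u1, v1, n1) \<Rightarrow> K (v1, n1 + 2 * (z1 - u1)\<^sup>2)) \<partial>P)"
  proof (rule nn_integral_cong)
    fix x
    obtain u1 v1 n1 where x: "trig_data r J \<phi> x = (u1, v1, n1)" by (cases "trig_data r J \<phi> x")
    have "(\<integral>\<^sup>+y. (case trig_data r J \<phi> y of (u2, v2, n2) \<Rightarrow>
        (\<lambda>(v2, e2). ennreal \<bar>v1 * w2 - v2 * w1\<bar> * indicator {..1} (n1 + 2 * (z1 - u1)\<^sup>2 + e2))
          (v2, n2 + 2 * (z2 - u2)\<^sup>2)) \<partial>P) =
      ennreal (1 / sqrt m) * (\<integral>\<^sup>+t. \<integral>\<^sup>+q.
        (\<lambda>(v2, e2). ennreal \<bar>v1 * w2 - v2 * w1\<bar> * indicator {..1} (n1 + 2 * (z1 - u1)\<^sup>2 + e2))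
          (l * t, 2 * z2\<^sup>2 / m + t\<^sup>2 + q) \<partial>?Q \<partial>lborel)"
      by (rule red) measurable
    then show "(\<integral>\<^sup>+y. (case (trig_data r J \<phi> x, trig_data r J \<phi> y) of ((u1, v1, n1), (u2, v2, n2)) \<Rightarrow>
      ennreal \<bar>v1 * w2 - v2 * w1\<bar> * indicator {..1} (n1 + 2 * (z1 - u1)\<^sup>2 + (n2 + 2 * (z2 - u2)\<^sup>2))) \<partial>P) =
      (case trig_data r J \<phi> x of (u1, v1, n1) \<Rightarrow> K (v1, n1 + 2 * (z1 - u1)\<^sup>2))"
      by (simp add: x K_def)
  qed
  also have "\<dots> = ennreal (1 / sqrt m) * (\<integral>\<^sup>+s. \<integral>\<^sup>+p. K (l * s, 2 * z1\<^sup>2 / m + s\<^sup>2 + p) \<partial>?Q \<partial>lborel)"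
    by (rule red) measurable
  also have "(\<integral>\<^sup>+s. \<integral>\<^sup>+p. K (l * s, 2 * z1\<^sup>2 / m + s\<^sup>2 + p) \<partial>?Q \<partial>lborel) =
      ennreal (1 / sqrt m) * (\<integral>\<^sup>+s. \<integral>\<^sup>+t. ennreal l * (ennreal \<bar>s * w2 - t * w1\<bar> *
        ball_mass (4 * N - 2) (R - (s\<^sup>2 + t\<^sup>2))) \<partial>lborel \<partial>lborel)"
  proof -
    have "(\<integral>\<^sup>+p. K (l * s, 2 * z1\<^sup>2 / m + s\<^sup>2 + p) \<partial>?Q) =
        ennreal (1 / sqrt m) * (\<integral>\<^sup>+t. ennreal l * (ennreal \<bar>s * w2 - t * w1\<bar> *
          ball_mass (4 * N - 2) (R - (s\<^sup>2 + t\<^sup>2))) \<partial>lborel)" for s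
    proof -
      let ?f = "\<lambda>t. ennreal \<bar>(l * s) * w2 - (l * t) * w1\<bar>"
      let ?c = "\<lambda>t. 2 * z1\<^sup>2 / m + s\<^sup>2 + (2 * z2\<^sup>2 / m + t\<^sup>2)"
      have "(\<integral>\<^sup>+p. K (l * s, 2 * z1\<^sup>2 / m + s\<^sup>2 + p) \<partial>?Q) =
          ennreal (1 / sqrt m) * (\<integral>\<^sup>+p. \<integral>\<^sup>+t. \<integral>\<^sup>+q. ?f t * indicator {..1} (?c t + (p + q)) \<partial>?Q \<partial>lborel \<partial>?Q)"
        unfolding K_def prod.case by (subst nn_integral_cmult) (simp_all add: add_ac)
      \<comment> \<open>The radial remainders of the two components are brought together so that the
        semigroup law fuses them into one of dimension 4N - 2.\<close>
      also have "(\<integral>\<^sup>+p. \<integral>\<^sup>+t. \<integral>\<^sup>+q. ?f t * indicator {..1} (?c t + (p + q)) \<partial>?Q \<partial>lborel \<partial>?Q) =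
          (\<integral>\<^sup>+t. \<integral>\<^sup>+p. \<integral>\<^sup>+q. ?f t * indicator {..1} (?c t + (p + q)) \<partial>?Q \<partial>?Q \<partial>lborel)"
        by (rule sq_lborel.Fubini'[symmetric]) measurable
      also have "\<dots> = (\<integral>\<^sup>+t. \<integral>\<^sup>+q. ?f t * indicator {..1} (?c t + q) \<partial>sq_measure (2 * N - 1 + (2 * N - 1)) \<partial>lborel)"
        by (rule nn_integral_cong, rule nn_integral_sq_measure_add) measurable
      also have "\<dots> = (\<integral>\<^sup>+t. ?f t * ball_mass (2 * N - 1 + (2 * N - 1)) (1 - ?c t) \<partial>lborel)"
        by (simp add: nn_integral_cmult nn_integral_indicator_sq_measure)
      also have "2 * N - 1 + (2 * N - 1) = 4 * N - 2" by simp
      also have "(\<integral>\<^sup>+t. ?f t * ball_mass (4 * N - 2) (1 - ?c t) \<partial>lborel) = 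
          (\<integral>\<^sup>+t. ennreal l * (ennreal \<bar>s * w2 - t * w1\<bar> * ball_mass (4 * N - 2) (R - (s\<^sup>2 + t\<^sup>2))) \<partial>lborel)"
      proof (rule nn_integral_cong)
        fix t
        have "(l * s) * w2 - (l * t) * w1 = l * (s * w2 - t * w1)" by (simp add: algebra_simps)
        then have "?f t = ennreal l * ennreal \<bar>s * w2 - t * w1\<bar>"
          using l by (simp add: abs_mult ennreal_mult')
        moreover have "1 - ?c t = R - (s\<^sup>2 + t\<^sup>2)"
          by (simp add: R_def add_divide_distrib algebra_simps)
        ultimately show "?f t * ball_mass (4 * N - 2) (1 - ?c t) =
            ennreal l * (ennreal \<bar>s * w2 - t * w1\<bar> * ball_mass (4 * N - 2) (R - (s\<^sup>2 + t\<^sup>2)))"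
          by (simp only: mult.assoc)
      qed
      finally show ?thesis .
    qed
    then show ?thesis by (simp only:) (rule nn_integral_cmult, measurable)
  qed
  also have "(\<integral>\<^sup>+s. \<integral>\<^sup>+t. ennreal l * (ennreal \<bar>s * w2 - t * w1\<bar> *
        ball_mass (4 * N - 2) (R - (s\<^sup>2 + t\<^sup>2))) \<partial>lborel \<partial>lborel) =
      ennreal l * (\<integral>\<^sup>+s. \<integral>\<^sup>+t. ennreal \<bar>s * w2 - t * w1\<bar> *
        ball_mass (4 * N - 2) (R - (s\<^sup>2 + t\<^sup>2)) \<partial>lborel \<partial>lborel)"
    by (simp add: nn_integral_cmult)
  also have "(\<integral>\<^sup>+s. \<integral>\<^sup>+t. ennreal \<bar>s * w2 - t * w1\<bar> *
        ball_mass (4 * N - 2) (R - (s\<^sup>2 + t\<^sup>2)) \<partial>lborel \<partial>lborel) =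
      ennreal (sqrt (w1\<^sup>2 + w2\<^sup>2)) * (\<integral>\<^sup>+s. \<integral>\<^sup>+t. ennreal \<bar>s\<bar> *
        ball_mass (4 * N - 2) (R - (s\<^sup>2 + t\<^sup>2)) \<partial>lborel \<partial>lborel)"
    by (rule nn_integral_det_radial) measurable
  also have "(\<integral>\<^sup>+s. \<integral>\<^sup>+t. ennreal \<bar>s\<bar> * ball_mass (4 * N - 2) (R - (s\<^sup>2 + t\<^sup>2)) \<partial>lborel \<partial>lborel) =
      ennreal (1 / pi) * ball_mass (4 * N + 1) R"
  proof -
    have "4 * N - 2 + 3 = 4 * N + 1" using N by simp
    then have "ball_mass (4 * N + 1) R = ennreal pi * (\<integral>\<^sup>+s. \<integral>\<^sup>+t. ennreal \<bar>s\<bar> *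
        ball_mass (4 * N - 2) (R - (s\<^sup>2 + t\<^sup>2)) \<partial>lborel \<partial>lborel)"
      using nn_integral_abs_ball_mass[of "4 * N - 2" R] by simp
    then show ?thesis by (simp add: mult.assoc[symmetric] ennreal_mult'[symmetric])
  qed
  also have "ennreal (1 / sqrt m) * (ennreal (1 / sqrt m) * (ennreal l * (ennreal (sqrt (w1\<^sup>2 + w2\<^sup>2)) *
      (ennreal (1 / pi) * ball_mass (4 * N + 1) R)))) =
      (ennreal (1 / sqrt m) * ennreal (1 / sqrt m) * ennreal l * ennreal (1 / pi)) * ennreal (sqrt (w1\<^sup>2 + w2\<^sup>2)) *
      ball_mass (4 * N + 1) R"
    by (simp only: mult_ac)
  also have "ennreal (1 / sqrt m) * ennreal (1 / sqrt m) * ennreal l * ennreal (1 / pi) =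
      ennreal ((1 / sqrt m) * (1 / sqrt m) * l * (1 / pi))"
    using m l by (simp add: ennreal_mult'[symmetric])
  also have "(1 / sqrt m) * (1 / sqrt m) * l * (1 / pi) = l / (m * pi)"
    using m by simp
  finally show ?thesis unfolding J_def P_def l_def m_def R_def .
qed

text \<open>Joint law of position and velocity for a curve in the unit ball. The two components
  interact only through the sum of their squared norms, so their radial remainders fuse into a ball
  volume of dimension 4N - 2.\<close>

lemma nn_integral_ball_frames:
  fixes h :: "real \<times> real \<times> real \<times> real \<Rightarrow> ennreal"
  assumes N: "N \<ge> 1" and [measurable]: "h \<in> borel_measurable (borel \<Otimes>\<^sub>M borel \<Otimes>\<^sub>M borel \<Otimes>\<^sub>M borel)"
  shows "(\<integral>\<^sup>+x. \<integral>\<^sup>+y. (case (trig_data r {- int N..int N} \<phi> x, trig_data r {- int N..int N} \<phi> y) of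
        ((u1, v1, n1), (u2, v2, n2)) \<Rightarrow> h (u1, u2, v1, v2) * indicator {..1} (n1 + n2))
      \<partial>(\<Pi>\<^sub>M k\<in>{- int N..int N}. lborel) \<partial>(\<Pi>\<^sub>M k\<in>{- int N..int N}. lborel)) =
    (\<integral>\<^sup>+s1. \<integral>\<^sup>+s2. \<integral>\<^sup>+t1. \<integral>\<^sup>+t2. h (sqrt (mu r N / 2) * s1, sqrt (mu r N / 2) * s2, lam r N * t1, lam r N * t2) *
      ball_mass (4 * N - 2) (1 - (s1\<^sup>2 + s2\<^sup>2) - (t1\<^sup>2 + t2\<^sup>2)) \<partial>lborel \<partial>lborel \<partial>lborel \<partial>lborel)"
proof -
  define I P where "I = {- int N..int N}" and "P = (\<Pi>\<^sub>M k\<in>I. lborel :: real measure)"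
  define l c where "l = lam r N" and "c = sqrt (mu r N / 2)"
  let ?Q = "sq_measure (2 * N - 1)"
  note law = nn_integral_trig_data[where r = r and \<phi> = \<phi>, OF N, folded I_def, folded P_def, folded l_def, folded c_def]
  define K where "K = (\<lambda>(u1, v1, n1). \<integral>\<^sup>+s2. \<integral>\<^sup>+t2. \<integral>\<^sup>+q2. h (u1, c * s2, v1, l * t2) *
      indicator {..1} (n1 + (s2\<^sup>2 + t2\<^sup>2 + q2)) \<partial>?Q \<partial>lborel \<partial>lborel)"
  have [measurable]: "K \<in> borel_measurable (borel \<Otimes>\<^sub>M borel \<Otimes>\<^sub>M borel)"
    unfolding K_def by measurable
  let ?h = "\<lambda>s1 s2 t1 t2. h (c * s1, c * s2, l * t1, l * t2)"
  have "(\<integral>\<^sup>+x. \<integral>\<^sup>+y. (case (trig_data r I \<phi> x, trig_data r I \<phi> y) of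
        ((u1, v1, n1), (u2, v2, n2)) \<Rightarrow> h (u1, u2, v1, v2) * indicator {..1} (n1 + n2)) \<partial>P \<partial>P) =
      (\<integral>\<^sup>+x. K (trig_data r I \<phi> x) \<partial>P)"
  proof (rule nn_integral_cong)
    fix x
    obtain u1 v1 n1 where x: "trig_data r I \<phi> x = (u1, v1, n1)" by (cases "trig_data r I \<phi> x")
    have "(\<integral>\<^sup>+y. (\<lambda>(u2, v2, n2). h (u1, u2, v1, v2) * indicator {..1} (n1 + n2)) (trig_data r I \<phi> y) \<partial>P) =
      (\<integral>\<^sup>+s2. \<integral>\<^sup>+t2. \<integral>\<^sup>+q2. (\<lambda>(u2, v2, n2). h (u1, u2, v1, v2) * indicator {..1} (n1 + n2))
        (c * s2, l * t2, s2\<^sup>2 + t2\<^sup>2 + q2) \<partial>?Q \<partial>lborel \<partial>lborel)"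
      by (rule law) measurable
    then show "(\<integral>\<^sup>+y. (case (trig_data r I \<phi> x, trig_data r I \<phi> y) of
        ((u1, v1, n1), (u2, v2, n2)) \<Rightarrow> h (u1, u2, v1, v2) * indicator {..1} (n1 + n2)) \<partial>P) =
      K (trig_data r I \<phi> x)"
      by (simp add: x K_def)
  qed
  also have "\<dots> = (\<integral>\<^sup>+s1. \<integral>\<^sup>+t1. \<integral>\<^sup>+q1. K (c * s1, l * t1, s1\<^sup>2 + t1\<^sup>2 + q1) \<partial>?Q \<partial>lborel \<partial>lborel)"
    by (rule law) measurable
  also have "\<dots> = (\<integral>\<^sup>+s1. \<integral>\<^sup>+t1. \<integral>\<^sup>+s2. \<integral>\<^sup>+t2. ?h s1 s2 t1 t2 *
      ball_mass (4 * N - 2) (1 - (s1\<^sup>2 + s2\<^sup>2) - (t1\<^sup>2 + t2\<^sup>2)) \<partial>lborel \<partial>lborel \<partial>lborel \<partial>lborel)"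
  proof (rule nn_integral_cong, rule nn_integral_cong)
    fix s1 t1 :: real
    let ?e = "\<lambda>s2 t2. s1\<^sup>2 + s2\<^sup>2 + (t1\<^sup>2 + t2\<^sup>2)"
    have "(\<integral>\<^sup>+q1. K (c * s1, l * t1, s1\<^sup>2 + t1\<^sup>2 + q1) \<partial>?Q) =
        (\<integral>\<^sup>+q1. \<integral>\<^sup>+s2. \<integral>\<^sup>+t2. \<integral>\<^sup>+q2. ?h s1 s2 t1 t2 * indicator {..1} (?e s2 t2 + (q1 + q2))
          \<partial>?Q \<partial>lborel \<partial>lborel \<partial>?Q)"
      by (simp add: K_def add_ac)
    also have "\<dots> = (\<integral>\<^sup>+s2. \<integral>\<^sup>+q1. \<integral>\<^sup>+t2. \<integral>\<^sup>+q2. ?h s1 s2 t1 t2 * indicator {..1} (?e s2 t2 + (q1 + q2))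
          \<partial>?Q \<partial>lborel \<partial>?Q \<partial>lborel)"
      by (rule sq_lborel.Fubini'[symmetric]) measurable
    also have "\<dots> = (\<integral>\<^sup>+s2. \<integral>\<^sup>+t2. \<integral>\<^sup>+q1. \<integral>\<^sup>+q2. ?h s1 s2 t1 t2 * indicator {..1} (?e s2 t2 + (q1 + q2))
          \<partial>?Q \<partial>?Q \<partial>lborel \<partial>lborel)"
      by (rule nn_integral_cong, rule sq_lborel.Fubini'[symmetric]) measurable
    also have "\<dots> = (\<integral>\<^sup>+s2. \<integral>\<^sup>+t2. \<integral>\<^sup>+q. ?h s1 s2 t1 t2 * indicator {..1} (?e s2 t2 + q)
          \<partial>sq_measure (2 * N - 1 + (2 * N - 1)) \<partial>lborel \<partial>lborel)"
      by (rule nn_integral_cong, rule nn_integral_cong, rule nn_integral_sq_measure_add) measurable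
    also have "\<dots> = (\<integral>\<^sup>+s2. \<integral>\<^sup>+t2. ?h s1 s2 t1 t2 *
        ball_mass (2 * N - 1 + (2 * N - 1)) (1 - (s1\<^sup>2 + s2\<^sup>2) - (t1\<^sup>2 + t2\<^sup>2)) \<partial>lborel \<partial>lborel)"
      by (simp add: nn_integral_cmult nn_integral_indicator_sq_measure diff_diff_eq)
    also have "2 * N - 1 + (2 * N - 1) = 4 * N - 2" by simp
    finally show "(\<integral>\<^sup>+q1. K (c * s1, l * t1, s1\<^sup>2 + t1\<^sup>2 + q1) \<partial>?Q) = (\<integral>\<^sup>+s2. \<integral>\<^sup>+t2. ?h s1 s2 t1 t2 *
      ball_mass (4 * N - 2) (1 - (s1\<^sup>2 + s2\<^sup>2) - (t1\<^sup>2 + t2\<^sup>2)) \<partial>lborel \<partial>lborel)" .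
  qed
  also have "\<dots> = (\<integral>\<^sup>+s1. \<integral>\<^sup>+s2. \<integral>\<^sup>+t1. \<integral>\<^sup>+t2. ?h s1 s2 t1 t2 *
      ball_mass (4 * N - 2) (1 - (s1\<^sup>2 + s2\<^sup>2) - (t1\<^sup>2 + t2\<^sup>2)) \<partial>lborel \<partial>lborel \<partial>lborel \<partial>lborel)"
    by (rule nn_integral_cong, rule lborel_pair.Fubini') measurable
  finally show ?thesis unfolding I_def P_def l_def c_def .
qed

text \<open>The volume left from the first curve is averaged over the second. The normalisation sqrt
  (mu / 2) turns 2 (z1^2 + z2^2) / mu into s1^2 + s2^2, so this volume and the one arising from the
  speed of the second curve are both \<open>V s1 s2\<close>. Their product is integrated as the
  square of a ball volume with n = 4N + 1, whence the factor pi / (4N + 2).\<close>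

lemma nn_integral_speed_ball_mass:
  assumes N: "N \<ge> 1"
  shows "(\<integral>\<^sup>+x. \<integral>\<^sup>+y. (case (trig_data r {- int N..int N} \<phi> x, trig_data r {- int N..int N} \<phi> y) of
        ((z1, w1, n1), (z2, w2, n2)) \<Rightarrow> ennreal (sqrt (w1\<^sup>2 + w2\<^sup>2)) *
          ball_mass (4 * N + 1) (1 - 2 * (z1\<^sup>2 + z2\<^sup>2) / mu r N) * indicator {..1} (n1 + n2))
      \<partial>(\<Pi>\<^sub>M k\<in>{- int N..int N}. lborel) \<partial>(\<Pi>\<^sub>M k\<in>{- int N..int N}. lborel)) =
    ennreal (lam r N * (unit_ball_vol (real (4 * N + 1)))\<^sup>2 * pi / (2 * (real (4 * N) + 2)))"
proof -
  define m l where "m = mu r N" and "l = lam r N"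
  have m: "m > 0" and l: "l > 0" using mu_pos lam_pos[OF N] by (simp_all add: m_def l_def)
  define V where "V = (\<lambda>s1 s2. ball_mass (4 * N + 1) (1 - (s1\<^sup>2 + s2\<^sup>2)))"
  have [measurable]: "(\<lambda>p. V (fst p) (snd p)) \<in> borel_measurable (borel \<Otimes>\<^sub>M borel)"
    unfolding V_def by measurable
  define h where "h = (\<lambda>(z1 :: real, z2 :: real, w1 :: real, w2 :: real). ennreal (sqrt (w1\<^sup>2 + w2\<^sup>2)) *
    ball_mass (4 * N + 1) (1 - 2 * (z1\<^sup>2 + z2\<^sup>2) / m))"
  have [measurable]: "h \<in> borel_measurable (borel \<Otimes>\<^sub>M borel \<Otimes>\<^sub>M borel \<Otimes>\<^sub>M borel)"
    unfolding h_def by measurable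
  have h: "h (sqrt (m / 2) * s1, sqrt (m / 2) * s2, l * t1, l * t2) =
      ennreal l * V s1 s2 * ennreal (sqrt (t1\<^sup>2 + t2\<^sup>2))" for s1 s2 t1 t2
  proof -
    have "(l * t1)\<^sup>2 + (l * t2)\<^sup>2 = l\<^sup>2 * (t1\<^sup>2 + t2\<^sup>2)" by (simp add: power_mult_distrib distrib_left)
    then have "sqrt ((l * t1)\<^sup>2 + (l * t2)\<^sup>2) = l * sqrt (t1\<^sup>2 + t2\<^sup>2)"
      using l by (simp add: real_sqrt_mult)
    moreover have "2 * ((sqrt (m / 2) * s1)\<^sup>2 + (sqrt (m / 2) * s2)\<^sup>2) / m = s1\<^sup>2 + s2\<^sup>2"
      using m by (simp add: power_mult_distrib field_simps)
    ultimately show ?thesis using l by (simp add: h_def V_def ennreal_mult' mult_ac)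
  qed
  have "(\<integral>\<^sup>+x. \<integral>\<^sup>+y. (case (trig_data r {- int N..int N} \<phi> x, trig_data r {- int N..int N} \<phi> y) of
        ((u1, v1, n1), (u2, v2, n2)) \<Rightarrow> h (u1, u2, v1, v2) * indicator {..1} (n1 + n2))
      \<partial>(\<Pi>\<^sub>M k\<in>{- int N..int N}. lborel) \<partial>(\<Pi>\<^sub>M k\<in>{- int N..int N}. lborel)) =
    (\<integral>\<^sup>+s1. \<integral>\<^sup>+s2. \<integral>\<^sup>+t1. \<integral>\<^sup>+t2. ennreal l * V s1 s2 * (ennreal (sqrt (t1\<^sup>2 + t2\<^sup>2)) *
      ball_mass (4 * N - 2) (1 - (s1\<^sup>2 + s2\<^sup>2) - (t1\<^sup>2 + t2\<^sup>2))) \<partial>lborel \<partial>lborel \<partial>lborel \<partial>lborel)"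
    using nn_integral_ball_frames[OF N, of h r \<phi>] by (simp add: h[unfolded m_def l_def] m_def l_def mult.assoc)
  also have "\<dots> = (\<integral>\<^sup>+s1. \<integral>\<^sup>+s2. ennreal (l / 2) * (V s1 s2)\<^sup>2 \<partial>lborel \<partial>lborel)"
  proof (rule nn_integral_cong, rule nn_integral_cong)
    fix s1 s2 :: real
    let ?M = "\<integral>\<^sup>+t1. \<integral>\<^sup>+t2. ennreal (sqrt (t1\<^sup>2 + t2\<^sup>2)) *
      ball_mass (4 * N - 2) (1 - (s1\<^sup>2 + s2\<^sup>2) - (t1\<^sup>2 + t2\<^sup>2)) \<partial>lborel \<partial>lborel"
    have "4 * N - 2 + 3 = 4 * N + 1" using N by simp
    \<comment> \<open>The speed integral is half of V, because the norm weight raises the dimension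
      4N - 2 by three.\<close>
    then have V: "V s1 s2 = 2 * ?M"
      using nn_integral_norm_ball_mass[of "4 * N - 2" "1 - (s1\<^sup>2 + s2\<^sup>2)"] by (simp add: V_def)
    have "(\<integral>\<^sup>+t1. \<integral>\<^sup>+t2. ennreal l * V s1 s2 * (ennreal (sqrt (t1\<^sup>2 + t2\<^sup>2)) *
      ball_mass (4 * N - 2) (1 - (s1\<^sup>2 + s2\<^sup>2) - (t1\<^sup>2 + t2\<^sup>2))) \<partial>lborel \<partial>lborel) = ennreal l * V s1 s2 * ?M"
      by (simp add: nn_integral_cmult)
    also have "\<dots> = ennreal (l / 2) * 2 * V s1 s2 * ?M"
      using l by (simp add: ennreal_mult''[symmetric] flip: ennreal_numeral)
    also have "\<dots> = ennreal (l / 2) * (V s1 s2 * (2 * ?M))" by (simp only: mult_ac)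
    also have "2 * ?M = V s1 s2" by (rule V[symmetric])
    also have "V s1 s2 * V s1 s2 = (V s1 s2)\<^sup>2" by (simp only: power2_eq_square)
    finally show "(\<integral>\<^sup>+t1. \<integral>\<^sup>+t2. ennreal l * V s1 s2 * (ennreal (sqrt (t1\<^sup>2 + t2\<^sup>2)) *
      ball_mass (4 * N - 2) (1 - (s1\<^sup>2 + s2\<^sup>2) - (t1\<^sup>2 + t2\<^sup>2))) \<partial>lborel \<partial>lborel) =
      ennreal (l / 2) * (V s1 s2)\<^sup>2" .
  qed
  also have "\<dots> = ennreal (l / 2) * (\<integral>\<^sup>+s1. \<integral>\<^sup>+s2. (V s1 s2)\<^sup>2 \<partial>lborel \<partial>lborel)"
    unfolding V_def by (simp add: nn_integral_cmult)
  also have "(\<integral>\<^sup>+s1. \<integral>\<^sup>+s2. (V s1 s2)\<^sup>2 \<partial>lborel \<partial>lborel) =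
      ennreal ((unit_ball_vol (real (4 * N + 1)))\<^sup>2 * (pi / (real (4 * N + 1) + 1)))"
    unfolding V_def by (rule nn_integral_ball_mass_square) simp
  also have "ennreal (l / 2) * \<dots> = ennreal (l / 2 * ((unit_ball_vol (real (4 * N + 1)))\<^sup>2 * (pi / (real (4 * N + 1) + 1))))"
    using l by (simp add: ennreal_mult'[symmetric])
  also have "l / 2 * ((unit_ball_vol (real (4 * N + 1)))\<^sup>2 * (pi / (real (4 * N + 1) + 1))) =
      l * (unit_ball_vol (real (4 * N + 1)))\<^sup>2 * pi / (2 * (real (4 * N) + 2))"
    by (simp add: add.commute mult.assoc)
  finally show ?thesis by (simp add: h_def m_def l_def)
qed

section \<open>Intersections of translated curves\<close>

lemma has_real_derivative_frame:
  "(frame r k has_real_derivative frame_deriv r k \<phi>) (at \<phi>)"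
proof -
  have cos: "((\<lambda>\<phi>. cos (m * \<phi>) / s) has_real_derivative - m * sin (m * \<phi>) / s) (at \<phi>)"
    and sin: "((\<lambda>\<phi>. sin (m * \<phi>) / s) has_real_derivative m * cos (m * \<phi>) / s) (at \<phi>)"
    if "s \<noteq> 0" for m s :: real
    using that by (auto intro!: derivative_eq_intros simp: field_simps)
  have t: "sqrt (tau r j) \<noteq> 0" for j using tau_pos[of r j] by simp
  consider "k = 0" | "k > 0" | "k < 0" by linarith
  then show ?thesis
  proof cases
    case 1
    then show ?thesis by (simp add: frame_def[abs_def] frame_deriv_def)
  next
    case 2
    then have "frame r k = (\<lambda>\<phi>. cos (real (nat k) * \<phi>) / sqrt (tau r (nat k)))"
      by (auto simp: frame_def fun_eq_iff)
    then show ?thesis using 2 cos[OF t, of "real (nat k)" "nat k"] by (simp add: frame_deriv_def)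
  next
    case 3
    then have "frame r k = (\<lambda>\<phi>. sin (real (nat (- k)) * \<phi>) / sqrt (tau r (nat (- k))))"
      by (auto simp: frame_def fun_eq_iff)
    then show ?thesis using 3 sin[OF t, of "real (nat (- k))" "nat (- k)"] by (simp add: frame_deriv_def)
  qed
qed

lemma continuous_on_frame [continuous_intros]:
  assumes "continuous_on S g"
  shows "continuous_on S (\<lambda>x. frame r k (g x))"
proof -
  have "continuous_on UNIV (frame r k)"
    using has_real_derivative_frame[THEN DERIV_isCont] by (simp add: continuous_on_eq_continuous_at)
  from continuous_on_compose2[OF this assms] show ?thesis by simp
qed

lemma continuous_on_frame_deriv [continuous_intros]:
  fixes g :: "'a::t2_space \<Rightarrow> real"
  assumes "continuous_on S g"
  shows "continuous_on S (\<lambda>x. frame_deriv r k (g x))"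
proof -
  have t: "sqrt (tau r j) \<noteq> 0" for j using tau_pos[of r j] by simp
  consider "k = 0" | "k > 0" | "k < 0" by linarith
  then show ?thesis
  proof cases
    case 1
    then show ?thesis by (simp add: frame_deriv_def)
  next
    case 2
    have "continuous_on S (\<lambda>x. - real (nat k) * sin (real (nat k) * g x) / sqrt (tau r (nat k)))"
      by (intro continuous_intros assms ballI t)
    then show ?thesis using 2 unfolding frame_deriv_def by simp
  next
    case 3
    have "continuous_on S (\<lambda>x. real (nat (- k)) * cos (real (nat (- k)) * g x) / sqrt (tau r (nat (- k))))"
      by (intro continuous_intros assms ballI t)
    then show ?thesis using 3 unfolding frame_deriv_def by simp
  qed
qed

lemma measurable_frame [measurable]: "frame r k \<in> borel_measurable borel"
  by (intro borel_measurable_continuous_onI continuous_intros)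

lemma measurable_frame_deriv [measurable]: "frame_deriv r k \<in> borel_measurable borel"
  by (intro borel_measurable_continuous_onI continuous_intros)

definition trig_sum :: "nat \<Rightarrow> int set \<Rightarrow> (int \<Rightarrow> real) \<Rightarrow> real \<Rightarrow> real" where
  "trig_sum r I x \<phi> = (\<Sum>k\<in>I. x k * frame r k \<phi>)"

definition trig_sum_deriv :: "nat \<Rightarrow> int set \<Rightarrow> (int \<Rightarrow> real) \<Rightarrow> real \<Rightarrow> real" where
  "trig_sum_deriv r I x \<phi> = (\<Sum>k\<in>I. x k * frame_deriv r k \<phi>)"

definition sum_sq :: "int set \<Rightarrow> (int \<Rightarrow> real) \<Rightarrow> real" where
  "sum_sq I x = (\<Sum>k\<in>I. (x k)\<^sup>2)"

lemma trig_data_eq: "trig_data r I \<phi> x = (trig_sum r I x \<phi>, trig_sum_deriv r I x \<phi>, sum_sq I x)"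
  by (simp add: trig_data_def trig_sum_def trig_sum_deriv_def sum_sq_def)

lemma has_derivative_trig_sum:
  "(trig_sum r I x has_derivative (\<lambda>h. trig_sum_deriv r I x \<phi> * h)) (at \<phi>)"
  using has_real_derivative_frame unfolding trig_sum_def trig_sum_deriv_def has_field_derivative_def[symmetric]
  by (intro DERIV_sum DERIV_cmult)

lemma continuous_on_trig_sum [continuous_intros]:
  "continuous_on S g \<Longrightarrow> continuous_on S (\<lambda>p. trig_sum r I x (g p))"
  unfolding trig_sum_def by (intro continuous_intros)

lemma continuous_on_trig_sum_deriv [continuous_intros]:
  fixes g :: "'a::t2_space \<Rightarrow> real"
  shows "continuous_on S g \<Longrightarrow> continuous_on S (\<lambda>p. trig_sum_deriv r I x (g p))"
  unfolding trig_sum_deriv_def by (intro continuous_intros)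

lemma measurable_trig_sum [measurable (raw)]:
  assumes "f \<in> measurable M (\<Pi>\<^sub>M k\<in>I. lborel)" "g \<in> borel_measurable M"
  shows "(\<lambda>w. trig_sum r I (f w) (g w)) \<in> borel_measurable M"
  unfolding trig_sum_def
  using measurable_compose[OF assms(1) measurable_component_singleton] measurable_compose[OF assms(2) measurable_frame]
  by (intro borel_measurable_sum borel_measurable_times) simp_all

lemma measurable_trig_sum_deriv [measurable (raw)]:
  assumes "f \<in> measurable M (\<Pi>\<^sub>M k\<in>I. lborel)" "g \<in> borel_measurable M"
  shows "(\<lambda>w. trig_sum_deriv r I (f w) (g w)) \<in> borel_measurable M"
  unfolding trig_sum_deriv_def
  using measurable_compose[OF assms(1) measurable_component_singleton] measurable_compose[OF assms(2) measurable_frame_deriv]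
  by (intro borel_measurable_sum borel_measurable_times) simp_all

lemma measurable_sum_sq [measurable (raw)]:
  assumes "f \<in> measurable M (\<Pi>\<^sub>M k\<in>I. lborel)"
  shows "(\<lambda>w. sum_sq I (f w)) \<in> borel_measurable M"
  unfolding sum_sq_def
  using measurable_compose[OF assms measurable_component_singleton]
  by (intro borel_measurable_sum borel_measurable_power) simp_all

definition param_square :: "(real \<times> real) set" where
  "param_square = {0..<2 * pi} \<times> {0..<2 * pi}"

lemma intersection_number_frame_curve:
  "intersection_number (frame_curve r N p) (frame_curve r N p') =
    emeasure (count_space UNIV) {w \<in> param_square.
      trig_sum r {- int N..int N} (fst p) (fst w) = trig_sum r {- int N..int N} (fst p') (snd w) \<and>
      trig_sum r {- int N..int N} (snd p) (fst w) = trig_sum r {- int N..int N} (snd p') (snd w)}"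
  unfolding intersection_number_def param_square_def frame_curve_def trig_sum_def
  by (rule arg_cong[where f = "emeasure (count_space UNIV)"]) auto

text \<open>The two equations for an intersection are encoded as a single scalar equation: the sum
  of the absolute differences vanishes. This makes the count of zeros of a continuous function
  applicable.\<close>

lemma measurable_intersection_number_frame_curve [measurable]:
  "(\<lambda>w. intersection_number (frame_curve r N (fst w)) (frame_curve r N (snd w)))
    \<in> borel_measurable (coord_space N \<Otimes>\<^sub>M coord_space N)"
proof -
  let ?I = "{- int N..int N}"
  define \<Phi> where "\<Phi> w p =
    \<bar>trig_sum r ?I (fst (fst w)) (fst p) - trig_sum r ?I (fst (snd w)) (snd p)\<bar> +
    \<bar>trig_sum r ?I (snd (fst w)) (fst p) - trig_sum r ?I (snd (snd w)) (snd p)\<bar>"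
    for w :: "((int \<Rightarrow> real) \<times> (int \<Rightarrow> real)) \<times> ((int \<Rightarrow> real) \<times> (int \<Rightarrow> real))" and p :: "real \<times> real"
  have eq: "intersection_number (frame_curve r N (fst w)) (frame_curve r N (snd w)) =
      emeasure (count_space UNIV) {p \<in> {0..<2 * pi} \<times> {0..<2 * pi}. \<Phi> w p = 0}" for w
  proof -
    have "\<Phi> w p = 0 \<longleftrightarrow> trig_sum r ?I (fst (fst w)) (fst p) = trig_sum r ?I (fst (snd w)) (snd p) \<and>
      trig_sum r ?I (snd (fst w)) (fst p) = trig_sum r ?I (snd (snd w)) (snd p)" for p
      unfolding \<Phi>_def by (smt (verit))
    then show ?thesis unfolding intersection_number_frame_curve param_square_def by simp
  qed
  show ?thesis
    unfolding eq
  proof (rule measurable_count_zeros_square)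
    show "(\<lambda>w. \<Phi> w p) \<in> borel_measurable (coord_space N \<Otimes>\<^sub>M coord_space N)" for p
      unfolding \<Phi>_def coord_space_def by measurable
    show "continuous_on UNIV (\<Phi> w)" for w
      unfolding \<Phi>_def by (intro continuous_intros)
  qed
qed

text \<open>Solving the intersection equations for the constant coefficients gives c = (u p, v p),
  so the count is that of a fibre of a planar map. Each component carries sqrt 2 because the
  constant frame function is 1 / sqrt 2; together they give the factor 2 in the Jacobian. The number
  e stands for the squared norm of the nonconstant coordinates.\<close>

lemma nn_integral_translated_intersections:
  fixes x y x' y' :: "int \<Rightarrow> real" and e :: real and I J :: "int set" and r :: nat
  defines "u \<equiv> \<lambda>p. sqrt 2 * (trig_sum r I x' (snd p) - trig_sum r J x (fst p))"
    and "v \<equiv> \<lambda>p. sqrt 2 * (trig_sum r I y' (snd p) - trig_sum r J y (fst p))"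
  shows "(\<integral>\<^sup>+c. emeasure (count_space UNIV) {p \<in> param_square.
        fst c / sqrt 2 + trig_sum r J x (fst p) = trig_sum r I x' (snd p) \<and>
        snd c / sqrt 2 + trig_sum r J y (fst p) = trig_sum r I y' (snd p)} *
        indicator {..1} ((fst c)\<^sup>2 + (snd c)\<^sup>2 + e) \<partial>lborel) =
    (\<integral>\<^sup>+p. indicator param_square p * (2 * (ennreal \<bar>trig_sum_deriv r J x (fst p) * trig_sum_deriv r I y' (snd p) -
        trig_sum_deriv r J y (fst p) * trig_sum_deriv r I x' (snd p)\<bar> *
      indicator {..1} ((u p)\<^sup>2 + (v p)\<^sup>2 + e))) \<partial>lborel)"
proof -
  define u1 u2 v1 v2 where "u1 p = - sqrt 2 * trig_sum_deriv r J x (fst p)"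
    and "u2 p = sqrt 2 * trig_sum_deriv r I x' (snd p)"
    and "v1 p = - sqrt 2 * trig_sum_deriv r J y (fst p)"
    and "v2 p = sqrt 2 * trig_sum_deriv r I y' (snd p)" for p :: "real \<times> real"
  have c: "continuous_on UNIV u1" "continuous_on UNIV u2" "continuous_on UNIV v1" "continuous_on UNIV v2"
    unfolding u1_def u2_def v1_def v2_def by (intro continuous_intros)+
  have uc: "continuous_on UNIV u" "continuous_on UNIV v"
    unfolding u_def v_def by (intro continuous_intros)+
  then have [measurable]: "u \<in> borel_measurable borel" "v \<in> borel_measurable borel"
    by (blast intro: borel_measurable_continuous_onI)+
  have der: "((\<lambda>p. trig_sum r K z (fst p)) has_derivative (\<lambda>h. trig_sum_deriv r K z (fst p) * fst h)) (at p)"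
    "((\<lambda>p. trig_sum r K z (snd p)) has_derivative (\<lambda>h. trig_sum_deriv r K z (snd p) * snd h)) (at p)"
    for K z and p :: "real \<times> real"
    using has_derivative_compose[OF has_derivative_fst[OF has_derivative_ident] has_derivative_trig_sum]
      has_derivative_compose[OF has_derivative_snd[OF has_derivative_ident] has_derivative_trig_sum] by blast+
  have du: "(u has_derivative (\<lambda>h. u1 p * fst h + u2 p * snd h)) (at p)"
    and dv: "(v has_derivative (\<lambda>h. v1 p * fst h + v2 p * snd h)) (at p)" for p
    unfolding u_def u1_def u2_def v_def v1_def v2_def
    by (rule has_derivative_eq_rhs[OF has_derivative_mult_right[OF has_derivative_diff[OF der(2) der(1)]]],
        simp add: fun_eq_iff algebra_simps)+
  \<comment> \<open>On the fibre over c the ball condition on c is a condition on p, so it can be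
    moved from the integrand into the domain of the map.\<close>
  define D where "D = {p \<in> param_square. (u p)\<^sup>2 + (v p)\<^sup>2 + e \<le> 1}"
  have P: "param_square \<in> sets borel"
    unfolding param_square_def borel_prod[symmetric] by measurable
  note [measurable] = this
  have D: "D \<in> sets borel" unfolding D_def by measurable
  have "param_square \<subseteq> cbox (0, 0) (2 * pi, 2 * pi)" by (auto simp: param_square_def)
  then have bD: "bounded D" unfolding D_def by (intro bounded_subset[OF bounded_cbox]) auto
  have iff: "fst c / sqrt 2 + trig_sum r J x (fst p) = trig_sum r I x' (snd p) \<and>
      snd c / sqrt 2 + trig_sum r J y (fst p) = trig_sum r I y' (snd p) \<longleftrightarrow> (u p, v p) = c" for c p
    unfolding u_def v_def by (cases c) (auto simp: field_simps)
  have count: "emeasure (count_space UNIV) {p \<in> D. (u p, v p) = c} =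
      emeasure (count_space UNIV) {p \<in> param_square. (u p, v p) = c} *
        indicator {..1} ((fst c)\<^sup>2 + (snd c)\<^sup>2 + e)" for c
  proof (cases "(fst c)\<^sup>2 + (snd c)\<^sup>2 + e \<le> 1")
    case True
    then have "{p \<in> D. (u p, v p) = c} = {p \<in> param_square. (u p, v p) = c}" by (auto simp: D_def)
    then show ?thesis using True by simp
  next
    case False
    then have *: "{p \<in> D. (u p, v p) = c} = {}" by (auto simp: D_def)
    show ?thesis unfolding * using False by simp
  qed
  \<comment> \<open>Measurability in c is obtained by the same encoding as a scalar equation, with c
    as the parameter.\<close>
  have "(\<lambda>c. emeasure (count_space UNIV) {p \<in> {0..<2 * pi} \<times> {0..<2 * pi}.
      \<bar>u p - fst c\<bar> + \<bar>v p - snd c\<bar> = 0}) \<in> borel_measurable borel"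
  proof (rule measurable_count_zeros_square)
    fix p :: "real \<times> real"
    show "(\<lambda>c. \<bar>u p - fst c\<bar> + \<bar>v p - snd c\<bar>) \<in> borel_measurable borel"
      by (intro borel_measurable_continuous_onI continuous_intros)
  qed (intro continuous_intros uc)
  moreover have "\<bar>u p - fst c\<bar> + \<bar>v p - snd c\<bar> = 0 \<longleftrightarrow> (u p, v p) = c" for p c
    by (cases c) (auto simp: add_nonneg_eq_0_iff)
  ultimately have [measurable]: "(\<lambda>c. emeasure (count_space UNIV) {p \<in> param_square. (u p, v p) = c}) \<in> borel_measurable borel"
    unfolding param_square_def by simp
  have [measurable]: "(\<lambda>c :: real \<times> real. (fst c)\<^sup>2 + (snd c)\<^sup>2 + e) \<in> borel_measurable borel"
    by (intro borel_measurable_continuous_onI continuous_intros)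
  have meas: "(\<lambda>c. emeasure (count_space UNIV) {p \<in> D. (u p, v p) = c}) \<in> borel_measurable borel"
    unfolding count by measurable
  have "(\<integral>\<^sup>+c. emeasure (count_space UNIV) {p \<in> D. (u p, v p) = c} \<partial>lborel) =
      (\<integral>\<^sup>+p. ennreal \<bar>u1 p * v2 p - u2 p * v1 p\<bar> * indicator D p \<partial>lborel)"
    by (rule area_formula_plane[OF du dv c D bD meas])
  also have "\<dots> = (\<integral>\<^sup>+p. indicator param_square p * (2 * (ennreal \<bar>trig_sum_deriv r J x (fst p) * trig_sum_deriv r I y' (snd p) -
        trig_sum_deriv r J y (fst p) * trig_sum_deriv r I x' (snd p)\<bar> *
      indicator {..1} ((u p)\<^sup>2 + (v p)\<^sup>2 + e))) \<partial>lborel)"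
  proof (rule nn_integral_cong)
    fix p
    let ?d = "trig_sum_deriv r J x (fst p) * trig_sum_deriv r I y' (snd p) -
        trig_sum_deriv r J y (fst p) * trig_sum_deriv r I x' (snd p)"
    have "u1 p * v2 p - u2 p * v1 p = (sqrt 2 * sqrt 2) * (- ?d)"
      unfolding u1_def u2_def v1_def v2_def by algebra
    then have "\<bar>u1 p * v2 p - u2 p * v1 p\<bar> = 2 * \<bar>?d\<bar>"
      by (simp only: abs_mult abs_minus_cancel) simp
    then have "ennreal \<bar>u1 p * v2 p - u2 p * v1 p\<bar> = 2 * ennreal \<bar>?d\<bar>"
      by (simp add: ennreal_mult')
    moreover have "(indicator D p :: ennreal) = indicator param_square p * indicator {..1} ((u p)\<^sup>2 + (v p)\<^sup>2 + e)"
      by (simp add: D_def indicator_def)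
    ultimately show "ennreal \<bar>u1 p * v2 p - u2 p * v1 p\<bar> * indicator D p =
      indicator param_square p * (2 * (ennreal \<bar>?d\<bar> * indicator {..1} ((u p)\<^sup>2 + (v p)\<^sup>2 + e)))"
      by (simp only: mult_ac)
  qed
  finally show ?thesis unfolding count iff .
qed

section \<open>The average intersection number\<close>

lemma sigma_finite_PiM_lborel: "finite I \<Longrightarrow> sigma_finite_measure (\<Pi>\<^sub>M k\<in>I. lborel :: real measure)"
proof -
  assume I: "finite I"
  interpret product_sigma_finite "\<lambda>_. lborel :: real measure" by standard
  show ?thesis using sigma_finite[OF I] .
qed

lemma measurable_update_zero [measurable (raw)]:
  assumes "f \<in> measurable M (\<Pi>\<^sub>M k\<in>nonzero_indices N. lborel)" "g \<in> borel_measurable M"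
  shows "(\<lambda>w. (f w)(0 := g w)) \<in> measurable M (\<Pi>\<^sub>M k\<in>{- int N..int N}. lborel)"
proof -
  have "(\<lambda>w. (f w, g w)) \<in> measurable M ((\<Pi>\<^sub>M k\<in>nonzero_indices N. lborel) \<Otimes>\<^sub>M lborel)"
    using assms by (intro measurable_Pair) simp_all
  from measurable_compose[OF this measurable_add_dim[of 0 "nonzero_indices N" "\<lambda>_. lborel"]]
  show ?thesis by (simp add: insert_zero_nonzero_indices)
qed

lemma sigma_finite_coord_space: "sigma_finite_measure (coord_space N)"
  unfolding coord_space_def
  by (intro sigma_finite_pair_measure sigma_finite_PiM_lborel) simp_all

lemma nn_integral_coord_space:
  assumes [measurable]: "H \<in> borel_measurable (coord_space N)"
  shows "(\<integral>\<^sup>+p. H p \<partial>coord_space N) = (\<integral>\<^sup>+x. \<integral>\<^sup>+y. H (x, y)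
    \<partial>(\<Pi>\<^sub>M k\<in>{- int N..int N}. lborel) \<partial>(\<Pi>\<^sub>M k\<in>{- int N..int N}. lborel))"
proof -
  interpret sigma_finite_measure "\<Pi>\<^sub>M k\<in>{- int N..int N}. lborel :: real measure"
    by (intro sigma_finite_PiM_lborel) simp
  show ?thesis
    using nn_integral_fst[of H "\<Pi>\<^sub>M k\<in>{- int N..int N}. lborel"] assms by (simp add: coord_space_def)
qed

text \<open>Tonelli with the two constant coefficients innermost and joined to a point c of the
  plane, which is the variable of the area formula.\<close>

lemma nn_integral_coord_space_split:
  assumes [measurable]: "H \<in> borel_measurable (coord_space N)"
  shows "(\<integral>\<^sup>+p. H p \<partial>coord_space N) = (\<integral>\<^sup>+x. \<integral>\<^sup>+y. \<integral>\<^sup>+c. H (x(0 := fst c), y(0 := snd c))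
    \<partial>(lborel :: (real \<times> real) measure) \<partial>(\<Pi>\<^sub>M k\<in>nonzero_indices N. lborel) \<partial>(\<Pi>\<^sub>M k\<in>nonzero_indices N. lborel))"
proof -
  define I J PI PJ where "I = {- int N..int N}" and "J = nonzero_indices N"
    and "PI = (\<Pi>\<^sub>M k\<in>I. lborel :: real measure)" and "PJ = (\<Pi>\<^sub>M k\<in>J. lborel :: real measure)"
  interpret product_sigma_finite "\<lambda>_::int. lborel :: real measure" by standard
  interpret PI: sigma_finite_measure PI unfolding PI_def I_def by (intro sigma_finite_PiM_lborel) simp
  interpret PJ: sigma_finite_measure PJ unfolding PJ_def J_def by (intro sigma_finite_PiM_lborel) simp
  interpret PJ_lborel: pair_sigma_finite PJ "lborel :: real measure" by standard
  have I: "I = insert 0 J" "finite J" "0 \<notin> J"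
    by (simp_all add: I_def J_def insert_zero_nonzero_indices)
  have H [measurable]: "H \<in> borel_measurable (PI \<Otimes>\<^sub>M PI)"
    using assms by (simp add: coord_space_def PI_def I_def)
  have ins: "(\<integral>\<^sup>+x. f x \<partial>PI) = (\<integral>\<^sup>+x. \<integral>\<^sup>+c. f (x(0 := c)) \<partial>lborel \<partial>PJ)"
    if "f \<in> borel_measurable PI" for f
    using product_nn_integral_insert[OF I(2,3), of f] that unfolding PI_def PJ_def I(1) by simp
  have "(\<integral>\<^sup>+p. H p \<partial>coord_space N) = (\<integral>\<^sup>+x. \<integral>\<^sup>+y. H (x, y) \<partial>PI \<partial>PI)"
    unfolding PI_def I_def by (rule nn_integral_coord_space) measurable
  also have "\<dots> = (\<integral>\<^sup>+x. \<integral>\<^sup>+y. \<integral>\<^sup>+d. H (x, y(0 := d)) \<partial>lborel \<partial>PJ \<partial>PI)"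
    by (intro nn_integral_cong ins) measurable
  also have "\<dots> = (\<integral>\<^sup>+x. \<integral>\<^sup>+c. \<integral>\<^sup>+y. \<integral>\<^sup>+d. H (x(0 := c), y(0 := d)) \<partial>lborel \<partial>PJ \<partial>lborel \<partial>PJ)"
  proof (rule ins)
    show "(\<lambda>x. \<integral>\<^sup>+y. \<integral>\<^sup>+d. H (x, y(0 := d)) \<partial>lborel \<partial>PJ) \<in> borel_measurable PI"
      unfolding PI_def PJ_def I_def J_def
    proof -
      let ?PI = "\<Pi>\<^sub>M k\<in>{- int N..int N}. lborel :: real measure"
      let ?PJ = "\<Pi>\<^sub>M k\<in>nonzero_indices N. lborel :: real measure"
      interpret q: sigma_finite_measure ?PJ by (intro sigma_finite_PiM_lborel) simp
      note [measurable] = H[unfolded PI_def I_def]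
      show "(\<lambda>x. \<integral>\<^sup>+y. \<integral>\<^sup>+d. H (x, y(0 := d)) \<partial>lborel \<partial>?PJ) \<in> borel_measurable ?PI"
        by measurable
    qed
  qed
  also have "\<dots> = (\<integral>\<^sup>+x. \<integral>\<^sup>+y. \<integral>\<^sup>+c. \<integral>\<^sup>+d. H (x(0 := c), y(0 := d)) \<partial>lborel \<partial>lborel \<partial>PJ \<partial>PJ)"
  proof (rule nn_integral_cong, rule PJ_lborel.Fubini')
    fix x assume x: "x \<in> space PJ"
    note [measurable] = H[unfolded PI_def I_def]
    have [measurable]: "x \<in> space (\<Pi>\<^sub>M k\<in>nonzero_indices N. lborel)" using x by (simp add: PJ_def J_def)
    show "(\<lambda>(y, c). \<integral>\<^sup>+d. H (x(0 := c), y(0 := d)) \<partial>lborel) \<in> borel_measurable (PJ \<Otimes>\<^sub>M lborel)"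
      unfolding PJ_def J_def by measurable
  qed
  also have "\<dots> = (\<integral>\<^sup>+x. \<integral>\<^sup>+y. \<integral>\<^sup>+c. H (x(0 := fst c), y(0 := snd c)) \<partial>lborel \<partial>PJ \<partial>PJ)"
  proof (rule nn_integral_cong, rule nn_integral_cong)
    fix x y assume xy: "x \<in> space PJ" "y \<in> space PJ"
    note [measurable] = H[unfolded PI_def I_def]
    have [measurable]: "x \<in> space (\<Pi>\<^sub>M k\<in>nonzero_indices N. lborel)" "y \<in> space (\<Pi>\<^sub>M k\<in>nonzero_indices N. lborel)"
      using xy by (simp_all add: PJ_def J_def)
    have "(\<integral>\<^sup>+c. \<integral>\<^sup>+d. (\<lambda>c. H (x(0 := fst c), y(0 := snd c))) (c, d) \<partial>lborel \<partial>lborel) =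
        (\<integral>\<^sup>+c. H (x(0 := fst c), y(0 := snd c)) \<partial>(lborel \<Otimes>\<^sub>M lborel))"
      by (rule lborel.nn_integral_fst) measurable
    then show "(\<integral>\<^sup>+c. \<integral>\<^sup>+d. H (x(0 := c), y(0 := d)) \<partial>lborel \<partial>lborel) =
        (\<integral>\<^sup>+c. H (x(0 := fst c), y(0 := snd c)) \<partial>lborel)"
      by (simp add: lborel_prod)
  qed
  finally show ?thesis unfolding PJ_def J_def .
qed

lemma trig_sum_update_zero:
  "trig_sum r {- int N..int N} (x(0 := c)) \<phi> = c / sqrt 2 + trig_sum r (nonzero_indices N) x \<phi>"
proof -
  have "(\<Sum>k\<in>nonzero_indices N. (x(0 := c)) k * frame r k \<phi>) = (\<Sum>k\<in>nonzero_indices N. x k * frame r k \<phi>)"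
    by (intro sum.cong) (auto simp: nonzero_indices_def)
  then show ?thesis
    unfolding trig_sum_def insert_zero_nonzero_indices[symmetric] by (simp add: frame_def)
qed

lemma sum_sq_update_zero:
  "sum_sq {- int N..int N} (x(0 := c)) = c\<^sup>2 + sum_sq (nonzero_indices N) x"
proof -
  have "(\<Sum>k\<in>nonzero_indices N. ((x(0 := c)) k)\<^sup>2) = (\<Sum>k\<in>nonzero_indices N. (x k)\<^sup>2)"
    by (intro sum.cong) (auto simp: nonzero_indices_def)
  then show ?thesis
    unfolding sum_sq_def insert_zero_nonzero_indices[symmetric] by simp
qed

definition ball_indicator :: "nat \<Rightarrow> (int \<Rightarrow> real) \<times> (int \<Rightarrow> real) \<Rightarrow> ennreal" where
  "ball_indicator N p = indicator {..1} (sum_sq {- int N..int N} (fst p) + sum_sq {- int N..int N} (snd p))"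

lemma measurable_ball_indicator [measurable]: "ball_indicator N \<in> borel_measurable (coord_space N)"
  unfolding ball_indicator_def[abs_def] coord_space_def by measurable

text \<open>Each component has 2N + 1 coordinates; the semigroup law joins their radial laws to that
  of R^(4N+2).\<close>

lemma nn_integral_ball_indicator:
  "(\<integral>\<^sup>+p. ball_indicator N p \<partial>coord_space N) = ennreal (unit_ball_vol (real (4 * N + 2)))"
proof -
  let ?I = "{- int N..int N}"
  let ?P = "\<Pi>\<^sub>M k\<in>?I. lborel :: real measure"
  have card: "card ?I = 2 * N + 1" by simp
  have "(\<integral>\<^sup>+p. ball_indicator N p \<partial>coord_space N) =
      (\<integral>\<^sup>+x. \<integral>\<^sup>+y. indicator {..1} (sum_sq ?I x + sum_sq ?I y) \<partial>?P \<partial>?P)"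
    by (subst nn_integral_coord_space) (simp_all add: ball_indicator_def)
  also have "\<dots> = (\<integral>\<^sup>+x. \<integral>\<^sup>+q. indicator {..1} (sum_sq ?I x + q) \<partial>sq_measure (2 * N + 1) \<partial>?P)"
    unfolding sum_sq_def card[symmetric]
    by (rule nn_integral_cong, rule nn_integral_PiM_sum_squares) simp_all
  also have "\<dots> = (\<integral>\<^sup>+p. \<integral>\<^sup>+q. indicator {..1} (p + q) \<partial>sq_measure (2 * N + 1) \<partial>sq_measure (2 * N + 1))"
    unfolding sum_sq_def card[symmetric]
    by (rule nn_integral_PiM_sum_squares[where h = "\<lambda>p. \<integral>\<^sup>+q. indicator {..1} (p + q) \<partial>sq_measure _"]) simp_all
  also have "\<dots> = (\<integral>\<^sup>+q. indicator {..1} q \<partial>sq_measure (2 * N + 1 + (2 * N + 1)))"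
    by (rule nn_integral_sq_measure_add) simp
  also have "2 * N + 1 + (2 * N + 1) = 4 * N + 2" by simp
  also have "(\<integral>\<^sup>+q. indicator {..1} q \<partial>sq_measure (4 * N + 2)) = ball_mass (4 * N + 2) 1"
    using nn_integral_indicator_sq_measure[where c = 0 and k = "4 * N + 2"] by simp
  finally show ?thesis by (simp add: ball_mass_def emeasure_sq_measure_atMost)
qed

lemma emeasure_param_square: "emeasure lborel param_square = ennreal (4 * pi\<^sup>2)"
proof -
  have "emeasure lborel param_square =
      emeasure (lborel \<Otimes>\<^sub>M lborel) ({0..<2 * pi} \<times> {0..<2 * pi} :: (real \<times> real) set)"
    by (simp add: param_square_def lborel_prod)
  also have "\<dots> = emeasure lborel {0..<2 * pi} * emeasure lborel {0..<2 * pi}"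
    by (rule lborel.emeasure_pair_measure_Times) simp_all
  also have "\<dots> = ennreal (2 * pi * (2 * pi))" by (simp add: ennreal_mult'[symmetric])
  finally show ?thesis by (simp add: power2_eq_square)
qed

text \<open>The second curve g is kept outermost, because the constant coefficients of f are
  integrated with g fixed. For fixed parameters (phi, psi) the remaining integral over both curves
  is the same at every point, so the integral over the parameter square only multiplies it by 4
  pi^2.\<close>

theorem nn_integral_intersection_number:
  assumes N: "N \<ge> 1"
  shows "(\<integral>\<^sup>+w. intersection_number (frame_curve r N (fst w)) (frame_curve r N (snd w)) *
      (ball_indicator N (fst w) * ball_indicator N (snd w)) \<partial>(coord_space N \<Otimes>\<^sub>M coord_space N)) =
    ennreal (2 * pi\<^sup>2 * (lam r N)\<^sup>2 * (unit_ball_vol (real (4 * N + 1)))\<^sup>2 / (mu r N * (2 * real N + 1)))"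
proof -
  define I J where "I = {- int N..int N}" and "J = nonzero_indices N"
  define PI PJ where "PI = (\<Pi>\<^sub>M k\<in>I. lborel :: real measure)" and "PJ = (\<Pi>\<^sub>M k\<in>J. lborel :: real measure)"
  let ?C = "coord_space N"
  interpret C: sigma_finite_measure ?C by (rule sigma_finite_coord_space)
  interpret CC: pair_sigma_finite ?C ?C by standard
  interpret PJ: sigma_finite_measure PJ unfolding PJ_def J_def by (intro sigma_finite_PiM_lborel) simp
  interpret PJl: pair_sigma_finite PJ "lborel :: (real \<times> real) measure" by standard
  interpret Cl: pair_sigma_finite ?C "lborel :: (real \<times> real) measure" by standard
  define m l where "m = mu r N" and "l = lam r N"
  have m: "m > 0" and l: "l > 0" using mu_pos lam_pos[OF N] by (simp_all add: m_def l_def)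
  \<comment> \<open>The squared norm of the first curve once its constant coefficients are expressed
    through the intersection condition at p; x and y are its nonconstant coordinates and g holds the
    coordinates of the second curve.\<close>
  define n :: "(real \<times> real) \<Rightarrow> (int \<Rightarrow> real) \<Rightarrow> (int \<Rightarrow> real) \<Rightarrow> (int \<Rightarrow> real) \<times> (int \<Rightarrow> real) \<Rightarrow> real"
    where "n p x y g = (sqrt 2 * (trig_sum r I (fst g) (snd p) - trig_sum r J x (fst p)))\<^sup>2 +
        (sqrt 2 * (trig_sum r I (snd g) (snd p) - trig_sum r J y (fst p)))\<^sup>2 + (sum_sq J x + sum_sq J y)" for p x y g
  define A where "A p x y g = indicator param_square p * (2 * (ennreal \<bar>trig_sum_deriv r J x (fst p) * trig_sum_deriv r I (snd g) (snd p) -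
        trig_sum_deriv r J y (fst p) * trig_sum_deriv r I (fst g) (snd p)\<bar> * indicator {..1} (n p x y g)))" for p x y g
  have bsq [measurable]: "param_square \<in> sets (borel \<Otimes>\<^sub>M borel)" unfolding param_square_def by measurable
  have C_eq: "?C = PI \<Otimes>\<^sub>M PI" by (simp add: coord_space_def PI_def I_def)
  \<comment> \<open>Stated for arbitrary measurable arguments, so that every interchange below can
    use it on its own ordering and nesting of the product spaces.\<close>
  have Ameas: "(\<lambda>w. A (P w) (X w) (Y w) (G w)) \<in> borel_measurable M"
    if "P \<in> measurable M (borel \<Otimes>\<^sub>M borel)" "X \<in> measurable M PJ" "Y \<in> measurable M PJ" "G \<in> measurable M ?C"
    for P X Y G and M :: "'z measure"
  proof -
    note [measurable] = that(1) that(2,3)[unfolded PJ_def] that(4)[unfolded C_eq PI_def]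
    show ?thesis unfolding A_def n_def by measurable
  qed
  have "(\<integral>\<^sup>+w. intersection_number (frame_curve r N (fst w)) (frame_curve r N (snd w)) *
      (ball_indicator N (fst w) * ball_indicator N (snd w)) \<partial>(?C \<Otimes>\<^sub>M ?C)) =
    (\<integral>\<^sup>+g. \<integral>\<^sup>+f. intersection_number (frame_curve r N f) (frame_curve r N g) *
      (ball_indicator N f * ball_indicator N g) \<partial>?C \<partial>?C)"
  proof -
    have "(\<lambda>w. intersection_number (frame_curve r N (fst w)) (frame_curve r N (snd w)) *
      (ball_indicator N (fst w) * ball_indicator N (snd w))) \<in> borel_measurable (?C \<Otimes>\<^sub>M ?C)"
      by measurable
    from CC.nn_integral_snd[OF this] show ?thesis by simp
  qed
  also have "\<dots> = (\<integral>\<^sup>+g. ball_indicator N g * (\<integral>\<^sup>+x. \<integral>\<^sup>+y. \<integral>\<^sup>+p. A p x y g \<partial>lborel \<partial>PJ \<partial>PJ) \<partial>?C)"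
  proof (rule nn_integral_cong)
    fix g assume g: "g \<in> space ?C"
    have [measurable]: "(\<lambda>f. intersection_number (frame_curve r N f) (frame_curve r N g)) \<in> borel_measurable ?C"
      using measurable_compose[OF measurable_Pair2'[OF g, of ?C] measurable_intersection_number_frame_curve] by simp
    have "(\<integral>\<^sup>+f. intersection_number (frame_curve r N f) (frame_curve r N g) *
        (ball_indicator N f * ball_indicator N g) \<partial>?C) =
      (\<integral>\<^sup>+f. ball_indicator N g * (intersection_number (frame_curve r N f) (frame_curve r N g) * ball_indicator N f) \<partial>?C)"
      by (simp only: mult_ac)
    also have "\<dots> = ball_indicator N g *
        (\<integral>\<^sup>+f. intersection_number (frame_curve r N f) (frame_curve r N g) * ball_indicator N f \<partial>?C)"
      by (rule nn_integral_cmult) measurable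
    also have "(\<integral>\<^sup>+f. intersection_number (frame_curve r N f) (frame_curve r N g) * ball_indicator N f \<partial>?C) =
      (\<integral>\<^sup>+x. \<integral>\<^sup>+y. \<integral>\<^sup>+c. intersection_number (frame_curve r N (x(0 := fst c), y(0 := snd c))) (frame_curve r N g) *
        ball_indicator N (x(0 := fst c), y(0 := snd c)) \<partial>lborel \<partial>PJ \<partial>PJ)"
      unfolding PJ_def J_def by (rule nn_integral_coord_space_split) measurable
    also have "\<dots> = (\<integral>\<^sup>+x. \<integral>\<^sup>+y. \<integral>\<^sup>+p. A p x y g \<partial>lborel \<partial>PJ \<partial>PJ)"
    proof (rule nn_integral_cong, rule nn_integral_cong)
      fix x y
      have "ball_indicator N (x(0 := fst c), y(0 := snd c)) =
          indicator {..1} ((fst c)\<^sup>2 + (snd c)\<^sup>2 + (sum_sq J x + sum_sq J y))" for c :: "real \<times> real"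
        by (simp add: ball_indicator_def sum_sq_update_zero J_def add_ac)
      then show "(\<integral>\<^sup>+c. intersection_number (frame_curve r N (x(0 := fst c), y(0 := snd c))) (frame_curve r N g) *
        ball_indicator N (x(0 := fst c), y(0 := snd c)) \<partial>lborel) = (\<integral>\<^sup>+p. A p x y g \<partial>lborel)"
        unfolding A_def n_def nn_integral_translated_intersections[symmetric]
        by (simp add: intersection_number_frame_curve trig_sum_update_zero I_def J_def)
    qed
    finally show "(\<integral>\<^sup>+f. intersection_number (frame_curve r N f) (frame_curve r N g) *
        (ball_indicator N f * ball_indicator N g) \<partial>?C) =
      ball_indicator N g * (\<integral>\<^sup>+x. \<integral>\<^sup>+y. \<integral>\<^sup>+p. A p x y g \<partial>lborel \<partial>PJ \<partial>PJ)" .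
  qed
  \<comment> \<open>The parameter pair is moved outwards, past the coordinates of f here and past
    those of g afterwards. Once it is fixed, the laws at \<open>fst p\<close> and
    \<open>snd p\<close> apply.\<close>
  also have "\<dots> = (\<integral>\<^sup>+g. \<integral>\<^sup>+p. ball_indicator N g * (\<integral>\<^sup>+x. \<integral>\<^sup>+y. A p x y g \<partial>PJ \<partial>PJ) \<partial>lborel \<partial>?C)"
  proof (rule nn_integral_cong)
    fix g assume g [measurable]: "g \<in> space ?C"
    have "(\<integral>\<^sup>+x. \<integral>\<^sup>+y. \<integral>\<^sup>+p. A p x y g \<partial>lborel \<partial>PJ \<partial>PJ) = (\<integral>\<^sup>+x. \<integral>\<^sup>+p. \<integral>\<^sup>+y. A p x y g \<partial>PJ \<partial>lborel \<partial>PJ)"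
    proof (rule nn_integral_cong, rule PJl.Fubini'[symmetric])
      fix x assume [measurable]: "x \<in> space PJ"
      show "(\<lambda>(y, p). A p x y g) \<in> borel_measurable (PJ \<Otimes>\<^sub>M lborel)"
        unfolding case_prod_unfold by (rule Ameas) (simp_all add: borel_prod)
    qed
    also have "\<dots> = (\<integral>\<^sup>+p. \<integral>\<^sup>+x. \<integral>\<^sup>+y. A p x y g \<partial>PJ \<partial>PJ \<partial>lborel)"
    proof (rule PJl.Fubini'[symmetric])
      have "(\<lambda>w. A (snd (fst w)) (fst (fst w)) (snd w) g) \<in> borel_measurable ((PJ \<Otimes>\<^sub>M lborel) \<Otimes>\<^sub>M PJ)"
        by (rule Ameas) (simp_all add: borel_prod)
      then show "(\<lambda>(x, p). \<integral>\<^sup>+y. A p x y g \<partial>PJ) \<in> borel_measurable (PJ \<Otimes>\<^sub>M lborel)"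
        unfolding case_prod_unfold by (intro PJ.borel_measurable_nn_integral) (simp add: case_prod_unfold)
    qed
    finally have eq: "(\<integral>\<^sup>+x. \<integral>\<^sup>+y. \<integral>\<^sup>+p. A p x y g \<partial>lborel \<partial>PJ \<partial>PJ) =
        (\<integral>\<^sup>+p. \<integral>\<^sup>+x. \<integral>\<^sup>+y. A p x y g \<partial>PJ \<partial>PJ \<partial>lborel)" .
    have "(\<lambda>w. A (fst (fst w)) (snd (fst w)) (snd w) g) \<in> borel_measurable ((lborel \<Otimes>\<^sub>M PJ) \<Otimes>\<^sub>M PJ)"
      by (rule Ameas) (simp_all add: borel_prod)
    then have "(\<lambda>p. \<integral>\<^sup>+x. \<integral>\<^sup>+y. A p x y g \<partial>PJ \<partial>PJ) \<in> borel_measurable lborel"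
      by (intro PJ.borel_measurable_nn_integral) (simp add: case_prod_unfold)
    then show "ball_indicator N g * (\<integral>\<^sup>+x. \<integral>\<^sup>+y. \<integral>\<^sup>+p. A p x y g \<partial>lborel \<partial>PJ \<partial>PJ) =
        (\<integral>\<^sup>+p. ball_indicator N g * (\<integral>\<^sup>+x. \<integral>\<^sup>+y. A p x y g \<partial>PJ \<partial>PJ) \<partial>lborel)"
      unfolding eq by (rule nn_integral_cmult[symmetric])
  qed
  also have "\<dots> = (\<integral>\<^sup>+p. \<integral>\<^sup>+g. ball_indicator N g * (\<integral>\<^sup>+x. \<integral>\<^sup>+y. A p x y g \<partial>PJ \<partial>PJ) \<partial>?C \<partial>lborel)"
  proof (rule Cl.Fubini'[symmetric])
    have "(\<lambda>w. A (snd (fst (fst w))) (snd (fst w)) (snd w) (fst (fst (fst w)))) \<in>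
        borel_measurable (((?C \<Otimes>\<^sub>M lborel) \<Otimes>\<^sub>M PJ) \<Otimes>\<^sub>M PJ)"
      by (rule Ameas) (simp_all add: borel_prod)
    then have "(\<lambda>w. \<integral>\<^sup>+x. \<integral>\<^sup>+y. A (snd w) x y (fst w) \<partial>PJ \<partial>PJ) \<in> borel_measurable (?C \<Otimes>\<^sub>M lborel)"
      by (intro PJ.borel_measurable_nn_integral) (simp add: case_prod_unfold)
    then show "(\<lambda>(g, p). ball_indicator N g * (\<integral>\<^sup>+x. \<integral>\<^sup>+y. A p x y g \<partial>PJ \<partial>PJ)) \<in> borel_measurable (?C \<Otimes>\<^sub>M lborel)"
      unfolding case_prod_unfold by measurable
  qed
  \<comment> \<open>The integral over all curves no longer depends on p, apart from the indicator of
    the parameter square.\<close>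
  also have "\<dots> = (\<integral>\<^sup>+p. ennreal (l\<^sup>2 * (unit_ball_vol (real (4 * N + 1)))\<^sup>2 / (2 * m * (2 * real N + 1))) * indicator param_square p \<partial>lborel)"
  proof (rule nn_integral_cong)
    fix p :: "real \<times> real"
    let ?k = "ennreal (l / (m * pi))"
    define S where "S = (\<lambda>(x', y'). ennreal (sqrt ((trig_sum_deriv r I x' (snd p))\<^sup>2 + (trig_sum_deriv r I y' (snd p))\<^sup>2)) *
        ball_mass (4 * N + 1) (1 - 2 * ((trig_sum r I x' (snd p))\<^sup>2 + (trig_sum r I y' (snd p))\<^sup>2) / m))"
    have [measurable]: "S \<in> borel_measurable ?C"
      unfolding S_def coord_space_def I_def by measurable
    \<comment> \<open>After integrating out f, the second curve enters only through S: its speed at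
      \<open>snd p\<close> times a ball volume determined by its position there.\<close>
    have inner: "(\<integral>\<^sup>+x. \<integral>\<^sup>+y. A p x y g \<partial>PJ \<partial>PJ) = indicator param_square p * (2 * (?k * S g))" for g
    proof -
      obtain x' y' where g: "g = (x', y')" by (cases g)
      define B where "B x y = ennreal \<bar>trig_sum_deriv r J x (fst p) * trig_sum_deriv r I y' (snd p) -
          trig_sum_deriv r J y (fst p) * trig_sum_deriv r I x' (snd p)\<bar> *
          indicator {..1} (sum_sq J x + 2 * (trig_sum r I x' (snd p) - trig_sum r J x (fst p))\<^sup>2 +
            (sum_sq J y + 2 * (trig_sum r I y' (snd p) - trig_sum r J y (fst p))\<^sup>2))" for x y
      have A: "A p x y g = indicator param_square p * 2 * B x y" for x y
        by (simp add: A_def B_def g n_def power_mult_distrib add_ac mult.assoc)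
      have B: "(\<integral>\<^sup>+x. \<integral>\<^sup>+y. B x y \<partial>PJ \<partial>PJ) = ?k * S g"
        using nn_integral_det_nonzero_frames[where r = r and \<phi> = "fst p" and
          ?w2.0 = "trig_sum_deriv r I y' (snd p)" and ?w1.0 = "trig_sum_deriv r I x' (snd p)" and
          ?z1.0 = "trig_sum r I x' (snd p)" and ?z2.0 = "trig_sum r I y' (snd p)", OF N]
        by (simp add: trig_data_eq B_def[abs_def] S_def g PJ_def J_def l_def m_def mult.assoc)
      have Bm [measurable]: "(\<lambda>w. B (fst w) (snd w)) \<in> borel_measurable (PJ \<Otimes>\<^sub>M PJ)"
        unfolding B_def PJ_def by measurable
      have "(\<integral>\<^sup>+x. \<integral>\<^sup>+y. A p x y g \<partial>PJ \<partial>PJ) = (\<integral>\<^sup>+x. indicator param_square p * 2 * (\<integral>\<^sup>+y. B x y \<partial>PJ) \<partial>PJ)"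
        unfolding A
      proof (intro nn_integral_cong nn_integral_cmult)
        fix x assume "x \<in> space PJ"
        then show "B x \<in> borel_measurable PJ"
          using measurable_compose[OF measurable_Pair1' Bm] by simp
      qed
      also have "\<dots> = indicator param_square p * 2 * (\<integral>\<^sup>+x. \<integral>\<^sup>+y. B x y \<partial>PJ \<partial>PJ)"
        using Bm by (intro nn_integral_cmult PJ.borel_measurable_nn_integral) (simp add: case_prod_unfold)
      finally show ?thesis unfolding B by (simp only: mult.assoc)
    qed
    have "(\<integral>\<^sup>+g. ball_indicator N g * (\<integral>\<^sup>+x. \<integral>\<^sup>+y. A p x y g \<partial>PJ \<partial>PJ) \<partial>?C) =
        (\<integral>\<^sup>+g. (indicator param_square p * (2 * ?k)) * (S g * ball_indicator N g) \<partial>?C)"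
      unfolding inner by (simp only: mult_ac)
    also have "\<dots> = indicator param_square p * (2 * ?k) * (\<integral>\<^sup>+g. S g * ball_indicator N g \<partial>?C)"
      by (rule nn_integral_cmult) measurable
    also have "(\<integral>\<^sup>+g. S g * ball_indicator N g \<partial>?C) =
        ennreal (l * (unit_ball_vol (real (4 * N + 1)))\<^sup>2 * pi / (2 * (real (4 * N) + 2)))"
    proof -
      have "(\<integral>\<^sup>+g. S g * ball_indicator N g \<partial>?C) = (\<integral>\<^sup>+x. \<integral>\<^sup>+y. S (x, y) * ball_indicator N (x, y) \<partial>PI \<partial>PI)"
        unfolding PI_def I_def by (rule nn_integral_coord_space) measurable
      then show ?thesis
        using nn_integral_speed_ball_mass[where r = r and \<phi> = "snd p", OF N]
        by (simp add: trig_data_eq S_def ball_indicator_def PI_def I_def l_def m_def)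
    qed
    also have "indicator param_square p * (2 * ?k) *
        ennreal (l * (unit_ball_vol (real (4 * N + 1)))\<^sup>2 * pi / (2 * (real (4 * N) + 2))) =
      (2 * ?k * ennreal (l * (unit_ball_vol (real (4 * N + 1)))\<^sup>2 * pi / (2 * (real (4 * N) + 2)))) * indicator param_square p"
      by (simp only: mult_ac)
    also have "2 * ?k * ennreal (l * (unit_ball_vol (real (4 * N + 1)))\<^sup>2 * pi / (2 * (real (4 * N) + 2))) =
        ennreal (2 * (l / (m * pi)) * (l * (unit_ball_vol (real (4 * N + 1)))\<^sup>2 * pi / (2 * (real (4 * N) + 2))))"
      using l m by (simp add: ennreal_mult'[symmetric] flip: ennreal_numeral)
    also have "2 * (l / (m * pi)) * (l * (unit_ball_vol (real (4 * N + 1)))\<^sup>2 * pi / (2 * (real (4 * N) + 2))) =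
        l\<^sup>2 * (unit_ball_vol (real (4 * N + 1)))\<^sup>2 / (2 * m * (2 * real N + 1))"
    proof -
      have "real (4 * N) + 2 = 2 * (2 * real N + 1)" by simp
      then show ?thesis using m by (simp only:) (simp add: power2_eq_square divide_simps)
    qed
    finally show "(\<integral>\<^sup>+g. ball_indicator N g * (\<integral>\<^sup>+x. \<integral>\<^sup>+y. A p x y g \<partial>PJ \<partial>PJ) \<partial>?C) =
      ennreal (l\<^sup>2 * (unit_ball_vol (real (4 * N + 1)))\<^sup>2 / (2 * m * (2 * real N + 1))) * indicator param_square p" .
  qed
  also have "\<dots> = ennreal (l\<^sup>2 * (unit_ball_vol (real (4 * N + 1)))\<^sup>2 / (2 * m * (2 * real N + 1))) * ennreal (4 * pi\<^sup>2)"
    unfolding emeasure_param_square[symmetric]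
    by (rule nn_integral_cmult_indicator) (use bsq in \<open>simp only: borel_prod sets_lborel\<close>)
  also have "\<dots> = ennreal (l\<^sup>2 * (unit_ball_vol (real (4 * N + 1)))\<^sup>2 / (2 * m * (2 * real N + 1)) * (4 * pi\<^sup>2))"
    by (rule ennreal_mult''[symmetric]) simp
  also have "l\<^sup>2 * (unit_ball_vol (real (4 * N + 1)))\<^sup>2 / (2 * m * (2 * real N + 1)) * (4 * pi\<^sup>2) =
      2 * pi\<^sup>2 * l\<^sup>2 * (unit_ball_vol (real (4 * N + 1)))\<^sup>2 / (m * (2 * real N + 1))"
    using m by (simp add: divide_simps)
  finally show ?thesis by (simp add: m_def l_def)
qed

section \<open>Transfer from coordinates to the space of curves\<close>

definition curve_coords :: "nat \<Rightarrow> nat \<Rightarrow> (real \<Rightarrow> real \<times> real) \<Rightarrow> (int \<Rightarrow> real) \<times> (int \<Rightarrow> real)" where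
  "curve_coords r N = the_inv_into (space (coord_space N)) (frame_curve r N)"

lemma curve_coords_frame_curve:
  "p \<in> space (coord_space N) \<Longrightarrow> curve_coords r N (frame_curve r N p) = p"
  unfolding curve_coords_def by (rule the_inv_into_f_f[OF inj_on_frame_curve])

lemma measurable_frame_curve [measurable]:
  "frame_curve r N \<in> measurable (coord_space N) (W2_volume r N)"
  unfolding W2_volume_def by (rule measurable_embed_measure2'[OF inj_on_frame_curve])

lemma measurable_curve_coords [measurable]:
  "curve_coords r N \<in> measurable (W2_volume r N) (coord_space N)"
  unfolding W2_volume_def
proof (rule measurable_embed_measure1)
  show "(\<lambda>p. curve_coords r N (frame_curve r N p)) \<in> measurable (coord_space N) (coord_space N)"
    by (subst measurable_cong[where g = "\<lambda>p. p"]) (simp_all add: curve_coords_frame_curve)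
qed

lemma W2_volume_eq_distr: "W2_volume r N = distr (coord_space N) (W2_volume r N) (frame_curve r N)"
  unfolding W2_volume_def by (rule embed_measure_eq_distr'[OF inj_on_frame_curve])

lemma frame_curve_curve_coords:
  assumes "f \<in> space (W2_volume r N)"
  shows "frame_curve r N (curve_coords r N f) = f"
proof -
  obtain p where "p \<in> space (coord_space N)" "f = frame_curve r N p"
    using assms by (auto simp: W2_volume_def space_embed_measure)
  then show ?thesis by (simp add: curve_coords_frame_curve)
qed

text \<open>The image under \<open>curve_coords\<close> is the coordinate measure again, and
  sigma-finiteness of an image measure passes back to the original.\<close>

lemma sigma_finite_W2_volume: "sigma_finite_measure (W2_volume r N)"
proof (rule sigma_finite_measure_distr)
  have "distr (W2_volume r N) (coord_space N) (curve_coords r N) =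
      distr (coord_space N) (coord_space N) (curve_coords r N \<circ> frame_curve r N)"
    by (subst W2_volume_eq_distr) (rule distr_distr; measurable)
  also have "\<dots> = distr (coord_space N) (coord_space N) (\<lambda>p. p)"
    by (rule distr_cong) (simp_all add: curve_coords_frame_curve)
  finally show "sigma_finite_measure (distr (W2_volume r N) (coord_space N) (curve_coords r N))"
    using sigma_finite_coord_space by (simp add: distr_id)
qed measurable

lemma W2_volume_pair_eq_distr:
  "W2_volume r N \<Otimes>\<^sub>M W2_volume r N = distr (coord_space N \<Otimes>\<^sub>M coord_space N) (W2_volume r N \<Otimes>\<^sub>M W2_volume r N)
     (\<lambda>(p, p'). (frame_curve r N p, frame_curve r N p'))"
proof -
  have "sigma_finite_measure (distr (coord_space N) (W2_volume r N) (frame_curve r N))"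
    using sigma_finite_W2_volume W2_volume_eq_distr by simp
  from pair_measure_distr[OF measurable_frame_curve measurable_frame_curve this]
  show ?thesis unfolding W2_volume_eq_distr[symmetric] .
qed

text \<open>The intersection number factors through the measurable coordinate maps, since
  \<open>frame_curve\<close> recovers every curve from its coordinates.\<close>

lemma measurable_intersection_number:
  "(\<lambda>(f, g). intersection_number f g) \<in> borel_measurable (W2_volume r N \<Otimes>\<^sub>M W2_volume r N)"
proof -
  have "(\<lambda>w. (\<lambda>w. intersection_number (frame_curve r N (fst w)) (frame_curve r N (snd w)))
      (curve_coords r N (fst w), curve_coords r N (snd w)))
    \<in> borel_measurable (W2_volume r N \<Otimes>\<^sub>M W2_volume r N)"
    by (rule measurable_compose[OF _ measurable_intersection_number_frame_curve]) measurable
  then show ?thesis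
    by (rule measurable_cong[THEN iffD1, rotated])
      (auto simp: space_pair_measure frame_curve_curve_coords)
qed

text \<open>The frame is orthonormal, so the Sobolev unit ball corresponds to the Euclidean unit
  ball of the coordinates.\<close>

lemma indicator_W2_unit_ball:
  assumes "p \<in> space (coord_space N)"
  shows "indicator (W2_unit_ball r N) (frame_curve r N p) = ball_indicator N p"
proof -
  have "frame_curve r N p \<in> trig_curves N"
    using assms unfolding space_W2_volume[of r, symmetric] by (auto simp: W2_volume_def space_embed_measure)
  then show ?thesis
    by (simp add: W2_unit_ball_def W2_dot_frame_curve ball_indicator_def sum_sq_def indicator_def power2_eq_square)
qed

text \<open>The indicator is the coordinate indicator composed with \<open>curve_coords\<close>, and
  measurability of the indicator gives that of the set.\<close>

lemma sets_W2_unit_ball: "W2_unit_ball r N \<in> sets (W2_volume r N)"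
proof -
  have "(\<lambda>f. ball_indicator N (curve_coords r N f)) \<in> borel_measurable (W2_volume r N)" by measurable
  moreover have "ball_indicator N (curve_coords r N f) = indicator (W2_unit_ball r N) f"
    if "f \<in> space (W2_volume r N)" for f
    using indicator_W2_unit_ball[of "curve_coords r N f" N r] that measurable_space[OF measurable_curve_coords that]
    by (simp add: frame_curve_curve_coords)
  ultimately have "(indicator (W2_unit_ball r N) :: _ \<Rightarrow> ennreal) \<in> borel_measurable (W2_volume r N)"
    by (simp cong: measurable_cong)
  moreover have "W2_unit_ball r N \<inter> space (W2_volume r N) = W2_unit_ball r N"
    by (auto simp: space_W2_volume W2_unit_ball_def)
  ultimately show ?thesis by (simp add: borel_measurable_indicator_iff)
qed

lemma emeasure_W2_unit_ball:
  "emeasure (W2_volume r N) (W2_unit_ball r N) = ennreal (unit_ball_vol (real (4 * N + 2)))"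
proof -
  note [measurable] = sets_W2_unit_ball
  have "emeasure (W2_volume r N) (W2_unit_ball r N) = (\<integral>\<^sup>+f. indicator (W2_unit_ball r N) f \<partial>W2_volume r N)"
    by simp
  also have "\<dots> = (\<integral>\<^sup>+p. indicator (W2_unit_ball r N) (frame_curve r N p) \<partial>coord_space N)"
    by (subst W2_volume_eq_distr, subst nn_integral_distr) measurable
  also have "\<dots> = (\<integral>\<^sup>+p. ball_indicator N p \<partial>coord_space N)"
    by (intro nn_integral_cong indicator_W2_unit_ball)
  finally show ?thesis by (simp add: nn_integral_ball_indicator)
qed

text \<open>The closed forms of ball volumes in odd and even dimension. In the odd one, 2 (2N + 1)
  is cancelled between the powers of two and factorials of the numerator and (4N + 2)!, leaving only
  (2N)! and (4N + 1)!. The powers of pi differ by one, which produces the pi^2 in the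
  denominator.\<close>

lemma unit_ball_vol_quotient:
  "(unit_ball_vol (real (4 * N + 1)) / unit_ball_vol (real (4 * N + 2)))\<^sup>2 =
    2 ^ (8 * N + 2) * fact (2 * N) ^ 4 * (2 * real N + 1)\<^sup>2 / (pi\<^sup>2 * (fact (4 * N + 1))\<^sup>2)"
proof -
  have odd: "unit_ball_vol (real (4 * N + 1)) = 2 ^ (4 * N + 1) * fact (2 * N) / fact (4 * N + 1) * pi ^ (2 * N)"
  proof -
    have a: "2 * real N + 1 \<noteq> 0" by linarith
    have cancel: "2 * P * (a * F) / (2 * a * G) = P * F / G" if "a \<noteq> 0" for P a F G :: real
      using that by simp
    have "2 * (2 * N) + 1 = 4 * N + 1" by simp
    then have "unit_ball_vol (real (4 * N + 1)) =
        2 ^ (2 * Suc (2 * N)) * fact (Suc (2 * N)) / fact (2 * Suc (2 * N)) * pi ^ (2 * N)"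
      using unit_ball_vol_odd[of "2 * N"] by (simp only:)
    also have "(2 :: real) ^ (2 * Suc (2 * N)) = 2 * 2 ^ (4 * N + 1)" by simp
    also have "(fact (Suc (2 * N)) :: real) = (2 * real N + 1) * fact (2 * N)" by simp
    also have "2 * Suc (2 * N) = Suc (4 * N + 1)" by simp
    also have "(fact (Suc (4 * N + 1)) :: real) = 2 * (2 * real N + 1) * fact (4 * N + 1)"
      by (simp only: fact_Suc) (simp add: algebra_simps)
    finally show ?thesis by (simp only: cancel[OF a])
  qed
  have even: "unit_ball_vol (real (4 * N + 2)) = pi * pi ^ (2 * N) / fact (2 * N + 1)"
    using unit_ball_vol_even[of "2 * N + 1"] by (simp add: algebra_simps)
  have "unit_ball_vol (real (4 * N + 1)) / unit_ball_vol (real (4 * N + 2)) =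
      2 ^ (4 * N + 1) * fact (2 * N) * fact (2 * N + 1) / (pi * fact (4 * N + 1))"
    unfolding odd even by (simp add: mult_ac)
  also have "fact (2 * N + 1) = (2 * real N + 1) * fact (2 * N)" by simp
  finally have "unit_ball_vol (real (4 * N + 1)) / unit_ball_vol (real (4 * N + 2)) =
      2 ^ (4 * N + 1) * (fact (2 * N))\<^sup>2 * (2 * real N + 1) / (pi * fact (4 * N + 1))"
    by (simp add: power2_eq_square mult_ac)
  moreover have "(2 ^ (4 * N + 1))\<^sup>2 = (2 ^ (8 * N + 2) :: real)"
    by (simp add: power_mult[symmetric] mult.commute)
  moreover have "((fact (2 * N) :: real)\<^sup>2)\<^sup>2 = fact (2 * N) ^ 4" by simp
  ultimately show ?thesis by (simp only: power_divide power_mult_distrib)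
qed

theorem theorem2:
  fixes N r :: nat
  assumes "N \<ge> 1"
  shows "(\<integral>\<^sup>+ (f, g). intersection_number f g
            \<partial>uniform_measure (W2_volume r N \<Otimes>\<^sub>M W2_volume r N) (W2_unit_ball r N \<times> W2_unit_ball r N)) =
         ennreal (2 ^ (8 * N + 3) * (lam r N)\<^sup>2 * fact (2 * N) ^ 4 * real (2 * N + 1) /
                  (mu r N * (fact (4 * N + 1))\<^sup>2))"
proof -
  let ?W = "W2_volume r N" and ?B = "W2_unit_ball r N" and ?C = "coord_space N"
  interpret W: sigma_finite_measure ?W by (rule sigma_finite_W2_volume)
  note [measurable] = sets_W2_unit_ball measurable_intersection_number
  have [measurable]: "?B \<times> ?B \<in> sets (?W \<Otimes>\<^sub>M ?W)" by measurable
  define v1 v2 where "v1 = unit_ball_vol (real (4 * N + 1))" and "v2 = unit_ball_vol (real (4 * N + 2))"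
  \<comment> \<open>The integral of the intersection number over the product of the two balls,
    before division by the product of their volumes.\<close>
  define X where "X = 2 * pi\<^sup>2 * (lam r N)\<^sup>2 * v1\<^sup>2 / (mu r N * (2 * real N + 1))"
  have v: "v2 > 0" unfolding v2_def by (rule unit_ball_vol_pos) simp
  have X: "X \<ge> 0" unfolding X_def using mu_pos[of r N] by simp
  have "(\<integral>\<^sup>+ w. (case w of (f, g) \<Rightarrow> intersection_number f g) * indicator (?B \<times> ?B) w \<partial>(?W \<Otimes>\<^sub>M ?W)) =
      (\<integral>\<^sup>+ w. intersection_number (frame_curve r N (fst w)) (frame_curve r N (snd w)) *
        indicator (?B \<times> ?B) (frame_curve r N (fst w), frame_curve r N (snd w)) \<partial>(?C \<Otimes>\<^sub>M ?C))"
    by (subst W2_volume_pair_eq_distr, subst nn_integral_distr) (measurable, simp add: case_prod_unfold)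
  also have "\<dots> = (\<integral>\<^sup>+ w. intersection_number (frame_curve r N (fst w)) (frame_curve r N (snd w)) *
        (ball_indicator N (fst w) * ball_indicator N (snd w)) \<partial>(?C \<Otimes>\<^sub>M ?C))"
    by (intro nn_integral_cong)
      (auto simp: indicator_times indicator_W2_unit_ball space_pair_measure)
  also have "\<dots> = ennreal X"
    unfolding X_def v1_def by (rule nn_integral_intersection_number[OF assms])
  finally have num: "(\<integral>\<^sup>+ w. (case w of (f, g) \<Rightarrow> intersection_number f g) * indicator (?B \<times> ?B) w \<partial>(?W \<Otimes>\<^sub>M ?W)) = ennreal X" .
  have "emeasure (?W \<Otimes>\<^sub>M ?W) (?B \<times> ?B) = emeasure ?W ?B * emeasure ?W ?B"
    by (rule W.emeasure_pair_measure_Times) measurable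
  then have den: "emeasure (?W \<Otimes>\<^sub>M ?W) (?B \<times> ?B) = ennreal (v2\<^sup>2)"
    using v by (simp add: emeasure_W2_unit_ball v2_def ennreal_mult'[symmetric] power2_eq_square)
  have "(\<integral>\<^sup>+ (f, g). intersection_number f g \<partial>uniform_measure (?W \<Otimes>\<^sub>M ?W) (?B \<times> ?B)) = ennreal X / ennreal (v2\<^sup>2)"
    by (subst nn_integral_uniform_measure) (measurable, simp only: num den)
  also have "\<dots> = ennreal (X / v2\<^sup>2)" using X v by (simp add: divide_ennreal)
  also have "X / v2\<^sup>2 = 2 * pi\<^sup>2 * (lam r N)\<^sup>2 / (mu r N * (2 * real N + 1)) * (v1 / v2)\<^sup>2"
    by (simp add: X_def power_divide)
  also have "\<dots> = 2 ^ (8 * N + 3) * (lam r N)\<^sup>2 * fact (2 * N) ^ 4 * real (2 * N + 1) /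
                  (mu r N * (fact (4 * N + 1))\<^sup>2)"
  \<comment> \<open>The squared volume ratio contributes (2N + 1)^2, of which one factor cancels
    against the denominator of X; pi^2 cancels completely, and the leading 2 raises the power of two
    to 8N + 3.\<close>
  proof -
    define a b c d e :: real where "a = 2 * real N + 1" and "b = mu r N" and "c = (fact (4 * N + 1))\<^sup>2"
      and "d = fact (2 * N) ^ 4" and "e = pi\<^sup>2"
    have nz: "a \<noteq> 0" "b \<noteq> 0" "c \<noteq> 0" "e \<noteq> 0"
      using mu_pos[of r N] by (simp_all add: a_def b_def c_def e_def)
    have "2 * e * (lam r N)\<^sup>2 / (b * a) * (2 ^ (8 * N + 2) * d * a\<^sup>2 / (e * c)) =
        2 * 2 ^ (8 * N + 2) * (lam r N)\<^sup>2 * d * a / (b * c)"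
      using nz by (simp add: divide_simps power2_eq_square)
    also have "2 * 2 ^ (8 * N + 2) = (2 ^ (8 * N + 3) :: real)" by (simp add: power_add)
    finally have "2 * e * (lam r N)\<^sup>2 / (b * a) * (2 ^ (8 * N + 2) * d * a\<^sup>2 / (e * c)) =
        2 ^ (8 * N + 3) * (lam r N)\<^sup>2 * d * a / (b * c)" .
    moreover have "real (2 * N + 1) = a" by (simp add: a_def)
    ultimately show ?thesis
      unfolding v1_def v2_def unit_ball_vol_quotient
      by (simp only: a_def[symmetric] b_def[symmetric] c_def[symmetric] d_def[symmetric] e_def[symmetric])
  qed
  finally show ?thesis .
qed

end
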